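(* Let $\mathcal{K}:H^1_0(\Omega)\to H^{-1}(\Omega)$ be any compact linear operator. Then the following statements (i)–(ii) hold: (i) For all $0<\theta\le1$ and $C_{\rm mark}\ge1$, there exist $\ell_0\in\mathbb{N}_0$, $C_{\rm lin}>0$, and $0<q_{\rm lin}<1$ such that Algorithm B guarantees that, for all $\ell,n\in\mathbb{N}_0$ with $n\ge\ell\ge\ell_0$, $$\big[\eta_n(u_n)^2+\zeta_n(z_n[u_n])^2\big]\le C_{\rm lin}\,q_{\rm lin}^{\,n-\ell}\,\big[\eta_\ell(u_\ell)^2+\zeta_\ell(z_\ell[u_\ell])^2\big].$$ (ii) There exist $C_{\rm opt}>0$ and $\ell_0\in\mathbb{N}_0$ such that Algorithm B guarantees that, for all $0<\theta<\theta_{\rm opt}:=(1+C_{\rm stab}^2C_{\rm drel}^2)^{-1}$, for all $s,t>0$ with $\|u\|_{\mathbb{A}_s}+\|z[u]\|_{\mathbb{A}_t}<\infty$, and all $\ell\in\mathbb{N}_0$ with $\ell\ge\ell_0$, it holds that $$\big[\eta_\ell(u_\ell)^2+\zeta_\ell(z_\ell[u_\ell])^2\big]\le C_{\rm opt}\,\big(\|u\|_{\mathbb{A}_s}^2+\|z[u]\|_{\mathbb{A}_t}^2\big)(\#\mathcal{T}_\ell-\#\mathcal{T}_0)^{-\beta},$$ where $\beta:=\min\{2s,2t\}$. The constants $C_{\rm lin}$, $q_{\rm lin}$, and $\ell_0$ depend only on $\theta$, $q_{\rm red}$, $C_{\rm stab}$, $C_{\rm rel}$, the bilinear form $a(\cdot,\cdot)$,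 and the compact operator $\mathcal{K}$. The constant $C_{\rm opt}$ depends only on $\theta$, $C_{\rm mesh}$, $C_{\rm mark}$, and (A1)–(A4).
   Context: **Model problem.** $\Omega\subset\mathbb{R}^d$, $d\ge2$, is a bounded Lipschitz domain; $f\in L^2(\Omega)$, $\boldsymbol{f}\in[L^2(\Omega)]^d$; $\boldsymbol{A},\boldsymbol{b},c\in L^\infty(\Omega)$ with $\boldsymbol{A}(x)\in\mathbb{R}^{d\times d}$ symmetric and uniformly positive definite, $\boldsymbol{b}(x)\in\mathbb{R}^d$, $c(x)\in\mathbb{R}$. Set $a(u,v):=\int_\Omega \boldsymbol{A}\nabla u\cdot\nabla v\,dx+\int_\Omega \boldsymbol{b}\cdot\nabla u\,v\,dx+\int_\Omega cuv\,dx$, assumed continuous and elliptic on $H^1_0(\Omega)$ (i.e., $a(v,v)\ge C_{\rm ell}\|v\|_{H^1(\Omega)}^2$ with $C_{\rm ell}>0$), and $F(v):=\int_\Omega fv\,dx-\int_\Omega\boldsymbol{f}\cdot\nabla v\,dx$. The energy norm is $|\!|\!|v|\!|\!|^2:=\int_\Omega\boldsymbol{A}\nabla v\cdot\nabla v\,dx$, an equivalent norm on $H^1_0(\Omega)$. For a bounded linear operator $\mathcal{K}:H^1_0(\Omega)\to H^{-1}(\Omega):=H^1_0(\Omega)'$, set $b(v,w):=\langle\mathcal{K}v,w\rangle_{H^{-1}\times H^1_0}$. The primal solution $u\in H^1_0(\Omega)$ solves $a(u,v)=F(v)$ for all $v\in H^1_0(\Omega)$. For $w\in H^1_0(\Omega)$,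 the dual solution $z[w]\in H^1_0(\Omega)$ solves $a(v,z[w])=b(v,w)+b(w,v)$ for all $v\in H^1_0(\Omega)$. **Discretization.** For a conforming triangulation $\mathcal{T}_H$ of $\Omega$ into compact simplices and a fixed polynomial degree $p\ge1$, $\mathcal{X}_H:=\{v_H\in H^1_0(\Omega): v_H|_T\text{ is a polynomial of degree}\le p\text{ for all }T\in\mathcal{T}_H\}$. The discrete solutions $u_H,z_H[w]\in\mathcal{X}_H$ solve $a(u_H,v_H)=F(v_H)$ and $a(v_H,z_H[w])=b(v_H,w)+b(w,v_H)$ for all $v_H\in\mathcal{X}_H$. Quantities with index $h$, $\ell$, etc. are associated in the same way with $\mathcal{T}_h$, $\mathcal{T}_\ell$, etc. **Mesh refinement.** $\mathcal{T}_0$ is a fixed initial conforming triangulation. A fixed deterministic refinement strategy (e.g., newest vertex bisection) is given: for a triangulation $\mathcal{T}_H$ and marked elements $\mathcal{M}_H\subseteq\mathcal{T}_H$, $\mathtt{refine}(\mathcal{T}_H,\mathcal{M}_H)$ is the coarsest triangulation $\mathcal{T}_h$ in which all $T\in\mathcal{M}_H$ have been refined, i.e., $\mathcal{M}_H\subseteq\mathcal{T}_H\setminus\mathcal{T}_h$. Write $\mathcal{T}_h\in\mathbb{T}(\mathcal{T}_H)$ if $\mathcal{T}_h$ is obtained from $\mathcal{T}_H$ by finitely many refinement steps, and $\mathbb{T}:=\mathbb{T}(\mathcal{T}_0)$. If $\mathcal{T}_h\in\mathbb{T}(\mathcal{T}_H)$, then $\mathcal{X}_H\subseteq\mathcal{X}_h$.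 Assumptions: (a) $\#(\mathcal{T}_H\setminus\mathcal{T}_h)+\#\mathcal{T}_H\le\#\mathcal{T}_h$ for all $\mathcal{T}_H\in\mathbb{T}$, $\mathcal{T}_h\in\mathbb{T}(\mathcal{T}_H)$; (b) if $\mathcal{T}_{j+1}=\mathtt{refine}(\mathcal{T}_j,\mathcal{M}_j)$ for all $j$, then $\#\mathcal{T}_\ell-\#\mathcal{T}_0\le C_{\rm mesh}\sum_{j=0}^{\ell-1}\#\mathcal{M}_j$ for all $\ell\in\mathbb{N}$, with $C_{\rm mesh}>0$ depending only on $\mathcal{T}_0$; (c) all $\mathcal{T}_H,\mathcal{T}_h\in\mathbb{T}$ have a common refinement $\mathcal{T}_H\oplus\mathcal{T}_h\in\mathbb{T}(\mathcal{T}_H)\cap\mathbb{T}(\mathcal{T}_h)$ with $\#(\mathcal{T}_H\oplus\mathcal{T}_h)\le\#\mathcal{T}_H+\#\mathcal{T}_h-\#\mathcal{T}_0$. **Error estimators.** For $\mathcal{T}_H\in\mathbb{T}$, $v_H\in\mathcal{X}_H$, $T\in\mathcal{T}_H$, refinement indicators $\eta_H(T,v_H)\ge0$ and $\zeta_H(T,v_H)\ge0$ are given. For $\mathcal{U}_H\subseteq\mathcal{T}_H$, $\eta_H(\mathcal{U}_H,v_H):=\big(\sum_{T\in\mathcal{U}_H}\eta_H(T,v_H)^2\big)^{1/2}$, $\eta_H(v_H):=\eta_H(\mathcal{T}_H,v_H)$, and analogously for $\zeta_H$. There are constants $C_{\rm stab},C_{\rm rel},C_{\rm drel}>0$ and $0<q_{\rm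 red}<1$ such that for all $\mathcal{T}_H\in\mathbb{T}$ and $\mathcal{T}_h\in\mathbb{T}(\mathcal{T}_H)$: (A1) stability: for all $v_h\in\mathcal{X}_h$, $v_H\in\mathcal{X}_H$, $\mathcal{U}_H\subseteq\mathcal{T}_h\cap\mathcal{T}_H$: $|\eta_h(\mathcal{U}_H,v_h)-\eta_H(\mathcal{U}_H,v_H)|+|\zeta_h(\mathcal{U}_H,v_h)-\zeta_H(\mathcal{U}_H,v_H)|\le C_{\rm stab}|\!|\!|v_h-v_H|\!|\!|$. (A2) reduction: for all $v_H\in\mathcal{X}_H$: $\eta_h(\mathcal{T}_h\setminus\mathcal{T}_H,v_H)\le q_{\rm red}\,\eta_H(\mathcal{T}_H\setminus\mathcal{T}_h,v_H)$ and $\zeta_h(\mathcal{T}_h\setminus\mathcal{T}_H,v_H)\le q_{\rm red}\,\zeta_H(\mathcal{T}_H\setminus\mathcal{T}_h,v_H)$. (A3) reliability: for all $w\in H^1_0(\Omega)$: $|\!|\!|u-u_H|\!|\!|\le C_{\rm rel}\,\eta_H(u_H)$ and $|\!|\!|z[w]-z_H[w]|\!|\!|\le C_{\rm rel}\,\zeta_H(z_H[w])$. (A4) discrete reliability: for all $w\in H^1_0(\Omega)$: $|\!|\!|u_h-u_H|\!|\!|\le C_{\rm drel}\,\eta_H(\mathcal{T}_H\setminus\mathcal{T}_h,u_H)$ and $|\!|\!|z_h[w]-z_H[w]|\!|\!|\le C_{\rm drel}\,\zeta_H(\mathcal{T}_H\setminus\mathcal{T}_h,z_H[w])$. Convention on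 constants: $C_{\rm stab},C_{\rm rel},C_{\rm drel}$ are taken large enough (depending additionally on $a(\cdot,\cdot)$ and the boundedness of $\mathcal{K}$) that they also satisfy the analogous properties of the combined estimator: $\big|[\eta_h(\mathcal{U}_H,v_h)^2+\zeta_h(\mathcal{U}_H,w_h)^2]^{1/2}-[\eta_H(\mathcal{U}_H,v_H)^2+\zeta_H(\mathcal{U}_H,w_H)^2]^{1/2}\big|\le C_{\rm stab}[|\!|\!|v_h-v_H|\!|\!|+|\!|\!|w_h-w_H|\!|\!|]$; $|\!|\!|u-u_H|\!|\!|+|\!|\!|z[u]-z_H[u_H]|\!|\!|+|\!|\!|z[u_H]-z_H[u_H]|\!|\!|\le C_{\rm rel}[\eta_H(u_H)^2+\zeta_H(z_H[u_H])^2]^{1/2}$; $|\!|\!|u_h-u_H|\!|\!|+|\!|\!|z_h[u_h]-z_H[u_H]|\!|\!|\le C_{\rm drel}[\eta_H(\mathcal{T}_H\setminus\mathcal{T}_h,u_H)^2+\zeta_H(\mathcal{T}_H\setminus\mathcal{T}_h,z_H[u_H])^2]^{1/2}$. **Approximation classes.** $\mathbb{T}_N:=\{\mathcal{T}\in\mathbb{T}:\#\mathcal{T}-\#\mathcal{T}_0\le N\}$ for $N\in\mathbb{N}_0$. For $s,t>0$: $\|u\|_{\mathbb{A}_s}:=\sup_{N\in\mathbb{N}_0}\big((N+1)^s\min_{\mathcal{T}_H\in\mathbb{T}_N}\eta_H(u_H)\big)$ and $\|z[u]\|_{\mathbb{A}_t}:=\sup_{N\in\mathbb{N}_0}\big((N+1)^t\min_{\mathcal{T}_H\in\mathbb{T}_N}\zeta_H(z_H[u])\big)$,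 both in $[0,\infty]$. **Algorithm B.** Input: $0<\theta\le1$, $C_{\rm mark}\ge1$, $\mathcal{T}_0$. For $\ell=0,1,2,\dots$: (i) compute $u_\ell,z_\ell[u_\ell]\in\mathcal{X}_\ell$; (ii) compute $\eta_\ell(T,u_\ell)$, $\zeta_\ell(T,z_\ell[u_\ell])$ for all $T\in\mathcal{T}_\ell$; (iii) determine a set $\mathcal{M}_\ell\subseteq\mathcal{T}_\ell$ of, up to the multiplicative constant $C_{\rm mark}$, minimal cardinality such that $\theta[\eta_\ell(u_\ell)^2+\zeta_\ell(z_\ell[u_\ell])^2]\le\eta_\ell(\mathcal{M}_\ell,u_\ell)^2+\zeta_\ell(\mathcal{M}_\ell,z_\ell[u_\ell])^2$; (iv) set $\mathcal{T}_{\ell+1}:=\mathtt{refine}(\mathcal{T}_\ell,\mathcal{M}_\ell)$.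
   Formalization: In (ii) C_opt may also depend on an upper bound S for min{s,t} (S arbitrary, so no pair s,t is excluded), since a C_opt uniform in all s,t>0 is impossible; C_opt may also depend on the fixed Ω, a(·,·) and K; the estimate is stated when #T_ℓ > #T_0. *)

theory Defs
  imports "HOL-Analysis.Analysis"
begin

section \<open>Sobolev spaces\<close>

type_synonym 'd fn = "real^'d \<Rightarrow> real"
type_synonym 'd mesh = "(real^'d) set set"

text \<open>Near every boundary point, \<open>\<Omega>\<close> is the strict epigraph of a Lipschitz function over the
  hyperplane orthogonal to a unit vector \<open>e\<close>.\<close>

definition bounded_lipschitz_domain :: "(real^'d) set \<Rightarrow> bool" where
  "bounded_lipschitz_domain \<Omega> \<longleftrightarrow>
     open \<Omega> \<and> connected \<Omega> \<and> \<Omega> \<noteq> {} \<and> bounded \<Omega> \<and>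
     (\<forall>x\<in>frontier \<Omega>. \<exists>r>0. \<exists>e. \<exists>\<gamma>::real^'d \<Rightarrow> real. \<exists>L.
        norm e = 1 \<and> L-lipschitz_on {y. y \<bullet> e = 0} \<gamma> \<and>
        \<Omega> \<inter> ball x r = {y \<in> ball x r. \<gamma> (y - (y \<bullet> e) *\<^sub>R e) < y \<bullet> e})"

definition partial :: "'d \<Rightarrow> 'd fn \<Rightarrow> 'd::finite fn" where
  "partial i f x = frechet_derivative f (at x) (axis i 1)"

primrec Ck :: "nat \<Rightarrow> 'd::finite fn \<Rightarrow> bool" where
  "Ck 0 f \<longleftrightarrow> continuous_on UNIV f"
| "Ck (Suc k) f \<longleftrightarrow> (\<forall>x. f differentiable (at x)) \<and> (\<forall>i. Ck k (partial i f))"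

definition test_functions :: "(real^'d) set \<Rightarrow> 'd::finite fn set" where
  "test_functions \<Omega> =
     {\<phi>. (\<forall>k. Ck k \<phi>) \<and> compact (closure {x. \<phi> x \<noteq> 0}) \<and> closure {x. \<phi> x \<noteq> 0} \<subseteq> \<Omega>}"

text \<open>Elements of \<open>L\<^sup>2\<close>, \<open>H\<^sup>1\<close> and \<open>H\<^sup>1\<^sub>0\<close> are represented by functions; values outside \<open>\<Omega>\<close> and on
  null sets do not matter.\<close>

definition in_L2 :: "(real^'d) set \<Rightarrow> (real^'d \<Rightarrow> 'b::euclidean_space) \<Rightarrow> bool" where
  "in_L2 \<Omega> g \<longleftrightarrow> g \<in> borel_measurable (lebesgue_on \<Omega>) \<and>
                 integrable (lebesgue_on \<Omega>) (\<lambda>x. (norm (g x))\<^sup>2)"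

definition in_Linf :: "(real^'d) set \<Rightarrow> (real^'d \<Rightarrow> 'b::euclidean_space) \<Rightarrow> bool" where
  "in_Linf \<Omega> g \<longleftrightarrow> g \<in> borel_measurable (lebesgue_on \<Omega>) \<and>
                   (\<exists>C. AE x in lebesgue_on \<Omega>. norm (g x) \<le> C)"

definition has_weak_gradient :: "(real^'d) set \<Rightarrow> 'd fn \<Rightarrow> (real^'d \<Rightarrow> real^'d::finite) \<Rightarrow> bool" where
  "has_weak_gradient \<Omega> v g \<longleftrightarrow> in_L2 \<Omega> v \<and> in_L2 \<Omega> g \<and>
     (\<forall>\<phi>\<in>test_functions \<Omega>. \<forall>i.
        (\<integral>x. v x * partial i \<phi> x \<partial>lebesgue_on \<Omega>) = - (\<integral>x. g x $ i * \<phi> x \<partial>lebesgue_on \<Omega>))"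

definition H1 :: "(real^'d) set \<Rightarrow> 'd::finite fn set" where
  "H1 \<Omega> = {v. \<exists>g. has_weak_gradient \<Omega> v g}"

text \<open>Weak gradients are unique almost everywhere, so the choice below is immaterial.\<close>

definition wgrad :: "(real^'d) set \<Rightarrow> 'd fn \<Rightarrow> real^'d \<Rightarrow> real^'d::finite" where
  "wgrad \<Omega> v = (SOME g. has_weak_gradient \<Omega> v g)"

definition H1_norm :: "(real^'d) set \<Rightarrow> 'd::finite fn \<Rightarrow> real" where
  "H1_norm \<Omega> v = sqrt ((\<integral>x. (v x)\<^sup>2 \<partial>lebesgue_on \<Omega>) +
                       (\<integral>x. (norm (wgrad \<Omega> v x))\<^sup>2 \<partial>lebesgue_on \<Omega>))"

definition H10 :: "(real^'d) set \<Rightarrow> 'd::finite fn set" where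
  "H10 \<Omega> = {v \<in> H1 \<Omega>. \<exists>\<phi>. (\<forall>n. \<phi> n \<in> test_functions \<Omega>) \<and>
                             (\<lambda>n. H1_norm \<Omega> (\<lambda>x. \<phi> n x - v x)) \<longlonglongrightarrow> 0}"

text \<open>The dual space of \<open>H\<^sup>1\<^sub>0\<close>; only the values of a functional on \<open>H\<^sup>1\<^sub>0\<close> matter.\<close>

definition H_minus1 :: "(real^'d) set \<Rightarrow> ('d::finite fn \<Rightarrow> real) set" where
  "H_minus1 \<Omega> = {\<Phi>.
     (\<forall>v\<in>H10 \<Omega>. \<forall>w\<in>H10 \<Omega>. \<Phi> (\<lambda>x. v x + w x) = \<Phi> v + \<Phi> w) \<and>
     (\<forall>r. \<forall>v\<in>H10 \<Omega>. \<Phi> (\<lambda>x. r * v x) = r * \<Phi> v) \<and>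
     (\<exists>C. \<forall>v\<in>H10 \<Omega>. \<bar>\<Phi> v\<bar> \<le> C * H1_norm \<Omega> v)}"

definition dual_norm :: "(real^'d) set \<Rightarrow> ('d::finite fn \<Rightarrow> real) \<Rightarrow> real" where
  "dual_norm \<Omega> \<Phi> = (SUP v\<in>{v \<in> H10 \<Omega>. H1_norm \<Omega> v \<le> 1}. \<bar>\<Phi> v\<bar>)"

text \<open>A linear operator from \<open>H\<^sup>1\<^sub>0\<close> to its dual (with \<open>K v w\<close> the duality pairing of \<open>K v\<close> and \<open>w\<close>)
  that maps bounded sequences to sequences with a convergent subsequence. Boundedness of \<open>K\<close>, and
  hence independence of the representatives, follows.\<close>

definition compact_operator :: "(real^'d) set \<Rightarrow> ('d::finite fn \<Rightarrow> 'd fn \<Rightarrow> real) \<Rightarrow> bool" where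
  "compact_operator \<Omega> K \<longleftrightarrow>
     (\<forall>v\<in>H10 \<Omega>. K v \<in> H_minus1 \<Omega>) \<and>
     (\<forall>v\<in>H10 \<Omega>. \<forall>v'\<in>H10 \<Omega>. \<forall>w\<in>H10 \<Omega>. K (\<lambda>x. v x + v' x) w = K v w + K v' w) \<and>
     (\<forall>r. \<forall>v\<in>H10 \<Omega>. \<forall>w\<in>H10 \<Omega>. K (\<lambda>x. r * v x) w = r * K v w) \<and>
     (\<forall>V::nat \<Rightarrow> 'd fn. (\<forall>n. V n \<in> H10 \<Omega>) \<and> (\<exists>C. \<forall>n. H1_norm \<Omega> (V n) \<le> C) \<longrightarrow>
        (\<exists>\<Phi>\<in>H_minus1 \<Omega>. \<exists>r::nat \<Rightarrow> nat. strict_mono r \<and>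
           (\<lambda>n. dual_norm \<Omega> (\<lambda>w. K (V (r n)) w - \<Phi> w)) \<longlonglongrightarrow> 0))"


section \<open>Model problem\<close>

definition bilin ::
  "(real^'d) set \<Rightarrow> (real^'d \<Rightarrow> real^'d^'d) \<Rightarrow> (real^'d \<Rightarrow> real^'d) \<Rightarrow> 'd fn \<Rightarrow>
   'd fn \<Rightarrow> 'd::finite fn \<Rightarrow> real" where
  "bilin \<Omega> A b c u v =
     (\<integral>x. (A x *v wgrad \<Omega> u x) \<bullet> wgrad \<Omega> v x \<partial>lebesgue_on \<Omega>) +
     (\<integral>x. (b x \<bullet> wgrad \<Omega> u x) * v x \<partial>lebesgue_on \<Omega>) +
     (\<integral>x. c x * u x * v x \<partial>lebesgue_on \<Omega>)"

definition load :: "(real^'d) set \<Rightarrow> 'd fn \<Rightarrow> (real^'d \<Rightarrow> real^'d) \<Rightarrow> 'd::finite fn \<Rightarrow> real" where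
  "load \<Omega> f fv v =
     (\<integral>x. f x * v x \<partial>lebesgue_on \<Omega>) - (\<integral>x. fv x \<bullet> wgrad \<Omega> v x \<partial>lebesgue_on \<Omega>)"

definition energy_norm ::
  "(real^'d) set \<Rightarrow> (real^'d \<Rightarrow> real^'d^'d) \<Rightarrow> 'd::finite fn \<Rightarrow> real" where
  "energy_norm \<Omega> A v = sqrt (\<integral>x. (A x *v wgrad \<Omega> v x) \<bullet> wgrad \<Omega> v x \<partial>lebesgue_on \<Omega>)"

definition admissible_coefficients ::
  "(real^'d) set \<Rightarrow> (real^'d \<Rightarrow> real^'d^'d) \<Rightarrow> (real^'d \<Rightarrow> real^'d) \<Rightarrow> 'd::finite fn \<Rightarrow> bool" where
  "admissible_coefficients \<Omega> A b c \<longleftrightarrow>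
     in_Linf \<Omega> A \<and> in_Linf \<Omega> b \<and> in_Linf \<Omega> c \<and>
     (AE x in lebesgue_on \<Omega>. transpose (A x) = A x) \<and>
     (\<exists>\<alpha>>0. AE x in lebesgue_on \<Omega>. \<forall>\<xi>. \<alpha> * (norm \<xi>)\<^sup>2 \<le> (A x *v \<xi>) \<bullet> \<xi>) \<and>
     (\<exists>C. \<forall>u\<in>H10 \<Omega>. \<forall>v\<in>H10 \<Omega>. \<bar>bilin \<Omega> A b c u v\<bar> \<le> C * H1_norm \<Omega> u * H1_norm \<Omega> v) \<and>
     (\<exists>C>0. \<forall>v\<in>H10 \<Omega>. C * (H1_norm \<Omega> v)\<^sup>2 \<le> bilin \<Omega> A b c v v)"

text \<open>Galerkin solutions in a space \<open>X\<close>; the choice \<open>X = H10 \<Omega>\<close> gives the continuous problems.\<close>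

definition primal_solution ::
  "(real^'d) set \<Rightarrow> (real^'d \<Rightarrow> real^'d^'d) \<Rightarrow> (real^'d \<Rightarrow> real^'d) \<Rightarrow> 'd fn \<Rightarrow>
   'd fn \<Rightarrow> (real^'d \<Rightarrow> real^'d) \<Rightarrow> 'd fn set \<Rightarrow> 'd::finite fn \<Rightarrow> bool" where
  "primal_solution \<Omega> A b c f fv X u \<longleftrightarrow>
     u \<in> X \<and> (\<forall>v\<in>X. bilin \<Omega> A b c u v = load \<Omega> f fv v)"

definition dual_solution ::
  "(real^'d) set \<Rightarrow> (real^'d \<Rightarrow> real^'d^'d) \<Rightarrow> (real^'d \<Rightarrow> real^'d) \<Rightarrow> 'd fn \<Rightarrow>
   ('d fn \<Rightarrow> 'd fn \<Rightarrow> real) \<Rightarrow> 'd fn set \<Rightarrow> 'd fn \<Rightarrow> 'd::finite fn \<Rightarrow> bool" where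
  "dual_solution \<Omega> A b c K X w z \<longleftrightarrow>
     z \<in> X \<and> (\<forall>v\<in>X. bilin \<Omega> A b c v z = K v w + K w v)"


section \<open>Meshes, refinement and discrete spaces\<close>

definition conforming_triangulation :: "(real^'d) set \<Rightarrow> 'd::finite mesh \<Rightarrow> bool" where
  "conforming_triangulation \<Omega> \<T> \<longleftrightarrow>
     triangulation \<T> \<and> (\<forall>T\<in>\<T>. int CARD('d) simplex T) \<and> \<Union>\<T> = closure \<Omega>"

text \<open>Polynomials of total degree at most \<open>p\<close>, as combinations of monomials with multi-index \<open>\<alpha>\<close>.\<close>

definition polys_le :: "nat \<Rightarrow> 'd::finite fn set" where
  "polys_le p = {q. \<exists>k. \<forall>x. q x =
     (\<Sum>\<alpha> | (\<Sum>i\<in>UNIV. \<alpha> i) \<le> p. k \<alpha> * (\<Prod>i\<in>UNIV. (x $ i) ^ (\<alpha> i)))}"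

definition fe_space :: "(real^'d) set \<Rightarrow> nat \<Rightarrow> 'd mesh \<Rightarrow> 'd::finite fn set" where
  "fe_space \<Omega> p \<T> =
     {v \<in> H10 \<Omega>. \<forall>T\<in>\<T>. \<exists>q\<in>polys_le p. AE x in lebesgue_on T. v x = q x}"

inductive_set refinements ::
  "('d mesh \<Rightarrow> 'd mesh \<Rightarrow> 'd mesh) \<Rightarrow> 'd mesh \<Rightarrow> 'd::finite mesh set"
  for refine :: "'d mesh \<Rightarrow> 'd mesh \<Rightarrow> 'd mesh" and \<T>\<^sub>H :: "'d mesh" where
  refl: "\<T>\<^sub>H \<in> refinements refine \<T>\<^sub>H"
| step: "\<T> \<in> refinements refine \<T>\<^sub>H \<Longrightarrow> \<M> \<subseteq> \<T> \<Longrightarrow> refine \<T> \<M> \<in> refinements refine \<T>\<^sub>H"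

text \<open>\<open>refine \<T> \<M>\<close> is a conforming triangulation that subdivides \<open>\<T>\<close>, refines all marked elements,
  and is the coarsest such mesh: any mesh reachable from \<open>\<T>\<close> in which all of \<open>\<M>\<close> is refined is
  reachable from \<open>refine \<T> \<M>\<close>. The last three conjuncts are the assumptions on the number of sons,
  on the mesh closure, and on the overlay.\<close>

definition mesh_refinement ::
  "(real^'d) set \<Rightarrow> 'd mesh \<Rightarrow> ('d mesh \<Rightarrow> 'd mesh \<Rightarrow> 'd::finite mesh) \<Rightarrow> real \<Rightarrow> bool" where
  "mesh_refinement \<Omega> \<T>\<^sub>0 refine Cmesh \<longleftrightarrow>
     conforming_triangulation \<Omega> \<T>\<^sub>0 \<and>
     (\<forall>\<T>\<in>refinements refine \<T>\<^sub>0. \<forall>\<M>. \<M> \<subseteq> \<T> \<longrightarrow>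
        conforming_triangulation \<Omega> (refine \<T> \<M>) \<and>
        (\<forall>T\<in>\<T>. T = \<Union>{T' \<in> refine \<T> \<M>. T' \<subseteq> T}) \<and>
        \<M> \<subseteq> \<T> - refine \<T> \<M> \<and>
        (\<forall>\<T>'\<in>refinements refine \<T>. \<M> \<subseteq> \<T> - \<T>' \<longrightarrow> \<T>' \<in> refinements refine (refine \<T> \<M>))) \<and>
     (\<forall>\<T>\<^sub>H\<in>refinements refine \<T>\<^sub>0. \<forall>\<T>\<^sub>h\<in>refinements refine \<T>\<^sub>H.
        card (\<T>\<^sub>H - \<T>\<^sub>h) + card \<T>\<^sub>H \<le> card \<T>\<^sub>h) \<and>
     (\<forall>\<T> \<M>. \<T> 0 = \<T>\<^sub>0 \<and> (\<forall>j. \<M> j \<subseteq> \<T> j \<and> \<T> (Suc j) = refine (\<T> j) (\<M> j)) \<longrightarrow>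
        (\<forall>l. real (card (\<T> l)) - real (card \<T>\<^sub>0) \<le> Cmesh * (\<Sum>j<l. real (card (\<M> j))))) \<and>
     (\<forall>\<T>\<^sub>H\<in>refinements refine \<T>\<^sub>0. \<forall>\<T>\<^sub>h\<in>refinements refine \<T>\<^sub>0.
        \<exists>\<T>\<in>refinements refine \<T>\<^sub>H \<inter> refinements refine \<T>\<^sub>h.
          card \<T> + card \<T>\<^sub>0 \<le> card \<T>\<^sub>H + card \<T>\<^sub>h)"


section \<open>Error estimators\<close>

text \<open>\<open>\<eta> \<T> T v\<close> is the indicator on the element \<open>T\<close> of the mesh \<open>\<T>\<close>.\<close>

type_synonym 'd indicators = "'d mesh \<Rightarrow> (real^'d) set \<Rightarrow> 'd fn \<Rightarrow> real"

definition est :: "'d::finite indicators \<Rightarrow> 'd mesh \<Rightarrow> 'd mesh \<Rightarrow> 'd fn \<Rightarrow> real" where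
  "est \<eta> \<T> \<U> v = sqrt (\<Sum>T\<in>\<U>. (\<eta> \<T> T v)\<^sup>2)"

text \<open>In the following definitions, \<open>N\<close> is the energy norm, \<open>X \<T>\<close> the discrete space and \<open>R \<T>\<close> the
  set of refinements associated with the mesh \<open>\<T>\<close>.\<close>

definition stability ::
  "('d fn \<Rightarrow> real) \<Rightarrow> ('d mesh \<Rightarrow> 'd fn set) \<Rightarrow> ('d mesh \<Rightarrow> 'd mesh set) \<Rightarrow> 'd mesh \<Rightarrow>
   'd indicators \<Rightarrow> 'd::finite indicators \<Rightarrow> real \<Rightarrow> bool" where
  "stability N X R \<T>\<^sub>0 \<eta> \<zeta> Cstab \<longleftrightarrow>
     (\<forall>\<T>\<^sub>H\<in>R \<T>\<^sub>0. \<forall>\<T>\<^sub>h\<in>R \<T>\<^sub>H. \<forall>v\<^sub>h\<in>X \<T>\<^sub>h. \<forall>v\<^sub>H\<in>X \<T>\<^sub>H. \<forall>\<U>. \<U> \<subseteq> \<T>\<^sub>h \<inter> \<T>\<^sub>H \<longrightarrow>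
        \<bar>est \<eta> \<T>\<^sub>h \<U> v\<^sub>h - est \<eta> \<T>\<^sub>H \<U> v\<^sub>H\<bar> + \<bar>est \<zeta> \<T>\<^sub>h \<U> v\<^sub>h - est \<zeta> \<T>\<^sub>H \<U> v\<^sub>H\<bar>
          \<le> Cstab * N (\<lambda>x. v\<^sub>h x - v\<^sub>H x)) \<and>
     (\<forall>\<T>\<^sub>H\<in>R \<T>\<^sub>0. \<forall>\<T>\<^sub>h\<in>R \<T>\<^sub>H. \<forall>v\<^sub>h\<in>X \<T>\<^sub>h. \<forall>w\<^sub>h\<in>X \<T>\<^sub>h. \<forall>v\<^sub>H\<in>X \<T>\<^sub>H. \<forall>w\<^sub>H\<in>X \<T>\<^sub>H.
      \<forall>\<U>. \<U> \<subseteq> \<T>\<^sub>h \<inter> \<T>\<^sub>H \<longrightarrow>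
        \<bar>sqrt ((est \<eta> \<T>\<^sub>h \<U> v\<^sub>h)\<^sup>2 + (est \<zeta> \<T>\<^sub>h \<U> w\<^sub>h)\<^sup>2)
          - sqrt ((est \<eta> \<T>\<^sub>H \<U> v\<^sub>H)\<^sup>2 + (est \<zeta> \<T>\<^sub>H \<U> w\<^sub>H)\<^sup>2)\<bar>
          \<le> Cstab * (N (\<lambda>x. v\<^sub>h x - v\<^sub>H x) + N (\<lambda>x. w\<^sub>h x - w\<^sub>H x)))"

definition reduction ::
  "('d mesh \<Rightarrow> 'd fn set) \<Rightarrow> ('d mesh \<Rightarrow> 'd mesh set) \<Rightarrow> 'd mesh \<Rightarrow>
   'd indicators \<Rightarrow> 'd::finite indicators \<Rightarrow> real \<Rightarrow> bool" where
  "reduction X R \<T>\<^sub>0 \<eta> \<zeta> qred \<longleftrightarrow>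
     (\<forall>\<T>\<^sub>H\<in>R \<T>\<^sub>0. \<forall>\<T>\<^sub>h\<in>R \<T>\<^sub>H. \<forall>v\<in>X \<T>\<^sub>H.
        est \<eta> \<T>\<^sub>h (\<T>\<^sub>h - \<T>\<^sub>H) v \<le> qred * est \<eta> \<T>\<^sub>H (\<T>\<^sub>H - \<T>\<^sub>h) v \<and>
        est \<zeta> \<T>\<^sub>h (\<T>\<^sub>h - \<T>\<^sub>H) v \<le> qred * est \<zeta> \<T>\<^sub>H (\<T>\<^sub>H - \<T>\<^sub>h) v)"

definition reliability ::
  "('d fn \<Rightarrow> real) \<Rightarrow> 'd fn set \<Rightarrow> ('d mesh \<Rightarrow> 'd mesh set) \<Rightarrow> 'd mesh \<Rightarrow>
   'd indicators \<Rightarrow> 'd::finite indicators \<Rightarrow>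
   'd fn \<Rightarrow> ('d fn \<Rightarrow> 'd fn) \<Rightarrow> ('d mesh \<Rightarrow> 'd fn) \<Rightarrow> ('d mesh \<Rightarrow> 'd fn \<Rightarrow> 'd fn) \<Rightarrow>
   real \<Rightarrow> bool" where
  "reliability N H R \<T>\<^sub>0 \<eta> \<zeta> u z uH zH Crel \<longleftrightarrow>
     (\<forall>\<T>\<in>R \<T>\<^sub>0.
        N (\<lambda>x. u x - uH \<T> x) \<le> Crel * est \<eta> \<T> \<T> (uH \<T>) \<and>
        (\<forall>w\<in>H. N (\<lambda>x. z w x - zH \<T> w x) \<le> Crel * est \<zeta> \<T> \<T> (zH \<T> w)) \<and>
        N (\<lambda>x. u x - uH \<T> x) + N (\<lambda>x. z u x - zH \<T> (uH \<T>) x)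
          + N (\<lambda>x. z (uH \<T>) x - zH \<T> (uH \<T>) x)
          \<le> Crel * sqrt ((est \<eta> \<T> \<T> (uH \<T>))\<^sup>2 + (est \<zeta> \<T> \<T> (zH \<T> (uH \<T>)))\<^sup>2))"

definition discrete_reliability ::
  "('d fn \<Rightarrow> real) \<Rightarrow> 'd fn set \<Rightarrow> ('d mesh \<Rightarrow> 'd mesh set) \<Rightarrow> 'd mesh \<Rightarrow>
   'd indicators \<Rightarrow> 'd::finite indicators \<Rightarrow>
   ('d mesh \<Rightarrow> 'd fn) \<Rightarrow> ('d mesh \<Rightarrow> 'd fn \<Rightarrow> 'd fn) \<Rightarrow> real \<Rightarrow> bool" where
  "discrete_reliability N H R \<T>\<^sub>0 \<eta> \<zeta> uH zH Cdrel \<longleftrightarrow>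
     (\<forall>\<T>\<^sub>H\<in>R \<T>\<^sub>0. \<forall>\<T>\<^sub>h\<in>R \<T>\<^sub>H.
        N (\<lambda>x. uH \<T>\<^sub>h x - uH \<T>\<^sub>H x) \<le> Cdrel * est \<eta> \<T>\<^sub>H (\<T>\<^sub>H - \<T>\<^sub>h) (uH \<T>\<^sub>H) \<and>
        (\<forall>w\<in>H. N (\<lambda>x. zH \<T>\<^sub>h w x - zH \<T>\<^sub>H w x)
                  \<le> Cdrel * est \<zeta> \<T>\<^sub>H (\<T>\<^sub>H - \<T>\<^sub>h) (zH \<T>\<^sub>H w)) \<and>
        N (\<lambda>x. uH \<T>\<^sub>h x - uH \<T>\<^sub>H x) + N (\<lambda>x. zH \<T>\<^sub>h (uH \<T>\<^sub>h) x - zH \<T>\<^sub>H (uH \<T>\<^sub>H) x)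
          \<le> Cdrel * sqrt ((est \<eta> \<T>\<^sub>H (\<T>\<^sub>H - \<T>\<^sub>h) (uH \<T>\<^sub>H))\<^sup>2
                          + (est \<zeta> \<T>\<^sub>H (\<T>\<^sub>H - \<T>\<^sub>h) (zH \<T>\<^sub>H (uH \<T>\<^sub>H)))\<^sup>2))"

text \<open>All data besides \<open>\<Omega>\<close>, the coefficients and \<open>K\<close>: right-hand side, polynomial degree, meshes, the
  continuous solutions \<open>u\<close>, \<open>z w\<close> and discrete solutions \<open>uH \<T>\<close>, \<open>zH \<T> w\<close>, and the indicators with
  the constants for which they satisfy the four estimator properties (each in the individual form
  and, except for reduction, also in the combined form).\<close>

definition afem_setting ::
  "(real^'d) set \<Rightarrow> (real^'d \<Rightarrow> real^'d^'d) \<Rightarrow> (real^'d \<Rightarrow> real^'d) \<Rightarrow> 'd fn \<Rightarrow>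
   ('d fn \<Rightarrow> 'd fn \<Rightarrow> real) \<Rightarrow>
   real \<Rightarrow> real \<Rightarrow> real \<Rightarrow> real \<Rightarrow> real \<Rightarrow>
   'd fn \<Rightarrow> (real^'d \<Rightarrow> real^'d) \<Rightarrow> nat \<Rightarrow> 'd mesh \<Rightarrow> ('d mesh \<Rightarrow> 'd mesh \<Rightarrow> 'd mesh) \<Rightarrow>
   'd indicators \<Rightarrow> 'd indicators \<Rightarrow>
   'd fn \<Rightarrow> ('d fn \<Rightarrow> 'd fn) \<Rightarrow> ('d mesh \<Rightarrow> 'd fn) \<Rightarrow> ('d mesh \<Rightarrow> 'd fn \<Rightarrow> 'd::finite fn) \<Rightarrow>
   bool" where
  "afem_setting \<Omega> A b c K qred Cstab Crel Cdrel Cmesh f fv p \<T>\<^sub>0 refine \<eta> \<zeta> u z uH zH \<longleftrightarrow>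
     in_L2 \<Omega> f \<and> in_L2 \<Omega> fv \<and> 1 \<le> p \<and>
     0 < qred \<and> qred < 1 \<and> 0 < Cstab \<and> 0 < Crel \<and> 0 < Cdrel \<and> 0 < Cmesh \<and>
     mesh_refinement \<Omega> \<T>\<^sub>0 refine Cmesh \<and>
     primal_solution \<Omega> A b c f fv (H10 \<Omega>) u \<and>
     (\<forall>w\<in>H10 \<Omega>. dual_solution \<Omega> A b c K (H10 \<Omega>) w (z w)) \<and>
     (\<forall>\<T>\<in>refinements refine \<T>\<^sub>0.
        primal_solution \<Omega> A b c f fv (fe_space \<Omega> p \<T>) (uH \<T>) \<and>
        (\<forall>w\<in>H10 \<Omega>. dual_solution \<Omega> A b c K (fe_space \<Omega> p \<T>) w (zH \<T> w)) \<and>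
        (\<forall>v\<in>fe_space \<Omega> p \<T>. \<forall>T\<in>\<T>. 0 \<le> \<eta> \<T> T v \<and> 0 \<le> \<zeta> \<T> T v)) \<and>
     stability (energy_norm \<Omega> A) (fe_space \<Omega> p) (refinements refine) \<T>\<^sub>0 \<eta> \<zeta> Cstab \<and>
     reduction (fe_space \<Omega> p) (refinements refine) \<T>\<^sub>0 \<eta> \<zeta> qred \<and>
     reliability (energy_norm \<Omega> A) (H10 \<Omega>) (refinements refine) \<T>\<^sub>0 \<eta> \<zeta> u z uH zH Crel \<and>
     discrete_reliability (energy_norm \<Omega> A) (H10 \<Omega>) (refinements refine) \<T>\<^sub>0 \<eta> \<zeta> uH zH Cdrel"


section \<open>Approximation classes and the adaptive algorithm\<close>

text \<open>\<open>e \<T>\<close> is the estimator value on the mesh \<open>\<T>\<close>; the infimum is over a set containing \<open>\<T>\<^sub>0\<close>.\<close>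

definition approx_norm ::
  "('d mesh \<Rightarrow> 'd mesh \<Rightarrow> 'd mesh) \<Rightarrow> 'd::finite mesh \<Rightarrow> real \<Rightarrow> ('d mesh \<Rightarrow> real) \<Rightarrow> ennreal" where
  "approx_norm refine \<T>\<^sub>0 s e =
     (SUP N::nat. ennreal (real (N + 1) powr s) *
        (INF \<T>\<in>{\<T> \<in> refinements refine \<T>\<^sub>0. card \<T> \<le> card \<T>\<^sub>0 + N}. ennreal (e \<T>)))"

definition combined_est_sq ::
  "'d indicators \<Rightarrow> 'd indicators \<Rightarrow> ('d mesh \<Rightarrow> 'd fn) \<Rightarrow> ('d mesh \<Rightarrow> 'd fn \<Rightarrow> 'd fn) \<Rightarrow>
   'd mesh \<Rightarrow> 'd::finite mesh \<Rightarrow> real" where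
  "combined_est_sq \<eta> \<zeta> uH zH \<T> \<U> =
     (est \<eta> \<T> \<U> (uH \<T>))\<^sup>2 + (est \<zeta> \<T> \<U> (zH \<T> (uH \<T>)))\<^sup>2"

text \<open>The sequences \<open>\<T>\<close> of meshes and \<open>\<M>\<close> of marked sets are a possible run of the algorithm.\<close>

definition algorithm_B ::
  "'d mesh \<Rightarrow> ('d mesh \<Rightarrow> 'd mesh \<Rightarrow> 'd mesh) \<Rightarrow> 'd indicators \<Rightarrow> 'd indicators \<Rightarrow>
   ('d mesh \<Rightarrow> 'd fn) \<Rightarrow> ('d mesh \<Rightarrow> 'd fn \<Rightarrow> 'd fn) \<Rightarrow> real \<Rightarrow> real \<Rightarrow>
   (nat \<Rightarrow> 'd mesh) \<Rightarrow> (nat \<Rightarrow> 'd::finite mesh) \<Rightarrow> bool" where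
  "algorithm_B \<T>\<^sub>0 refine \<eta> \<zeta> uH zH \<theta> Cmark \<T> \<M> \<longleftrightarrow>
     \<T> 0 = \<T>\<^sub>0 \<and>
     (\<forall>l. \<T> (Suc l) = refine (\<T> l) (\<M> l) \<and>
          \<M> l \<subseteq> \<T> l \<and>
          \<theta> * combined_est_sq \<eta> \<zeta> uH zH (\<T> l) (\<T> l) \<le> combined_est_sq \<eta> \<zeta> uH zH (\<T> l) (\<M> l) \<and>
          (\<forall>\<M>'. \<M>' \<subseteq> \<T> l \<and>
             \<theta> * combined_est_sq \<eta> \<zeta> uH zH (\<T> l) (\<T> l) \<le> combined_est_sq \<eta> \<zeta> uH zH (\<T> l) \<M>' \<longrightarrow>
             real (card (\<M> l)) \<le> Cmark * real (card \<M>')))"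

end

theory Submission
  imports Defs "HOL-Library.Function_Algebras" "HOL-Computational_Algebra.Polynomial"
begin

text \<open>The pair \<open>(u\<^sub>H, z\<^sub>H[u\<^sub>H])\<close> is the Galerkin approximation of \<open>(u, z[u])\<close> in \<open>X\<^sub>H \<times> X\<^sub>H\<close> for a single
  block triangular, nonsymmetric, but uniformly stable system. The Galerkin projections onto nested
  spaces are therefore commuting, uniformly bounded projections in a Hilbert space. If many
  increments of the Galerkin sequence after step \<open>l\<close> were larger than a fixed multiple of the error
  at step \<open>l\<close>, then averages over early and over late iterates would stay apart, and the
  parallelogram law, applied along a dyadic tree of averages, would force the iterates to be
  unbounded. Hence the squared increments over \<open>n\<close> steps sum up to at most \<open>\<epsilon> n + C(\<epsilon>)\<close> times the
  squared error at step \<open>l\<close>, with \<open>C(\<epsilon>)\<close> independent of the meshes. Together with the estimator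
  reduction by Doerfler marking this yields linear convergence from the very first step. The rates
  follow by comparing the marked elements with the refined elements of an overlay of the current
  mesh with quasi-optimal meshes for \<open>u\<close> and \<open>z[u]\<close>.\<close>

section \<open>Quasi-orthogonality of nested projections\<close>

text \<open>The constants have to be fixed before meshes, data and indicators are quantified, so
  none of them may come from a limit along one particular run. Galerkin projections are never formed
  as maps: their boundedness is the inequality \<open>q x \<le> C * q (x + y)\<close> for
  \<open>x\<close> in the discrete space and \<open>y\<close> in the kernel of the projection.
  Elements of \<open>H10\<close> are functions, not classes, so \<open>energy_norm\<close> is only a
  seminorm there; the quasi-orthogonality argument therefore rests on nonnegativity, scaling and the
  parallelogram law alone. The analytic part makes this applicable. Since \<open>wgrad\<close> is a
  choice, it is linear only almost everywhere, and this needs uniqueness of weak gradients, hence a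
  supply of test functions. Ellipticity and the bound of \<open>K\<close> refer to
  \<open>H1_norm\<close> while the estimator properties refer to \<open>energy_norm\<close>, so a
  Poincare inequality has to link the two. For the rates, the approximation class of the dual
  solution concerns \<open>zH \<T> u\<close>, but the algorithm only sees
  \<open>zH \<T> (uH \<T>)\<close>; the gap is paid for by the primal estimator.\<close>

primrec dyadic_avg :: "(nat \<Rightarrow> 'v::real_vector) \<Rightarrow> nat \<Rightarrow> nat \<Rightarrow> 'v" where
  "dyadic_avg S 0 i = S i"
| "dyadic_avg S (Suc m) i = (1/2) *\<^sub>R (dyadic_avg S m i + dyadic_avg S m (i + 2 ^ m))"

text \<open>A dyadic average is a convex combination, so subtracting the fixed \<open>p\<close>
  commutes with averaging. With \<open>p = 0\<close> this gives membership of averages in discrete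
  spaces, with \<open>p\<close> a difference of iterates membership in a projection kernel.\<close>

lemma dyadic_avg_diff_in_subspace:
  assumes "subspace Y" "\<And>j. i \<le> j \<Longrightarrow> j < i + 2 ^ m \<Longrightarrow> S j - p \<in> Y"
  shows "dyadic_avg S m i - p \<in> Y"
  using assms(2)
proof (induction m arbitrary: i)
  case 0
  then show ?case by simp
next
  case (Suc m)
  have "dyadic_avg S m i - p \<in> Y" "dyadic_avg S m (i + 2 ^ m) - p \<in> Y"
    by (rule Suc.IH; rule Suc.prems; simp)+
  then have "(1/2) *\<^sub>R ((dyadic_avg S m i - p) + (dyadic_avg S m (i + 2 ^ m) - p)) \<in> Y"
    using assms(1) by (simp add: subspace_add subspace_scale)
  moreover have "dyadic_avg S (Suc m) i - p =
      (1/2) *\<^sub>R ((dyadic_avg S m i - p) + (dyadic_avg S m (i + 2 ^ m) - p))"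
  proof -
    have "(1/2) *\<^sub>R p + (1/2) *\<^sub>R p = p"
      by (simp flip: scaleR_add_left)
    then show ?thesis
      by (simp add: scaleR_add_right scaleR_diff_right algebra_simps)
  qed
  ultimately show ?case by simp
qed

text \<open>Definiteness and completeness are left out on purpose: functions that vanish almost
  everywhere have \<open>q\<close> equal to 0 without being 0.\<close>

locale quadratic_form_on =
  fixes H :: "'v::real_vector set" and q :: "'v \<Rightarrow> real"
  assumes subspace_H: "subspace H"
    and q_nonneg: "x \<in> H \<Longrightarrow> 0 \<le> q x"
    and q_scale: "x \<in> H \<Longrightarrow> q (c *\<^sub>R x) = c\<^sup>2 * q x"
    and q_parallelogram: "x \<in> H \<Longrightarrow> y \<in> H \<Longrightarrow> q (x + y) + q (x - y) = 2 * q x + 2 * q y"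
begin

lemma q_diff_le: "x \<in> H \<Longrightarrow> y \<in> H \<Longrightarrow> q (x - y) \<le> 2 * q x + 2 * q y"
  using q_parallelogram[of x y] q_nonneg[of "x + y"] subspace_H by (simp add: subspace_add)

text \<open>By the parallelogram law, averaging two vectors at distance \<open>\<delta>\<close> lowers the mean square by
  \<open>\<delta>/4\<close>, so every level of the dyadic tree of averages costs at least that much.\<close>

lemma dyadic_avg_gain:
  assumes "\<And>j. j < 2 ^ M \<Longrightarrow> S j \<in> H" "\<And>j. j < 2 ^ M \<Longrightarrow> q (S j) \<le> R"
    and gap: "\<And>m i. i + 2 ^ Suc m \<le> 2 ^ M \<Longrightarrow>
      \<delta> \<le> q (dyadic_avg S m (i + 2 ^ m) - dyadic_avg S m i)"
  shows "real M * \<delta> / 4 \<le> R"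
proof -
  have in_H: "dyadic_avg S m i \<in> H" if "i + 2 ^ m \<le> 2 ^ M" for m i
    using dyadic_avg_diff_in_subspace[OF subspace_H, of i m S 0] assms(1) that by simp
  have "q (dyadic_avg S m i) + real m * \<delta> / 4 \<le> R" if "i + 2 ^ m \<le> 2 ^ M" for m i
    using that
  proof (induction m arbitrary: i)
    case 0
    then show ?case using assms(2) by simp
  next
    case (Suc m)
    let ?a = "dyadic_avg S m i" and ?b = "dyadic_avg S m (i + 2 ^ m)"
    have H: "?a \<in> H" "?b \<in> H" "?a + ?b \<in> H" using in_H[of i m] in_H[of "i + 2 ^ m" m] Suc.prems
        subspace_add[OF subspace_H] by auto
    have a: "q ?a + real m * \<delta> / 4 \<le> R" "q ?b + real m * \<delta> / 4 \<le> R"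
      using Suc.IH[of i] Suc.IH[of "i + 2 ^ m"] Suc.prems by auto
    have g: "\<delta> \<le> q (?b - ?a)" using gap[OF Suc.prems] .
    have p: "q (?b + ?a) + q (?b - ?a) = 2 * q ?b + 2 * q ?a"
      using q_parallelogram H by blast
    have "q (dyadic_avg S (Suc m) i) = (1/2)\<^sup>2 * q (?b + ?a)"
      using q_scale[OF H(3), of "1/2"] by (simp add: add.commute)
    then have "q (dyadic_avg S (Suc m) i) \<le> (1/4) * (2 * q ?b + 2 * q ?a - \<delta>)"
      using p g by (simp add: power2_eq_square)
    then show ?case using a by (simp add: field_simps)
  qed
  from this[of 0 M] have "q (dyadic_avg S M 0) + real M * \<delta> / 4 \<le> R" by simp
  moreover have "0 \<le> q (dyadic_avg S M 0)" using in_H q_nonneg by simp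
  ultimately show ?thesis by simp
qed

end

text \<open>\<open>X k\<close> plays the role of a discrete space and \<open>Y k\<close> that of the vectors which the Galerkin
  projection onto \<open>X k\<close> annihilates.\<close>

locale nested_projections = quadratic_form_on H q
  for H :: "'v::real_vector set" and q :: "'v \<Rightarrow> real" +
  fixes X Y :: "nat \<Rightarrow> 'v set" and s :: "nat \<Rightarrow> 'v" and w :: 'v and C :: real
  assumes C_pos: "0 < C"
    and X_sub: "subspace (X k)" "X k \<subseteq> H" and X_mono: "k \<le> j \<Longrightarrow> X k \<subseteq> X j"
    and Y_sub: "subspace (Y k)" "Y k \<subseteq> H"
    and s_in: "s k \<in> X k" and s_diff: "k \<le> j \<Longrightarrow> s j - s k \<in> Y k" and lim_diff: "w - s k \<in> Y k"
    and proj_bound: "x \<in> X k \<Longrightarrow> y \<in> Y k \<Longrightarrow> q x \<le> C * q (x + y)"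
begin

lemma s_in_X: "k \<le> j \<Longrightarrow> s k \<in> X j"
  using s_in X_mono by blast

lemma s_diff_in_X: "k \<le> i \<Longrightarrow> j \<le> i \<Longrightarrow> s k - s j \<in> X i"
  using s_in_X X_sub by (simp add: subspace_diff)

text \<open>The projection onto \<open>X k\<close> of the error \<open>w - s l\<close> is
  \<open>s k - s l\<close>, because the remainder \<open>w - s k\<close> lies in its kernel
  \<open>Y k\<close>.\<close>

lemma q_partial_le: "l \<le> k \<Longrightarrow> q (s k - s l) \<le> C * q (w - s l)"
  using proj_bound[of "s k - s l" k "w - s k"] s_diff_in_X[of k k l] lim_diff by simp

text \<open>A crude bound for a single increment, spent later on the boundedly many large
  ones.\<close>

lemma q_increment_le: "l \<le> k \<Longrightarrow> q (s (Suc k) - s k) \<le> 4 * C * q (w - s l)"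
proof -
  assume l: "l \<le> k"
  then have "s (Suc k) - s l \<in> H" "s k - s l \<in> H"
    using s_diff_in_X[of "Suc k" "Suc k" l] s_diff_in_X[of k k l] X_sub by auto
  from q_diff_le[OF this] show ?thesis
    using q_partial_le[of l k] q_partial_le[of l "Suc k"] l by simp
qed

text \<open>If \<open>L\<close> averages \<open>s j\<close> over \<open>j \<le> k\<close> and \<open>R\<close> averages over \<open>j > k\<close>, then \<open>R - L\<close> projects to
  \<open>s k - L\<close> and to \<open>s (k + 1) - L\<close>; hence large increments separate the two averages.\<close>

lemma card_large_increments:
  assumes "finite B" "2 ^ M \<le> card B"
    and B: "\<And>k. k \<in> B \<Longrightarrow> l \<le> k \<and> \<delta> \<le> q (s (Suc k) - s k)"
  shows "real M * \<delta> \<le> 16 * C\<^sup>2 * q (w - s l)"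
proof -
  obtain r where r: "strict_mono_on {..<card B} r" "\<And>n. n < card B \<Longrightarrow> r n \<in> B"
    using finite_enumerate[OF assms(1)] by auto
  define S where "S = (\<lambda>i. s (r i) - s l)"
  have r_mono: "r i < r j" if "i < j" "j < 2 ^ M" for i j
    using that r(1) assms(2) by (auto simp: strict_mono_on_def)
  have r_B: "r i \<in> B" if "i < 2 ^ M" for i using that r(2) assms(2) by auto
  have gap: "\<delta> / (4 * C) \<le> q (dyadic_avg S m (i + 2 ^ m) - dyadic_avg S m i)"
    if im: "i + 2 ^ Suc m \<le> 2 ^ M" for m i
  proof -
    \<comment> \<open>The last index of the left block. Its large increment, from
      \<open>k = r n\<close> to \<open>Suc k\<close>, separates the blocks: the left one samples
      iterates up to \<open>k\<close>, the right one iterates from \<open>Suc k\<close> on.\<close>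
    define n where "n = i + 2 ^ m - 1"
    have n: "n + 1 = i + 2 ^ m" "n < 2 ^ M"
      using im zero_less_power[of "2::nat" m] unfolding n_def by (simp_all, linarith)
    define k where "k = r n"
    let ?L = "dyadic_avg S m i" and ?R = "dyadic_avg S m (i + 2 ^ m)"
    have kB: "l \<le> k" "\<delta> \<le> q (s (Suc k) - s k)" using B[OF r_B[OF n(2)]] by (auto simp: k_def)
    have LX: "?L \<in> X k'" if "k \<le> k'" for k'
    proof -
      have "S j - 0 \<in> X k'" if "i \<le> j" "j < i + 2 ^ m" for j
      proof -
        have "j \<le> n" using that n by auto
        then have "r j \<le> k" using r_mono[of j n] n by (cases "j = n") (auto simp: k_def)
        then show ?thesis using s_diff_in_X[of "r j" k' l] \<open>k \<le> k'\<close> kB by (simp add: S_def)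
      qed
      then show ?thesis using dyadic_avg_diff_in_subspace[OF X_sub(1), of i m S 0] by simp
    qed
    have RY: "?R - (s k' - s l) \<in> Y k'" if "k' \<le> Suc k" for k'
    proof (rule dyadic_avg_diff_in_subspace[OF Y_sub(1)])
      fix j assume j: "i + 2 ^ m \<le> j" "j < i + 2 ^ m + 2 ^ m"
      then have "n < j" "j < 2 ^ M" using n im by auto
      then have "k' \<le> r j" using r_mono[of n j] that by (auto simp: k_def)
      then show "S j - (s k' - s l) \<in> Y k'" using s_diff by (simp add: S_def)
    qed
    have bound: "q ((s k' - s l) - ?L) \<le> C * q (?R - ?L)" "(s k' - s l) - ?L \<in> H"
      if "k \<le> k'" "k' \<le> Suc k" for k'
    proof -
      have "(s k' - s l) - ?L \<in> X k'"
        using LX[OF that(1)] s_diff_in_X[of k' k' l] X_sub that kB by (simp add: subspace_diff)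
      then show "q ((s k' - s l) - ?L) \<le> C * q (?R - ?L)" "(s k' - s l) - ?L \<in> H"
        using proj_bound[of "(s k' - s l) - ?L" k' "?R - (s k' - s l)"] RY[OF that(2)] X_sub by auto
    qed
    \<comment> \<open>The increment is the difference of the two projections of
      \<open>?R - ?L\<close>, onto \<open>X (Suc k)\<close> and onto \<open>X k\<close>; each costs
      a factor \<open>C\<close> and the subtraction a factor 4 in total.\<close>
    have "q (s (Suc k) - s k) \<le> 4 * (C * q (?R - ?L))"
      using q_diff_le[OF bound(2)[of "Suc k"] bound(2)[of k]] bound(1)[of "Suc k"] bound(1)[of k]
      by simp
    then show ?thesis using kB C_pos by (simp add: field_simps)
  qed
  \<comment> \<open>All sampled iterates stay within \<open>C * q (w - s l)\<close> of
    \<open>s l\<close>, which is the upper bound that the accumulated gain of \<open>M\<close>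
    levels cannot exceed.\<close>
  have "real M * (\<delta> / (4 * C)) / 4 \<le> C * q (w - s l)"
  proof (rule dyadic_avg_gain[OF _ _ gap])
    fix j :: nat assume "j < 2 ^ M"
    then have "l \<le> r j" using B r_B by blast
    then show "S j \<in> H" "q (S j) \<le> C * q (w - s l)"
      using s_diff_in_X[of "r j" "r j" l] X_sub q_partial_le by (auto simp: S_def)
  qed
  then show ?thesis using C_pos by (simp add: field_simps power2_eq_square)
qed

text \<open>Increments are split at the threshold \<open>\<epsilon> * q (w - s l)\<close>. Those
  below contribute the part growing with \<open>N\<close>; those above number fewer than
  \<open>2 ^ M\<close> by the choice of \<open>M\<close> and each obey the crude bound.\<close>

lemma sum_increments_le:
  assumes "0 < \<epsilon>" "16 * C\<^sup>2 < \<epsilon> * real M"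
  shows "(\<Sum>k\<in>{l..<l + N}. q (s (Suc k) - s k)) \<le> (\<epsilon> * real N + 4 * C * 2 ^ M) * q (w - s l)"
proof -
  let ?e = "\<lambda>k. q (s (Suc k) - s k)" and ?Q = "q (w - s l)"
  have Q: "0 \<le> ?Q" using lim_diff Y_sub q_nonneg by blast
  define B where "B = {k \<in> {l..<l + N}. \<epsilon> * ?Q < ?e k}"
  have "?e k \<le> \<epsilon> * ?Q + (if k \<in> B then 4 * C * ?Q else 0)" if "k \<in> {l..<l + N}" for k
    using q_increment_le[of l k] that mult_nonneg_nonneg[OF less_imp_le[OF assms(1)] Q]
    by (auto simp: B_def)
  then have "(\<Sum>k\<in>{l..<l + N}. ?e k) \<le>
      (\<Sum>k\<in>{l..<l + N}. \<epsilon> * ?Q + (if k \<in> B then 4 * C * ?Q else 0))"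
    by (rule sum_mono)
  also have "\<dots> = \<epsilon> * real N * ?Q + real (card B) * (4 * C * ?Q)"
  proof -
    have "{l..<l + N} \<inter> B = B" by (auto simp: B_def)
    then show ?thesis by (simp add: sum.distrib flip: sum.inter_restrict)
  qed
  also have "real (card B) * (4 * C * ?Q) \<le> 2 ^ M * (4 * C * ?Q)"
  proof (cases "?Q = 0")
    case False
    \<comment> \<open>The case \<open>?Q = 0\<close> is separate because the contradiction below is
      a strict inequality multiplied by \<open>?Q\<close>; there both sides vanish.\<close>
    have "card B < 2 ^ M"
    proof (rule ccontr)
      assume "\<not> card B < 2 ^ M"
      then have "real M * (\<epsilon> * ?Q) \<le> 16 * C\<^sup>2 * ?Q"
        by (intro card_large_increments[of B]) (auto simp: B_def)
      moreover have "16 * C\<^sup>2 * ?Q < \<epsilon> * real M * ?Q"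
        using assms(2) Q False by (intro mult_strict_right_mono) auto
      ultimately show False by (simp add: algebra_simps)
    qed
    then have "real (card B) \<le> 2 ^ M" using of_nat_mono[of "card B" "2 ^ M"] by simp
    then show ?thesis using Q C_pos by (intro mult_right_mono) auto
  qed simp
  finally show ?thesis by (simp add: algebra_simps)
qed

end

section \<open>Linear convergence of perturbed contractions\<close>

text \<open>Summing the perturbed contraction over \<open>N\<close> steps telescopes and bounds the
  sum of the \<open>\<rho> k\<close> by a multiple of \<open>\<rho> l\<close>; quasi-monotonicity
  bounds \<open>N * \<rho> (l + N)\<close> by that sum. A perturbation growing like
  \<open>\<epsilon> * N\<close> is harmless if \<open>\<epsilon>\<close> is small against
  \<open>1 - \<kappa>\<close>. The constants precede \<open>\<rho>\<close> and \<open>e\<close>,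
  which is the uniformity needed later.\<close>

lemma linear_convergence:
  fixes \<kappa> c1 c2 :: real and G :: "real \<Rightarrow> real"
  assumes "0 < \<kappa>" "\<kappa> < 1" "0 < c1" "1 \<le> c2" and G: "\<And>\<epsilon>. 0 < \<epsilon> \<Longrightarrow> 0 \<le> G \<epsilon>"
  shows "\<exists>C r. 0 < C \<and> 0 < r \<and> r < 1 \<and>
    (\<forall>\<rho> e :: nat \<Rightarrow> real. (\<forall>k. 0 \<le> \<rho> k) \<longrightarrow>
       (\<forall>k. \<rho> (Suc k) \<le> \<kappa> * \<rho> k + c1 * e k) \<longrightarrow>
       (\<forall>l k. l \<le> k \<longrightarrow> \<rho> k \<le> c2 * \<rho> l) \<longrightarrow>
       (\<forall>\<epsilon> l N. 0 < \<epsilon> \<longrightarrow> (\<Sum>k\<in>{l..<l + N}. e k) \<le> (\<epsilon> * real N + G \<epsilon>) * \<rho> l) \<longrightarrow>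
       (\<forall>l n. l \<le> n \<longrightarrow> \<rho> n \<le> C * r ^ (n - l) * \<rho> l))"
proof -
  \<comment> \<open>Chosen so that \<open>c2 * c1 * \<epsilon> * N\<close> is exactly a quarter of
    \<open>(1 - \<kappa>) * N\<close>. The following \<open>N\<close> makes the constant part at
    most another quarter, so \<open>\<rho>\<close> halves every \<open>N\<close> steps.\<close>
  define \<epsilon> where "\<epsilon> = (1 - \<kappa>) / (4 * c1 * c2)"
  have \<epsilon>: "0 < \<epsilon>" using assms by (simp add: \<epsilon>_def)
  obtain N :: nat where N: "4 * c2 * (1 + c1 * G \<epsilon>) / (1 - \<kappa>) < real N"
    using reals_Archimedean2 by blast
  have "0 \<le> 4 * c2 * (1 + c1 * G \<epsilon>) / (1 - \<kappa>)" using assms G[OF \<epsilon>] by simp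
  with N have N0: "0 < N" by simp
  define r where "r = root N (1/2)"
  have r: "0 < r" "r < 1" "r ^ N = 1/2" using N0 by (auto simp: r_def)
  have main: "\<rho> n \<le> 2 * c2 * r ^ (n - l) * \<rho> l"
    if \<rho>: "\<forall>k. 0 \<le> \<rho> k" and red: "\<forall>k. \<rho> (Suc k) \<le> \<kappa> * \<rho> k + c1 * e k"
      and mono: "\<forall>l k. l \<le> k \<longrightarrow> \<rho> k \<le> c2 * \<rho> l"
      and qo: "\<forall>\<epsilon> l N. 0 < \<epsilon> \<longrightarrow> (\<Sum>k\<in>{l..<l + N}. e k) \<le> (\<epsilon> * real N + G \<epsilon>) * \<rho> l"
      and ln: "l \<le> n" for \<rho> e :: "nat \<Rightarrow> real" and l n
  proof -
    have half: "\<rho> (l + N) \<le> (1/2) * \<rho> l" for l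
    proof -
      let ?S = "\<Sum>k\<in>{l..<l + N}. \<rho> k"
      have "(\<Sum>k\<in>{l..<l + N}. \<rho> (Suc k)) \<le> (\<Sum>k\<in>{l..<l + N}. \<kappa> * \<rho> k + c1 * e k)"
        using red by (intro sum_mono) auto
      also have "\<dots> = \<kappa> * ?S + c1 * (\<Sum>k\<in>{l..<l + N}. e k)"
        by (simp add: sum.distrib sum_distrib_left)
      also have "\<dots> \<le> \<kappa> * ?S + c1 * ((\<epsilon> * real N + G \<epsilon>) * \<rho> l)"
        using qo \<epsilon> assms by (intro add_left_mono mult_left_mono) auto
      finally have 1: "(\<Sum>k\<in>{l..<l + N}. \<rho> (Suc k)) \<le> \<kappa> * ?S + c1 * ((\<epsilon> * real N + G \<epsilon>) * \<rho> l)" .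
      have "(\<Sum>k\<in>{l..<l + N}. \<rho> (Suc k)) - ?S = \<rho> (l + N) - \<rho> l"
        using sum_Suc_diff'[of l "l + N" \<rho>] by (simp add: sum_subtractf)
      then have 2: "(1 - \<kappa>) * ?S \<le> \<rho> l + c1 * ((\<epsilon> * real N + G \<epsilon>) * \<rho> l)"
        using 1 \<rho>[rule_format, of "l + N"] by (simp add: algebra_simps)
      have "real N * \<rho> (l + N) = (\<Sum>k\<in>{l..<l + N}. \<rho> (l + N))" by simp
      also have "\<dots> \<le> (\<Sum>k\<in>{l..<l + N}. c2 * \<rho> k)" using mono by (intro sum_mono) auto
      also have "\<dots> = c2 * ?S" by (simp add: sum_distrib_left)
      finally have "(1 - \<kappa>) * (real N * \<rho> (l + N)) \<le> (1 - \<kappa>) * (c2 * ?S)"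
        using assms by (intro mult_left_mono) auto
      also have "\<dots> = c2 * ((1 - \<kappa>) * ?S)" by simp
      also have "\<dots> \<le> c2 * (\<rho> l + c1 * ((\<epsilon> * real N + G \<epsilon>) * \<rho> l))"
        using 2 assms by (intro mult_left_mono) auto
      also have "\<dots> = (c2 * (1 + c1 * G \<epsilon>) + c2 * c1 * \<epsilon> * real N) * \<rho> l"
        by (simp add: algebra_simps)
      also have "\<dots> \<le> ((1 - \<kappa>) * real N / 4 + (1 - \<kappa>) * real N / 4) * \<rho> l"
      proof (intro mult_right_mono add_mono)
        show "c2 * (1 + c1 * G \<epsilon>) \<le> (1 - \<kappa>) * real N / 4"
          using N assms by (simp add: field_simps)
        show "c2 * c1 * \<epsilon> * real N \<le> (1 - \<kappa>) * real N / 4"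
          using assms by (simp add: \<epsilon>_def field_simps)
      qed (use \<rho> in auto)
      finally have "((1 - \<kappa>) * real N) * \<rho> (l + N) \<le> ((1 - \<kappa>) * real N) * ((1/2) * \<rho> l)"
        by (simp add: algebra_simps)
      then show ?thesis using assms N0 by (subst (asm) mult_le_cancel_left_pos) auto
    qed
    have iter: "\<rho> (l + j * N) \<le> (1/2) ^ j * \<rho> l" for j
    proof (induction j)
      case (Suc j)
      have "\<rho> (l + Suc j * N) \<le> (1/2) * \<rho> (l + j * N)"
        using half[of "l + j * N"] by (simp add: algebra_simps)
      then show ?case using Suc by simp
    qed simp
    define j i where "j = (n - l) div N" and "i = (n - l) mod N"
    have nl: "n - l = j * N + i" "i \<le> N" using N0 by (auto simp: j_def i_def less_imp_le)
    then have n: "n = l + j * N + i" using ln by simp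
    have "\<rho> n \<le> c2 * \<rho> (l + j * N)" using mono n by auto
    also have "\<dots> \<le> c2 * ((1/2) ^ j * \<rho> l)" using iter assms by (intro mult_left_mono) auto
    also have "\<dots> \<le> c2 * (2 * r ^ (n - l) * \<rho> l)"
    proof (intro mult_left_mono mult_right_mono)
      \<comment> \<open>The incomplete block of \<open>i \<le> N\<close> steps brings no decay;
        charging it as \<open>r ^ i\<close> costs at most a factor 2, hence the constant
        \<open>2 * c2\<close>.\<close>
      have "1/2 \<le> r ^ i" using power_decreasing[of i N r] nl r by simp
      then have "(1/2::real) ^ j * (1/2) \<le> (1/2) ^ j * r ^ i" by simp
      also have "(1/2::real) ^ j * r ^ i = r ^ (n - l)"
        by (simp add: nl power_add power_mult mult.commute[of j N] r(3))
      finally show "(1/2::real) ^ j \<le> 2 * r ^ (n - l)" by simp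
    qed (use assms \<rho> in auto)
    finally show ?thesis by (simp add: mult_ac)
  qed
  show ?thesis
  proof (intro exI conjI allI impI)
    show "0 < 2 * c2" using assms by simp
    show "0 < r" "r < 1" by (fact r)+
  qed (rule main)
qed

section \<open>Smooth bump functions\<close>

lemma partial_eqI:
  assumes "(f has_derivative f') (at x)"
  shows "partial i f x = f' (axis i 1)"
  using frechet_derivative_at[OF assms] by (simp add: partial_def)

lemma differentiable_has_frechet:
  "f differentiable (at x) \<Longrightarrow> (f has_derivative frechet_derivative f (at x)) (at x)"
  using frechet_derivative_works by blast

lemma partial_add:
  assumes "f differentiable (at x)" "g differentiable (at x)"
  shows "partial i (\<lambda>x. f x + g x) x = partial i f x + partial i g x"
  using partial_eqI[OF has_derivative_add[OF assms[THEN differentiable_has_frechet]]]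
  by (simp add: partial_def)

lemma partial_mult:
  assumes "f differentiable (at x)" "g differentiable (at x)"
  shows "partial i (\<lambda>x. f x * g x) x = partial i f x * g x + f x * partial i g x"
  using partial_eqI[OF has_derivative_mult[OF assms[THEN differentiable_has_frechet]]]
  by (simp add: partial_def)

lemma partial_const: "partial i (\<lambda>x. c) x = 0"
  by (rule partial_eqI[of _ "\<lambda>_. 0"]) simp

lemma Ck_continuous: "Ck k f \<Longrightarrow> continuous_on UNIV f"
  by (cases k) (auto simp: continuous_on_eq_continuous_at intro: differentiable_imp_continuous_within)

lemma Ck_SucD: "Ck (Suc k) f \<Longrightarrow> Ck k f"
proof (induction k arbitrary: f)
  case 0
  then show ?case using Ck_continuous[of "Suc 0" f] by simp
qed simp

lemma Ck_const: "Ck k (\<lambda>x. c)"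
proof (induction k arbitrary: c)
  case (Suc k)
  have "partial i (\<lambda>x. c) = (\<lambda>x. 0)" for i :: 'a by (simp add: fun_eq_iff partial_const)
  then show ?case using Suc by simp
qed simp

lemma Ck_add: "Ck k f \<Longrightarrow> Ck k g \<Longrightarrow> Ck k (\<lambda>x. f x + g x)"
proof (induction k arbitrary: f g)
  case (Suc k)
  have "partial i (\<lambda>x. f x + g x) = (\<lambda>x. partial i f x + partial i g x)" for i
    using Suc.prems by (simp add: fun_eq_iff partial_add)
  then show ?case using Suc by simp
qed (simp add: continuous_on_add)

lemma Ck_mult: "Ck k f \<Longrightarrow> Ck k g \<Longrightarrow> Ck k (\<lambda>x. f x * g x)"
proof (induction k arbitrary: f g)
  case (Suc k)
  have "partial i (\<lambda>x. f x * g x) = (\<lambda>x. partial i f x * g x + f x * partial i g x)" for i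
    using Suc.prems by (simp add: fun_eq_iff partial_mult)
  moreover have "Ck k f" "Ck k g" using Suc.prems Ck_SucD by auto
  ultimately show ?case using Suc by (simp add: Ck_add)
qed (simp add: continuous_on_mult)

lemma Ck_prod: "finite I \<Longrightarrow> (\<And>i. i \<in> I \<Longrightarrow> Ck k (f i)) \<Longrightarrow> Ck k (\<lambda>x. \<Prod>i\<in>I. f i x)"
  by (induction I rule: finite_induct) (simp_all add: Ck_const Ck_mult)

text \<open>The classical smooth function that is flat at 0. The polynomial factor in
  \<open>1 / t\<close> closes the family under differentiation, so that all orders of smoothness
  follow from one induction.\<close>

definition flat :: "real poly \<Rightarrow> real \<Rightarrow> real" where
  "flat p t = (if 0 < t then poly p (inverse t) * exp (- inverse t) else 0)"

text \<open>With \<open>s = 1 / t\<close> one has ds/dt = -s^2, so the derivative of p(s) exp(-s) in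
  t is s^2 (p(s) - p'(s)) exp(-s).\<close>

definition flat_deriv :: "real poly \<Rightarrow> real poly" where
  "flat_deriv p = monom 1 2 * (p - pderiv p)"

lemma tendsto_poly_times_exp_minus: "((\<lambda>s::real. poly p s * exp (- s)) \<longlongrightarrow> 0) at_top"
proof -
  have "((\<lambda>s::real. \<Sum>i\<le>degree p. coeff p i * (s ^ i / exp s)) \<longlongrightarrow> (\<Sum>i\<le>degree p. coeff p i * 0)) at_top"
    by (intro tendsto_sum tendsto_mult tendsto_const tendsto_power_div_exp_0)
  moreover have "(\<lambda>s::real. \<Sum>i\<le>degree p. coeff p i * (s ^ i / exp s)) = (\<lambda>s. poly p s * exp (- s))"
    by (simp add: fun_eq_iff poly_altdef sum_distrib_right exp_minus divide_inverse mult.assoc)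
  ultimately show ?thesis by simp
qed

lemma flat_tendsto_0: "(flat p \<longlongrightarrow> 0) (at 0)"
proof -
  have "(flat p \<longlongrightarrow> 0) (at_right 0)"
  proof (rule Lim_transform_eventually)
    show "((\<lambda>t. poly p (inverse t) * exp (- inverse t)) \<longlongrightarrow> 0) (at_right 0)"
      by (rule filterlim_compose[OF tendsto_poly_times_exp_minus filterlim_inverse_at_top_right])
    show "\<forall>\<^sub>F t in at_right 0. poly p (inverse t) * exp (- inverse t) = flat p t"
      by (auto simp: flat_def eventually_at_right_less intro: eventually_mono[OF eventually_at_right_less])
  qed
  moreover have "(flat p \<longlongrightarrow> 0) (at_left 0)"
    by (rule Lim_transform_eventually[OF tendsto_const])
      (auto simp: flat_def eventually_at_filter)
  ultimately show ?thesis by (simp add: filterlim_at_split)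
qed

lemma flat_has_derivative: "(flat p has_real_derivative flat (flat_deriv p) t) (at t)"
proof -
  consider "t < 0" | "t = 0" | "0 < t" by linarith
  then show ?thesis
  proof cases
    case 1
    have "((\<lambda>_. 0) has_real_derivative 0) (at t)" by simp
    then have "(flat p has_real_derivative 0) (at t)"
      by (rule has_field_derivative_transform_within_open[of _ _ _ "{..<0}"]) (use 1 in \<open>auto simp: flat_def\<close>)
    then show ?thesis using 1 by (simp add: flat_def)
  next
    case 2
    \<comment> \<open>Dividing by \<open>h\<close> multiplies the polynomial by its variable
      \<open>1 / h\<close>. The difference quotient at 0 is thus again a flat function and tends to
      0.\<close>
    have "flat (pCons 0 p) h = flat p h / h" for h
      by (simp add: flat_def field_simps)
    then have "((\<lambda>h. flat p h / h) \<longlongrightarrow> 0) (at 0)"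
      using flat_tendsto_0[of "pCons 0 p"] by presburger
    then show ?thesis using 2 by (simp add: DERIV_def) (simp add: flat_def)
  next
    case 3
    have "((\<lambda>t. poly p (inverse t) * exp (- inverse t)) has_real_derivative
        poly p (inverse t) * (exp (- inverse t) * (inverse t)\<^sup>2)
        + (poly (pderiv p) (inverse t) * (- (inverse t)\<^sup>2)) * exp (- inverse t)) (at t)"
      using 3 by (auto intro!: derivative_eq_intros simp: power2_eq_square)
    also have "poly p (inverse t) * (exp (- inverse t) * (inverse t)\<^sup>2)
        + (poly (pderiv p) (inverse t) * (- (inverse t)\<^sup>2)) * exp (- inverse t) = flat (flat_deriv p) t"
      using 3 by (simp add: flat_def flat_deriv_def poly_monom algebra_simps)
    finally show ?thesis
      by (rule has_field_derivative_transform_within_open[of _ _ _ "{0<..}"]) (use 3 in \<open>auto simp: flat_def\<close>)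
  qed
qed

lemma flat_coordinate_has_derivative:
  "((\<lambda>x. flat p (c * x $ j + d)) has_derivative
     (\<lambda>h. flat (flat_deriv p) (c * x $ j + d) * (c * h $ j))) (at (x :: real^'d))"
proof -
  have "((\<lambda>x. c * x $ j + d) has_derivative (\<lambda>h. c * h $ j)) (at x)"
    by (auto intro!: derivative_eq_intros bounded_linear_imp_has_derivative bounded_linear_vec_nth)
  from has_derivative_compose[OF this flat_has_derivative[unfolded has_field_derivative_def]]
  show ?thesis by simp
qed

lemma Ck_flat_coordinate: "Ck k (\<lambda>x :: real^'d. flat p (c * x $ j + d))"
proof (induction k arbitrary: p)
  case 0
  show ?case
    using flat_coordinate_has_derivative[of p c j d]
    by (auto simp: continuous_on_eq_continuous_at intro!: has_derivative_continuous)
next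
  case (Suc k)
  have "partial i (\<lambda>x. flat p (c * x $ j + d)) =
      (\<lambda>x. flat (flat_deriv p) (c * x $ j + d) * (c * (axis i 1 :: real^'d) $ j))" for i
    by (simp add: fun_eq_iff partial_eqI[OF flat_coordinate_has_derivative])
  moreover have "(\<lambda>x :: real^'d. flat p (c * x $ j + d)) differentiable (at x)" for x
    using flat_coordinate_has_derivative differentiable_def by blast
  ultimately show ?case using Suc by (simp add: Ck_mult Ck_const)
qed

text \<open>The dilation by \<open>Suc n\<close> steepens the flanks: the set where the function is
  nonzero stays \<open>box a b\<close>, while the values inside increase to 1 with
  \<open>n\<close>.\<close>

definition bump :: "real^'d \<Rightarrow> real^'d \<Rightarrow> nat \<Rightarrow> 'd::finite fn" where
  "bump a b n x = (\<Prod>j\<in>UNIV. flat 1 (real (Suc n) * x $ j + (- real (Suc n) * a $ j)) *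
                              flat 1 (- real (Suc n) * x $ j + real (Suc n) * b $ j))"

lemma Ck_bump: "Ck k (bump a b n)"
  unfolding bump_def by (intro Ck_prod Ck_mult Ck_flat_coordinate finite)

lemma flat_1: "flat 1 t = (if 0 < t then exp (- inverse t) else 0)"
  by (simp add: flat_def)

lemma bump_nonzero_iff: "bump a b n x \<noteq> 0 \<longleftrightarrow> x \<in> box a b"
proof -
  have 1: "0 < real (Suc n) * x $ j + (- real (Suc n) * a $ j) \<longleftrightarrow> a $ j < x $ j" for j
    using mult_less_cancel_left_pos[of "real (Suc n)" "a $ j" "x $ j"] by (auto simp del: of_nat_Suc)
  have 2: "0 < - real (Suc n) * x $ j + real (Suc n) * b $ j \<longleftrightarrow> x $ j < b $ j" for j
    using mult_less_cancel_left_pos[of "real (Suc n)" "x $ j" "b $ j"] by (auto simp del: of_nat_Suc)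
  show ?thesis
    unfolding bump_def mem_box_cart flat_1 1 2 by auto
qed

lemma bump_bounds: "0 \<le> bump a b n x" "bump a b n x \<le> 1"
proof -
  have "0 \<le> flat 1 t" "flat 1 t \<le> 1" for t by (auto simp: flat_1)
  then show "0 \<le> bump a b n x" "bump a b n x \<le> 1"
    unfolding bump_def by (auto intro!: prod_nonneg prod_le_1 mult_le_one)
qed

lemma bump_tendsto_indicator:
  fixes a b :: "real^'d"
  shows "(\<lambda>n. bump a b n x) \<longlonglongrightarrow> indicator (box a b) x"
proof (cases "x \<in> box a b")
  case True
  have *: "(\<lambda>n. flat 1 (real (Suc n) * t)) \<longlonglongrightarrow> 1" if "0 < t" for t
  proof -
    have "(\<lambda>n. exp (- (inverse (real (Suc n)) * inverse t))) \<longlonglongrightarrow> exp (- (0 * inverse t))"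
      by (intro tendsto_intros LIMSEQ_inverse_real_of_nat)
    then show ?thesis using that by (simp add: flat_1 zero_less_mult_iff)
  qed
  have "(\<lambda>n. \<Prod>j\<in>UNIV. flat 1 (real (Suc n) * (x $ j - a $ j)) * flat 1 (real (Suc n) * (b $ j - x $ j)))
      \<longlonglongrightarrow> (\<Prod>j\<in>(UNIV :: 'd set). 1 * 1)"
    by (intro tendsto_prod tendsto_mult *) (use True in \<open>auto simp: mem_box_cart simp del: of_nat_Suc\<close>)
  moreover have "bump a b n x = (\<Prod>j\<in>UNIV. flat 1 (real (Suc n) * (x $ j - a $ j)) *
      flat 1 (real (Suc n) * (b $ j - x $ j)))" for n
    unfolding bump_def by (simp only: right_diff_distrib) (simp only: diff_conv_add_uminus mult_minus_left add.commute)
  ultimately show ?thesis using True by simp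
next
  case False
  then have "bump a b n x = 0" for n using bump_nonzero_iff by blast
  then show ?thesis using False by simp
qed

lemma bump_test_function:
  assumes "cbox a b \<subseteq> \<Omega>"
  shows "bump a b n \<in> test_functions \<Omega>"
proof -
  have "closure {x. bump a b n x \<noteq> 0} \<subseteq> cbox a b"
    by (rule closure_minimal) (use box_subset_cbox in \<open>auto simp: bump_nonzero_iff\<close>)
  then show ?thesis
    using assms Ck_bump bounded_subset[OF bounded_cbox[of a b]] closure_subset
    by (auto simp: test_functions_def compact_eq_bounded_closed)
qed

text \<open>Dynkin's argument: boxes are stable under intersection and generate the Borel sets; the
  assumption \<open>zero\<close> provides closure under complements. Lebesgue sets differ from Borel
  sets by null sets, and a density whose integral vanishes on every measurable set is zero almost
  everywhere.\<close>

lemma integral_zero_on_boxes_imp_AE_zero: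
  fixes f :: "'a::euclidean_space \<Rightarrow> real"
  assumes f: "integrable lebesgue f" and zero: "(\<integral>x. f x \<partial>lebesgue) = 0"
    and box: "\<And>a b. (\<integral>x. indicator (box a b) x * f x \<partial>lebesgue) = 0"
  shows "AE x in lebesgue. f x = 0"
proof -
  have [measurable]: "f \<in> borel_measurable lebesgue" using f by simp
  have int: "integrable lebesgue (\<lambda>x. indicator A x * f x)" if "A \<in> sets lebesgue" for A
    using that f integrable_mult_indicator[of A lebesgue f] by simp
  have borel: "(\<integral>x\<in>A. f x \<partial>lebesgue) = 0" if "A \<in> sets borel" for A
  proof -
    let ?E = "range (\<lambda>(a, b). box a b :: 'a set)"
    have A: "A \<in> sigma_sets UNIV ?E"
      using that unfolding borel_eq_box by simp
    have stable: "Int_stable ?E"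
    proof (rule Int_stableI_image, simp only: split_paired_all)
      fix a b c d :: 'a
      show "\<exists>i\<in>UNIV. (case (a, b) of (a, b) \<Rightarrow> box a b) \<inter> (case (c, d) of (a, b) \<Rightarrow> box a b) =
          (case i of (a, b) \<Rightarrow> box a b)"
        by (simp add: box_Int_box) blast
    qed
    show ?thesis
    proof (induction rule: sigma_sets_induct_disjoint[OF stable _ A])
      case 1
      show ?case by simp
    next
      case (2 A)
      then show ?case using box by (auto simp: set_lebesgue_integral_def)
    next
      case 3
      show ?case by (simp add: set_lebesgue_integral_def)
    next
      case (4 A)
      then have "A \<in> sets borel" by (simp add: borel_eq_box)
      then have "A \<in> sets lebesgue" by simp
      then have "(\<integral>x. f x - indicator A x * f x \<partial>lebesgue) = 0"
        using 4 zero f int by (simp add: set_lebesgue_integral_def)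
      moreover have "f x - indicator A x * f x = indicator (UNIV - A) x *\<^sub>R f x" for x
        by (simp add: indicator_def)
      ultimately show ?case by (simp add: set_lebesgue_integral_def)
    next
      case (5 A)
      have A: "A i \<in> sets lebesgue" for i
      proof -
        have "A i \<in> sets borel" using 5 by (auto simp: borel_eq_box)
        then show ?thesis by simp
      qed
      have "(\<integral>x\<in>(\<Union>i. A i). f x \<partial>lebesgue) = (\<Sum>i. (\<integral>x\<in>A i. f x \<partial>lebesgue))"
        by (rule lebesgue_integral_countable_add)
          (use 5 A int in \<open>auto simp: disjoint_family_on_def set_integrable_def\<close>)
      then show ?case using 5 by simp
    qed
  qed
  have leb: "(\<integral>x\<in>A. f x \<partial>lebesgue) = 0" if A: "A \<in> sets lebesgue" for A
  proof -
    obtain S N N' where S: "A = S \<union> N" "N \<subseteq> N'" "N' \<in> null_sets lborel" "S \<in> sets lborel"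
      using A by (rule sets_completionE)
    then have "AE x in lebesgue. x \<notin> N'"
      by (intro AE_not_in) (auto intro: null_sets_completionI)
    then have "AE x in lebesgue. (x \<in> A) = (x \<in> S)" using S by auto
    then have "(\<integral>x\<in>A. f x \<partial>lebesgue) = (\<integral>x\<in>S. f x \<partial>lebesgue)"
      unfolding set_lebesgue_integral_def
    proof (intro integral_cong_AE)
      have "S \<in> sets lebesgue" using S(4) by simp
      then show "(\<lambda>x. indicator A x *\<^sub>R f x) \<in> borel_measurable lebesgue"
        "(\<lambda>x. indicator S x *\<^sub>R f x) \<in> borel_measurable lebesgue"
        using A by (intro borel_measurable_scaleR borel_measurable_indicator; simp)+
    qed (auto simp: indicator_def)
    then show ?thesis using borel S(4) by simp
  qed
  then show ?thesis
    using density_unique_real[OF f, of "\<lambda>_. 0"] by (simp add: set_lebesgue_integral_def)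
qed

text \<open>Bump functions are bounded by 1 and converge to indicators of boxes, so dominated
  convergence with majorant \<open>norm (g x)\<close> turns testing with smooth functions into
  testing with boxes.\<close>

lemma fundamental_lemma_calculus_of_variations:
  fixes \<Omega> :: "(real^'d) set"
  assumes "open \<Omega>" and g: "integrable (lebesgue_on \<Omega>) g"
    and test: "\<And>\<phi>. \<phi> \<in> test_functions \<Omega> \<Longrightarrow> (\<integral>x. g x * \<phi> x \<partial>lebesgue_on \<Omega>) = 0"
  shows "AE x in lebesgue_on \<Omega>. g x = 0"
proof -
  have \<Omega>: "\<Omega> \<in> sets lebesgue" using assms(1) by (simp add: lborelD borel_open)
  have [measurable]: "g \<in> borel_measurable (lebesgue_on \<Omega>)" using g by simp
  have on_box: "(\<integral>x. g x * indicator (box a b) x \<partial>lebesgue_on \<Omega>) = 0" if "cbox a b \<subseteq> \<Omega>" for a b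
  proof -
    have "(\<lambda>n. \<integral>x. g x * bump a b n x \<partial>lebesgue_on \<Omega>) \<longlonglongrightarrow> (\<integral>x. g x * indicator (box a b) x \<partial>lebesgue_on \<Omega>)"
    proof (rule integral_dominated_convergence[where w = "\<lambda>x. norm (g x)"])
      have "bump a b n \<in> borel_measurable borel" for n
        using Ck_continuous[OF Ck_bump[of 0 a b n]] by (rule borel_measurable_continuous_onI)
      then have [measurable]: "bump a b n \<in> borel_measurable (lebesgue_on \<Omega>)" for n
        by (simp add: borel_measurable_if_D measurable_completion measurable_restrict_space1)
      show "(\<lambda>x. g x * bump a b n x) \<in> borel_measurable (lebesgue_on \<Omega>)" for n by measurable
      have "indicator (box a b) \<in> borel_measurable (lebesgue_on \<Omega>)"
        by (intro measurable_restrict_space1 borel_measurable_indicator) simp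
      then show "(\<lambda>x. g x * indicator (box a b) x) \<in> borel_measurable (lebesgue_on \<Omega>)" by measurable
      show "AE x in lebesgue_on \<Omega>. norm (g x * bump a b n x) \<le> norm (g x)" for n
        using bump_bounds[of a b n] by (auto simp: abs_mult intro!: mult_left_le)
      show "AE x in lebesgue_on \<Omega>. (\<lambda>n. g x * bump a b n x) \<longlonglongrightarrow> g x * indicator (box a b) x"
        by (intro AE_I2 tendsto_mult tendsto_const bump_tendsto_indicator)
    qed (use g in auto)
    then show ?thesis using test[OF bump_test_function[OF that]] by (simp add: LIMSEQ_const_iff)
  qed
  \<comment> \<open>Cutting \<open>g\<close> off to one box yields a function integrable over the
    whole space whose integral over every box vanishes, since two boxes intersect in a box.\<close>
  have zero_on: "AE x in lebesgue. x \<in> cbox a b \<longrightarrow> g x = 0" if ab: "cbox a b \<subseteq> \<Omega>" for a b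
  proof -
    let ?f = "\<lambda>x. indicator (box a b) x * g x"
    have sub: "box a b \<subseteq> \<Omega>" using ab box_subset_cbox by blast
    have restr: "(\<integral>x. g x * indicator (box c d) x \<partial>lebesgue_on \<Omega>) = (\<integral>x. indicator (box c d) x * g x \<partial>lebesgue)"
      if "box c d \<subseteq> \<Omega>" for c d
    proof -
      have "(\<integral>x. g x * indicator (box c d) x \<partial>lebesgue_on \<Omega>) = (\<integral>x. indicator \<Omega> x *\<^sub>R (g x * indicator (box c d) x) \<partial>lebesgue)"
        using \<Omega> by (simp add: integral_restrict_space)
      also have "\<dots> = (\<integral>x. indicator (box c d) x * g x \<partial>lebesgue)"
        using that by (intro Bochner_Integration.integral_cong) (auto simp: indicator_def)
      finally show ?thesis .
    qed
    have "AE x in lebesgue. ?f x = 0"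
    proof (rule integral_zero_on_boxes_imp_AE_zero)
      have "integrable lebesgue (\<lambda>x. indicator \<Omega> x * g x)"
        using g \<Omega> by (simp add: integrable_restrict_space)
      then have "integrable lebesgue (\<lambda>x. indicator (box a b) x *\<^sub>R (indicator \<Omega> x * g x))"
        by (intro integrable_mult_indicator) auto
      moreover have "(\<lambda>x. indicator (box a b) x *\<^sub>R (indicator \<Omega> x * g x)) = ?f"
        using sub by (auto simp: indicator_def fun_eq_iff)
      ultimately show "integrable lebesgue ?f" by (simp only:)
      show "(\<integral>x. ?f x \<partial>lebesgue) = 0" using restr[OF sub] on_box[OF ab] by simp
      fix c d :: "real^'d"
      obtain c' d' where cd: "box c d \<inter> box a b = box c' d'"
        using box_Int_box[of c d a b] by blast
      have "(\<integral>x. indicator (box c d) x * ?f x \<partial>lebesgue) = (\<integral>x. indicator (box c' d') x * g x \<partial>lebesgue)"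
        by (simp flip: cd add: indicator_inter_arith mult.assoc)
      also have "\<dots> = 0"
      proof (cases "box c' d' = {}")
        case False
        \<comment> \<open>Nonemptiness is what links \<open>cbox c' d'\<close> to the closure of
          \<open>box c' d'\<close>; an empty open box may belong to a degenerate closed box lying
          elsewhere.\<close>
        then have "cbox c' d' \<subseteq> cbox a b"
          using cd closure_box[OF False] closure_mono[of "box c' d'" "cbox a b"] box_subset_cbox[of a b]
          by auto
        then show ?thesis using on_box[of c' d'] restr[of c' d'] ab box_subset_cbox[of c' d'] by auto
      qed simp
      finally show "(\<integral>x. indicator (box c d) x * ?f x \<partial>lebesgue) = 0" .
    qed
    moreover have "AE x in lebesgue. x \<notin> cbox a b - box a b"
      using negligible_frontier_interval[of a b] by (intro AE_not_in) (simp add: negligible_iff_null_sets)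
    ultimately show ?thesis by eventually_elim (auto simp: indicator_def split: if_splits)
  qed
  obtain \<D> where \<D>: "countable \<D>" "\<D> \<subseteq> Pow \<Omega>" "\<And>X. X \<in> \<D> \<Longrightarrow> \<exists>a b. X = cbox a b" "\<Union>\<D> = \<Omega>"
    using open_countable_Union_open_cbox[OF assms(1)] by metis
  have "AE x in lebesgue. \<forall>X\<in>\<D>. x \<in> X \<longrightarrow> g x = 0"
    using \<D>(1) by (subst AE_ball_countable) (use \<D>(2,3) zero_on in blast)+
  then have "AE x in lebesgue. x \<in> \<Omega> \<longrightarrow> g x = 0"
    by eventually_elim (use \<D>(4) in auto)
  then show ?thesis using \<Omega> by (simp add: AE_restrict_space_iff)
qed

section \<open>Sobolev spaces\<close>

text \<open>Difference quotients in a coordinate direction have integral zero by translation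
  invariance of Lebesgue measure, and dominated convergence passes to the derivative. This is the
  integration by parts used for test functions.\<close>

lemma integral_partial_eq_0:
  fixes f :: "real^'d \<Rightarrow> real"
  assumes diff: "\<And>x. f differentiable (at x)" and cont: "continuous_on UNIV (partial i f)"
    and K: "bounded K" "\<And>x. x \<notin> K \<Longrightarrow> f x = 0"
  shows "(\<integral>x. partial i f x \<partial>lborel) = 0"
proof -
  let ?e = "axis i 1 :: real^'d"
  obtain R where R: "0 < R" "K \<subseteq> cball 0 R"
    using K(1) unfolding bounded_pos by (auto simp: subset_iff)
  have f_cont: "continuous_on UNIV f"
    using diff by (simp add: continuous_on_eq_continuous_at differentiable_imp_continuous_within)
  have "compact (partial i f ` cball 0 (R + 2))"
    by (intro compact_continuous_image compact_cball continuous_on_subset[OF cont]) simp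
  then obtain M where M: "0 < M" "\<And>x. x \<in> cball 0 (R + 2) \<Longrightarrow> \<bar>partial i f x\<bar> \<le> M"
    by (metis bounded_pos compact_imp_bounded imageI real_norm_def)
  have deriv: "((\<lambda>t. f (x + t *\<^sub>R ?e)) has_real_derivative partial i f (x + t *\<^sub>R ?e)) (at t)" for x t
  proof -
    have "((\<lambda>t. x + t *\<^sub>R ?e) has_derivative (\<lambda>h. h *\<^sub>R ?e)) (at t)"
      by (auto intro!: derivative_eq_intros)
    from has_derivative_compose[OF this differentiable_has_frechet[OF diff]]
    have "((\<lambda>t. f (x + t *\<^sub>R ?e)) has_derivative
        (\<lambda>h. frechet_derivative f (at (x + t *\<^sub>R ?e)) (h *\<^sub>R ?e))) (at t)" .
    moreover have "frechet_derivative f (at (x + t *\<^sub>R ?e)) (h *\<^sub>R ?e) = partial i f (x + t *\<^sub>R ?e) * h" for h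
      using linear_scale[OF linear_frechet_derivative[OF diff]] by (simp add: partial_def)
    ultimately show ?thesis by (simp add: has_field_derivative_def)
  qed
  define F where "F = (\<lambda>n x. real (Suc n) * (f (x + (1 / real (Suc n)) *\<^sub>R ?e) - f x))"
  have f_meas [measurable]: "f \<in> borel_measurable borel"
    using f_cont by (rule borel_measurable_continuous_onI)
  have f_int: "integrable lborel f"
  proof -
    have "integrable lborel (\<lambda>x. indicator (cball 0 R) x *\<^sub>R f x)"
      by (intro borel_integrable_compact compact_cball continuous_on_subset[OF f_cont]) simp
    moreover have "(\<lambda>x. indicator (cball 0 R) x *\<^sub>R f x) = f"
      using K(2) R by (fastforce simp: fun_eq_iff indicator_def)
    ultimately show ?thesis by simp
  qed
  have shift: "integrable lborel (\<lambda>x. f (x + c))" "(\<integral>x. f (x + c) \<partial>lborel) = (\<integral>x. f x \<partial>lborel)" for c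
  proof -
    have "integrable (distr lborel borel ((+) c)) f" using f_int by (simp add: lborel_distr_plus)
    then show "integrable lborel (\<lambda>x. f (x + c))"
      by (subst (asm) integrable_distr_eq) (auto simp: add.commute)
    have "(\<integral>x. f x \<partial>lborel) = (\<integral>x. f x \<partial>distr lborel borel ((+) c))" by (simp add: lborel_distr_plus)
    also have "\<dots> = (\<integral>x. f (x + c) \<partial>lborel)" by (subst integral_distr) (auto simp: add.commute)
    finally show "(\<integral>x. f (x + c) \<partial>lborel) = (\<integral>x. f x \<partial>lborel)" by simp
  qed
  have "(\<lambda>n. \<integral>x. F n x \<partial>lborel) \<longlonglongrightarrow> (\<integral>x. partial i f x \<partial>lborel)"
  proof (rule integral_dominated_convergence[where w = "\<lambda>x. M * indicator (cball 0 (R + 1)) x"])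
    show "partial i f \<in> borel_measurable lborel"
      using borel_measurable_continuous_onI[OF cont] by simp
    show "F n \<in> borel_measurable lborel" for n unfolding F_def by measurable
    show "integrable lborel (\<lambda>x. M * indicator (cball 0 (R + 1)) x)"
      by (intro integrable_mult_right integrable_real_indicator emeasure_lborel_cball_finite) auto
    show "AE x in lborel. (\<lambda>n. F n x) \<longlonglongrightarrow> partial i f x"
    proof (rule AE_I2)
      fix x
      have "((\<lambda>h. (f (x + h *\<^sub>R ?e) - f x) / h) \<longlongrightarrow> partial i f x) (at 0)"
        using deriv[of x 0] by (simp add: DERIV_def)
      moreover have "filterlim (\<lambda>n. 1 / real (Suc n)) (at 0) sequentially"
        unfolding filterlim_at using LIMSEQ_Suc[OF lim_inverse_n'] by (auto simp: field_simps)
      ultimately have "(\<lambda>n. (f (x + (1 / real (Suc n)) *\<^sub>R ?e) - f x) / (1 / real (Suc n))) \<longlonglongrightarrow> partial i f x"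
        by (rule filterlim_compose)
      then show "(\<lambda>n. F n x) \<longlonglongrightarrow> partial i f x" by (simp add: F_def mult.commute)
    qed
    \<comment> \<open>Inside radius \<open>R + 1\<close> the mean value theorem evaluates the
      derivative within radius \<open>R + 2\<close>, where \<open>M\<close> bounds it. Outside,
      neither \<open>x\<close> nor its translate by at most 1 meets the support.\<close>
    show "AE x in lborel. norm (F n x) \<le> M * indicator (cball 0 (R + 1)) x" for n
    proof (rule AE_I2)
      fix x
      let ?h = "1 / real (Suc n)"
      have h: "0 < ?h" "?h \<le> 1" by auto
      show "norm (F n x) \<le> M * indicator (cball 0 (R + 1)) x"
      proof (cases "x \<in> cball 0 (R + 1)")
        case True
        obtain \<xi> where \<xi>: "0 < \<xi>" "\<xi> < ?h"
          "f (x + ?h *\<^sub>R ?e) - f (x + 0 *\<^sub>R ?e) = (?h - 0) * partial i f (x + \<xi> *\<^sub>R ?e)"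
          using MVT2[OF h(1), of "\<lambda>t. f (x + t *\<^sub>R ?e)" "\<lambda>t. partial i f (x + t *\<^sub>R ?e)"] deriv by blast
        then have "F n x = partial i f (x + \<xi> *\<^sub>R ?e)" by (simp add: F_def)
        moreover have "norm (x + \<xi> *\<^sub>R ?e) \<le> R + 2"
          using True norm_triangle_ineq[of x "\<xi> *\<^sub>R ?e"] less_le_trans[OF \<xi>(2) h(2)] \<xi>(1)
          by (simp add: norm_axis_1)
        ultimately show ?thesis using M(2) True by simp
      next
        case False
        have "norm x \<le> norm (x + ?h *\<^sub>R ?e) + norm (?h *\<^sub>R ?e)"
          using norm_triangle_ineq4[of "x + ?h *\<^sub>R ?e" "?h *\<^sub>R ?e"] by simp
        also have "norm (?h *\<^sub>R ?e) \<le> 1" using h by (simp add: norm_axis_1)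
        finally have "x + ?h *\<^sub>R ?e \<notin> K" "x \<notin> K" using False R by auto
        then show ?thesis using K(2) False by (simp add: F_def)
      qed
    qed
  qed
  moreover have "(\<integral>x. F n x \<partial>lborel) = 0" for n
    unfolding F_def using shift f_int by simp
  ultimately show ?thesis by (simp add: LIMSEQ_const_iff)
qed

section \<open>Square integrable functions\<close>

lemma in_L2_add:
  assumes "in_L2 \<Omega> f" "in_L2 \<Omega> g"
  shows "in_L2 \<Omega> (\<lambda>x. f x + g x)"
proof -
  have [measurable]: "f \<in> borel_measurable (lebesgue_on \<Omega>)" "g \<in> borel_measurable (lebesgue_on \<Omega>)"
    using assms by (auto simp: in_L2_def)
  have "integrable (lebesgue_on \<Omega>) (\<lambda>x. (norm (f x + g x))\<^sup>2)"
  proof (rule Bochner_Integration.integrable_bound)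
    show "integrable (lebesgue_on \<Omega>) (\<lambda>x. 2 * (norm (f x))\<^sup>2 + 2 * (norm (g x))\<^sup>2)"
      using assms by (auto simp: in_L2_def)
    have "(norm (f x + g x))\<^sup>2 \<le> 2 * (norm (f x))\<^sup>2 + 2 * (norm (g x))\<^sup>2" for x
    proof -
      have "(norm (f x + g x))\<^sup>2 \<le> (norm (f x) + norm (g x))\<^sup>2"
        by (intro power_mono norm_triangle_ineq) auto
      also have "\<dots> \<le> 2 * (norm (f x))\<^sup>2 + 2 * (norm (g x))\<^sup>2"
        using sum_squares_ge_zero[of "norm (f x) - norm (g x)" 0] by (simp add: power2_eq_square algebra_simps)
      finally show ?thesis .
    qed
    then show "AE x in lebesgue_on \<Omega>. norm ((norm (f x + g x))\<^sup>2) \<le> norm (2 * (norm (f x))\<^sup>2 + 2 * (norm (g x))\<^sup>2)"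
      by (auto intro!: order_trans[OF _ abs_ge_self])
  qed measurable
  then show ?thesis by (simp add: in_L2_def)
qed

lemma in_L2_scaleR:
  assumes "in_L2 \<Omega> f"
  shows "in_L2 \<Omega> (\<lambda>x. c *\<^sub>R f x)"
proof -
  have "(\<lambda>x. (norm (c *\<^sub>R f x))\<^sup>2) = (\<lambda>x. c\<^sup>2 * (norm (f x))\<^sup>2)"
    by (simp add: power_mult_distrib)
  then show ?thesis using assms by (auto simp: in_L2_def)
qed

lemma integrable_bounded_mult_L2:
  assumes "in_L2 \<Omega> f" "in_L2 \<Omega> g" and h: "h \<in> borel_measurable (lebesgue_on \<Omega>)"
    and le: "AE x in lebesgue_on \<Omega>. \<bar>h x\<bar> \<le> C * norm (f x) * norm (g x)"
  shows "integrable (lebesgue_on \<Omega>) h"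
proof (rule Bochner_Integration.integrable_bound[OF _ h])
  show "integrable (lebesgue_on \<Omega>) (\<lambda>x. \<bar>C\<bar> * ((norm (f x))\<^sup>2 + (norm (g x))\<^sup>2))"
    using assms by (auto simp: in_L2_def)
  show "AE x in lebesgue_on \<Omega>. norm (h x) \<le> norm (\<bar>C\<bar> * ((norm (f x))\<^sup>2 + (norm (g x))\<^sup>2))"
    using le
  proof eventually_elim
    case (elim x)
    have "C * norm (f x) * norm (g x) \<le> \<bar>C\<bar> * (norm (f x) * norm (g x))"
      by (simp add: mult.assoc mult_right_mono)
    also have "norm (f x) * norm (g x) \<le> (norm (f x))\<^sup>2 + (norm (g x))\<^sup>2"
      using sum_squares_bound[of "norm (f x)" "norm (g x)"]
        mult_nonneg_nonneg[OF norm_ge_zero norm_ge_zero, of "f x" "g x"] by linarith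
    finally show ?case using elim by (simp add: mult_left_mono abs_mult)
  qed
qed

lemma integrable_L2_inner:
  assumes "in_L2 \<Omega> f" "in_L2 \<Omega> g"
  shows "integrable (lebesgue_on \<Omega>) (\<lambda>x. f x \<bullet> g x)"
proof (rule integrable_bounded_mult_L2[OF assms, where C = 1])
  show "(\<lambda>x. f x \<bullet> g x) \<in> borel_measurable (lebesgue_on \<Omega>)"
    using assms by (auto simp: in_L2_def intro: borel_measurable_inner)
qed (simp add: Cauchy_Schwarz_ineq2)

lemma borel_measurable_vec_nth [measurable (raw)]:
  fixes f :: "'a \<Rightarrow> ('b::euclidean_space)^'n"
  assumes "f \<in> borel_measurable N"
  shows "(\<lambda>x. f x $ i) \<in> borel_measurable N"
  by (rule measurable_compose[OF assms borel_measurable_continuous_onI])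
    (auto intro!: continuous_intros)

lemma in_L2_vec_nth:
  fixes g :: "real^'d \<Rightarrow> real^'n"
  assumes "in_L2 \<Omega> g"
  shows "in_L2 \<Omega> (\<lambda>x. g x $ i)"
proof -
  have m: "(\<lambda>x. g x $ i) \<in> borel_measurable (lebesgue_on \<Omega>)"
    using assms by (auto simp: in_L2_def intro!: borel_measurable_vec_nth)
  have "integrable (lebesgue_on \<Omega>) (\<lambda>x. (norm (g x $ i))\<^sup>2)"
  proof (rule Bochner_Integration.integrable_bound)
    show "integrable (lebesgue_on \<Omega>) (\<lambda>x. (norm (g x))\<^sup>2)" using assms by (simp add: in_L2_def)
    show "(\<lambda>x. (norm (g x $ i))\<^sup>2) \<in> borel_measurable (lebesgue_on \<Omega>)" using m by measurable
    show "AE x in lebesgue_on \<Omega>. norm ((norm (g x $ i))\<^sup>2) \<le> norm ((norm (g x))\<^sup>2)"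
      using power_mono[OF component_le_norm_cart abs_ge_zero, of "g _" i 2] by simp
  qed
  then show ?thesis using m by (simp add: in_L2_def)
qed

locale bounded_open =
  fixes \<Omega> :: "(real^'d) set"
  assumes open_\<Omega>: "open \<Omega>" and bounded_\<Omega>: "bounded \<Omega>"
begin

abbreviation M where "M \<equiv> lebesgue_on \<Omega>"

lemma \<Omega>_lebesgue: "\<Omega> \<in> sets lebesgue"
  using open_\<Omega> by simp

lemma integral_vanishing_outside:
  fixes f :: "real^'d \<Rightarrow> real"
  assumes "f \<in> borel_measurable borel" "\<And>x. x \<notin> \<Omega> \<Longrightarrow> f x = 0"
  shows "(\<integral>x. f x \<partial>M) = (\<integral>x. f x \<partial>lborel)"
proof -
  have "(\<integral>x. f x \<partial>M) = (\<integral>x. indicator \<Omega> x *\<^sub>R f x \<partial>lebesgue)"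
    using \<Omega>_lebesgue by (simp add: integral_restrict_space)
  also have "(\<lambda>x. indicator \<Omega> x *\<^sub>R f x) = f" using assms(2) by (auto simp: fun_eq_iff indicator_def)
  finally show ?thesis using assms(1) by (simp add: integral_completion)
qed

lemma finite_measure_M: "finite_measure M"
proof
  have "\<Omega> \<in> lmeasurable" using bounded_\<Omega> open_\<Omega> by (simp add: lmeasurable_open)
  then show "emeasure M (space M) \<noteq> \<infinity>"
    using \<Omega>_lebesgue by (simp add: emeasure_restrict_space space_restrict_space fmeasurable_def)
qed

lemma in_L2_continuous:
  fixes f :: "real^'d \<Rightarrow> 'b::euclidean_space"
  assumes "continuous_on UNIV f"
  shows "in_L2 \<Omega> f"
proof -
  have m: "f \<in> borel_measurable M"
    using borel_measurable_continuous_onI[OF assms] by (simp add: measurable_completion measurable_restrict_space1)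
  have "compact (f ` closure \<Omega>)"
    using bounded_\<Omega> by (intro compact_continuous_image continuous_on_subset[OF assms]) auto
  then obtain B where B: "\<And>x. x \<in> closure \<Omega> \<Longrightarrow> norm (f x) \<le> B"
    by (metis bounded_iff compact_imp_bounded imageI)
  have "integrable M (\<lambda>x. (norm (f x))\<^sup>2)"
  proof (rule finite_measure.integrable_const_bound[OF finite_measure_M, where B = "B\<^sup>2"])
    show "AE x in M. norm ((norm (f x))\<^sup>2) \<le> B\<^sup>2"
      using B closure_subset[of \<Omega>] by (auto simp: space_restrict_space intro!: AE_I2 power_mono)
    show "(\<lambda>x. (norm (f x))\<^sup>2) \<in> borel_measurable M" using m by measurable
  qed
  then show ?thesis using m by (simp add: in_L2_def)
qed

lemma integrable_L2:
  fixes f :: "real^'d \<Rightarrow> real"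
  assumes "in_L2 \<Omega> f"
  shows "integrable M f"
  using integrable_L2_inner[OF assms in_L2_continuous[of "\<lambda>_. 1"]] by simp

section \<open>Test functions: integration by parts and the Poincare inequality\<close>

lemma test_function_Ck: "\<phi> \<in> test_functions \<Omega> \<Longrightarrow> Ck k \<phi>"
  by (simp add: test_functions_def)

lemma test_function_differentiable: "\<phi> \<in> test_functions \<Omega> \<Longrightarrow> \<phi> differentiable (at x)"
  using test_function_Ck[of \<phi> "Suc 0"] by simp

lemma test_function_continuous: "\<phi> \<in> test_functions \<Omega> \<Longrightarrow> continuous_on UNIV \<phi>"
  using test_function_Ck[of \<phi> 0] by simp

lemma test_function_partial_continuous: "\<phi> \<in> test_functions \<Omega> \<Longrightarrow> continuous_on UNIV (partial i \<phi>)"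
  using test_function_Ck[of \<phi> "Suc 0"] by simp

lemma test_function_zero: "\<phi> \<in> test_functions \<Omega> \<Longrightarrow> x \<notin> \<Omega> \<Longrightarrow> \<phi> x = 0"
  using closure_subset[of "{x. \<phi> x \<noteq> 0}"] by (auto simp: test_functions_def)

lemma test_function_add:
  assumes "\<phi> \<in> test_functions \<Omega>" "\<psi> \<in> test_functions \<Omega>"
  shows "(\<lambda>x. \<phi> x + \<psi> x) \<in> test_functions \<Omega>"
proof -
  have "{x. \<phi> x + \<psi> x \<noteq> 0} \<subseteq> {x. \<phi> x \<noteq> 0} \<union> {x. \<psi> x \<noteq> 0}" by auto
  then have "closure {x. \<phi> x + \<psi> x \<noteq> 0} \<subseteq> closure {x. \<phi> x \<noteq> 0} \<union> closure {x. \<psi> x \<noteq> 0}"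
    unfolding closure_Un[symmetric] by (rule closure_mono)
  moreover have "bounded {x. \<phi> x + \<psi> x \<noteq> 0}"
    by (rule bounded_subset[OF bounded_\<Omega>]) (use test_function_zero[OF assms(1)] test_function_zero[OF assms(2)] in force)
  ultimately show ?thesis using assms by (auto simp: test_functions_def Ck_add)
qed

lemma test_function_scale:
  assumes "\<phi> \<in> test_functions \<Omega>"
  shows "(\<lambda>x. c * \<phi> x) \<in> test_functions \<Omega>"
proof -
  have "closure {x. c * \<phi> x \<noteq> 0} \<subseteq> closure {x. \<phi> x \<noteq> 0}" by (rule closure_mono) auto
  moreover have "bounded {x. c * \<phi> x \<noteq> 0}"
    by (rule bounded_subset[OF bounded_\<Omega>]) (use test_function_zero assms in force)
  ultimately show ?thesis using assms by (auto simp: test_functions_def Ck_mult Ck_const)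
qed

text \<open>The product of two test functions vanishes outside \<open>\<Omega>\<close>, so the
  integral of its partial derivative is zero and the product rule gives the defining identity. It
  connects \<open>wgrad\<close> to classical derivatives on the functions approximating
  \<open>H10\<close>.\<close>

lemma test_function_weak_gradient:
  assumes \<phi>: "\<phi> \<in> test_functions \<Omega>"
  shows "has_weak_gradient \<Omega> \<phi> (\<lambda>x. \<chi> i. partial i \<phi> x)"
  unfolding has_weak_gradient_def
proof (intro conjI ballI allI)
  show "in_L2 \<Omega> \<phi>" by (intro in_L2_continuous test_function_continuous \<phi>)
  show "in_L2 \<Omega> (\<lambda>x. \<chi> i. partial i \<phi> x)"
    by (intro in_L2_continuous continuous_on_vec_lambda test_function_partial_continuous \<phi>)
  fix \<psi> i assume \<psi>: "\<psi> \<in> test_functions \<Omega>"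
  note c = test_function_continuous[OF \<phi>] test_function_continuous[OF \<psi>]
    test_function_partial_continuous[OF \<phi>] test_function_partial_continuous[OF \<psi>]
  have p: "partial i (\<lambda>x. \<phi> x * \<psi> x) = (\<lambda>x. partial i \<phi> x * \<psi> x + \<phi> x * partial i \<psi> x)"
    using test_function_differentiable \<phi> \<psi> by (simp add: fun_eq_iff partial_mult)
  have "(\<integral>x. partial i (\<lambda>x. \<phi> x * \<psi> x) x \<partial>lborel) = 0"
  proof (rule integral_partial_eq_0[OF _ _ bounded_\<Omega>])
    show "(\<lambda>x. \<phi> x * \<psi> x) differentiable at x" for x
      using test_function_differentiable \<phi> \<psi> by (intro differentiable_mult) auto
    show "continuous_on UNIV (partial i (\<lambda>x. \<phi> x * \<psi> x))"
      unfolding p by (intro continuous_intros c)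
  qed (use test_function_zero[OF \<phi>] in auto)
  also have "(\<integral>x. partial i (\<lambda>x. \<phi> x * \<psi> x) x \<partial>lborel) = (\<integral>x. partial i \<phi> x * \<psi> x + \<phi> x * partial i \<psi> x \<partial>M)"
    unfolding p
    by (rule integral_vanishing_outside[symmetric])
      (use test_function_zero[OF \<phi>] test_function_zero[OF \<psi>]
        in \<open>auto intro!: borel_measurable_continuous_onI continuous_intros c\<close>)
  also have "\<dots> = (\<integral>x. partial i \<phi> x * \<psi> x \<partial>M) + (\<integral>x. \<phi> x * partial i \<psi> x \<partial>M)"
    by (intro Bochner_Integration.integral_add integrable_L2 in_L2_continuous continuous_intros c)
  finally show "(\<integral>x. \<phi> x * partial i \<psi> x \<partial>M) = - (\<integral>x. (\<chi> i. partial i \<phi> x) $ i * \<psi> x \<partial>M)"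
    by simp
qed

text \<open>Integrate \<open>\<partial>\<^sub>i (x\<^sub>i \<phi>\<^sup>2) = \<phi>\<^sup>2 + 2 x\<^sub>i \<phi> \<partial>\<^sub>i \<phi>\<close> and absorb the mixed term by Young's inequality.\<close>

lemma Poincare_test_function:
  assumes \<phi>: "\<phi> \<in> test_functions \<Omega>" and R: "\<And>x. x \<in> \<Omega> \<Longrightarrow> \<bar>x $ i\<bar> \<le> R"
  shows "(\<integral>x. (\<phi> x)\<^sup>2 \<partial>M) \<le> 4 * R\<^sup>2 * (\<integral>x. (partial i \<phi> x)\<^sup>2 \<partial>M)"
proof -
  note c = test_function_continuous[OF \<phi>] test_function_partial_continuous[OF \<phi>]
  have nth: "(\<lambda>x::real^'d. x $ i) differentiable at x" "partial i (\<lambda>x::real^'d. x $ i) x = 1" for x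
  proof -
    have "((\<lambda>x::real^'d. x $ i) has_derivative (\<lambda>h. h $ i)) (at x)"
      by (intro bounded_linear_imp_has_derivative bounded_linear_vec_nth)
    then show "(\<lambda>x::real^'d. x $ i) differentiable at x" "partial i (\<lambda>x::real^'d. x $ i) x = 1"
      by (auto simp: differentiable_def partial_eqI)
  qed
  have p: "partial i (\<lambda>x. x $ i * (\<phi> x * \<phi> x)) = (\<lambda>x. (\<phi> x)\<^sup>2 + 2 * (x $ i * \<phi> x * partial i \<phi> x))"
    using test_function_differentiable[OF \<phi>] nth
    by (simp add: fun_eq_iff partial_mult differentiable_mult power2_eq_square algebra_simps)
  have "(\<integral>x. partial i (\<lambda>x. x $ i * (\<phi> x * \<phi> x)) x \<partial>lborel) = 0"
  proof (rule integral_partial_eq_0[OF _ _ bounded_\<Omega>])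
    show "(\<lambda>x. x $ i * (\<phi> x * \<phi> x)) differentiable at x" for x
      using test_function_differentiable \<phi> nth by (intro differentiable_mult) auto
    show "continuous_on UNIV (partial i (\<lambda>x. x $ i * (\<phi> x * \<phi> x)))"
      unfolding p by (intro continuous_intros c)
  qed (use test_function_zero[OF \<phi>] in auto)
  also have "(\<integral>x. partial i (\<lambda>x. x $ i * (\<phi> x * \<phi> x)) x \<partial>lborel) = (\<integral>x. (\<phi> x)\<^sup>2 + 2 * (x $ i * \<phi> x * partial i \<phi> x) \<partial>M)"
    unfolding p
    by (rule integral_vanishing_outside[symmetric])
      (use test_function_zero[OF \<phi>] in \<open>auto intro!: borel_measurable_continuous_onI continuous_intros c\<close>)
  finally have zero: "(\<integral>x. (\<phi> x)\<^sup>2 + 2 * (x $ i * \<phi> x * partial i \<phi> x) \<partial>M) = 0" .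
  have int: "integrable M (\<lambda>x. (\<phi> x)\<^sup>2)" "integrable M (\<lambda>x. (partial i \<phi> x)\<^sup>2)"
    "integrable M (\<lambda>x. x $ i * \<phi> x * partial i \<phi> x)"
    by (auto intro!: integrable_L2 in_L2_continuous continuous_intros c)
  \<comment> \<open>The expression with zero integral is added to the integrand, after which the
    inequality holds pointwise: it is twice the square of
    \<open>\<phi> x / 2 + x $ i * partial i \<phi> x\<close> being nonnegative.\<close>
  have "(\<integral>x. (\<phi> x)\<^sup>2 / 2 \<partial>M) \<le> (\<integral>x. 2 * R\<^sup>2 * (partial i \<phi> x)\<^sup>2 + ((\<phi> x)\<^sup>2 + 2 * (x $ i * \<phi> x * partial i \<phi> x)) \<partial>M)"
  proof (rule integral_mono_AE)
    show "AE x in M. (\<phi> x)\<^sup>2 / 2 \<le> 2 * R\<^sup>2 * (partial i \<phi> x)\<^sup>2 + ((\<phi> x)\<^sup>2 + 2 * (x $ i * \<phi> x * partial i \<phi> x))"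
    proof (rule AE_I2)
      fix x assume "x \<in> space M"
      then have "(x $ i)\<^sup>2 \<le> R\<^sup>2"
        using R power_mono[of "\<bar>x $ i\<bar>" R 2] by (simp add: space_restrict_space)
      then have "(x $ i)\<^sup>2 * (partial i \<phi> x)\<^sup>2 \<le> R\<^sup>2 * (partial i \<phi> x)\<^sup>2"
        by (intro mult_right_mono) auto
      moreover have "0 \<le> (\<phi> x / 2 + x $ i * partial i \<phi> x)\<^sup>2" by simp
      ultimately show "(\<phi> x)\<^sup>2 / 2 \<le> 2 * R\<^sup>2 * (partial i \<phi> x)\<^sup>2 + ((\<phi> x)\<^sup>2 + 2 * (x $ i * \<phi> x * partial i \<phi> x))"
        by (simp add: power2_eq_square algebra_simps)
    qed
  qed (use int in auto)
  also have "\<dots> = 2 * R\<^sup>2 * (\<integral>x. (partial i \<phi> x)\<^sup>2 \<partial>M)"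
    using int zero by (subst Bochner_Integration.integral_add) auto
  finally show ?thesis by simp
qed

section \<open>Uniqueness and linearity of weak gradients\<close>

lemma in_L2_diff:
  assumes "in_L2 \<Omega> f" "in_L2 \<Omega> g"
  shows "in_L2 \<Omega> (\<lambda>x. f x - g x)"
  using in_L2_add[OF assms(1) in_L2_scaleR[OF assms(2), of "- 1"]] by simp

lemma integrable_L2_mult:
  assumes "in_L2 \<Omega> f" "in_L2 \<Omega> g"
  shows "integrable M (\<lambda>x. f x * g x :: real)"
  using integrable_L2_inner[OF assms] by simp

text \<open>The fundamental lemma applies to each component of the difference. Without uniqueness,
  \<open>wgrad\<close> of a sum would be unrelated to the sum of the gradients.\<close>

lemma weak_gradient_unique:
  assumes g: "has_weak_gradient \<Omega> v g" and h: "has_weak_gradient \<Omega> v h"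
  shows "AE x in M. g x = h x"
proof -
  have "AE x in M. g x $ i - h x $ i = 0" for i
  proof (rule fundamental_lemma_calculus_of_variations[OF open_\<Omega>])
    have L2: "in_L2 \<Omega> (\<lambda>x. g x $ i)" "in_L2 \<Omega> (\<lambda>x. h x $ i)"
      using g h by (auto simp: has_weak_gradient_def intro: in_L2_vec_nth)
    then show "integrable M (\<lambda>x. g x $ i - h x $ i)" by (intro integrable_L2 in_L2_diff)
    fix \<phi> assume \<phi>: "\<phi> \<in> test_functions \<Omega>"
    have "(\<integral>x. (g x $ i - h x $ i) * \<phi> x \<partial>M) = (\<integral>x. g x $ i * \<phi> x \<partial>M) - (\<integral>x. h x $ i * \<phi> x \<partial>M)"
      unfolding left_diff_distrib using L2 in_L2_continuous[OF test_function_continuous[OF \<phi>]]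
      by (intro Bochner_Integration.integral_diff integrable_L2_mult)
    moreover have "(\<integral>x. g x $ i * \<phi> x \<partial>M) = (\<integral>x. h x $ i * \<phi> x \<partial>M)"
      using g h \<phi> by (auto simp: has_weak_gradient_def)
    ultimately show "(\<integral>x. (g x $ i - h x $ i) * \<phi> x \<partial>M) = 0" by simp
  qed
  then have "AE x in M. \<forall>i. g x $ i - h x $ i = 0" by (simp add: AE_all_countable)
  then show ?thesis by eventually_elim (simp add: vec_eq_iff)
qed

lemma weak_gradient_add:
  assumes "has_weak_gradient \<Omega> u g" "has_weak_gradient \<Omega> v h"
  shows "has_weak_gradient \<Omega> (\<lambda>x. u x + v x) (\<lambda>x. g x + h x)"
proof -
  have L2: "in_L2 \<Omega> u" "in_L2 \<Omega> v" "in_L2 \<Omega> g" "in_L2 \<Omega> h"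
    using assms by (auto simp: has_weak_gradient_def)
  have "(\<integral>x. (u x + v x) * partial i \<phi> x \<partial>M) = - (\<integral>x. (g x + h x) $ i * \<phi> x \<partial>M)"
    if \<phi>: "\<phi> \<in> test_functions \<Omega>" for \<phi> i
  proof -
    have \<phi>L2: "in_L2 \<Omega> \<phi>" "in_L2 \<Omega> (partial i \<phi>)"
      using \<phi> by (auto intro!: in_L2_continuous test_function_continuous test_function_partial_continuous)
    have "(\<integral>x. (u x + v x) * partial i \<phi> x \<partial>M) = (\<integral>x. u x * partial i \<phi> x \<partial>M) + (\<integral>x. v x * partial i \<phi> x \<partial>M)"
      unfolding distrib_right using L2 \<phi>L2 by (intro Bochner_Integration.integral_add integrable_L2_mult)
    moreover have "(\<integral>x. (g x + h x) $ i * \<phi> x \<partial>M) = (\<integral>x. g x $ i * \<phi> x \<partial>M) + (\<integral>x. h x $ i * \<phi> x \<partial>M)"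
      unfolding vector_add_component distrib_right using L2 \<phi>L2
      by (intro Bochner_Integration.integral_add integrable_L2_mult in_L2_vec_nth)
    ultimately show ?thesis using assms \<phi> by (simp add: has_weak_gradient_def)
  qed
  then show ?thesis using L2 by (auto simp: has_weak_gradient_def in_L2_add)
qed

lemma weak_gradient_scale:
  assumes "has_weak_gradient \<Omega> u g"
  shows "has_weak_gradient \<Omega> (\<lambda>x. c * u x) (\<lambda>x. c *\<^sub>R g x)"
proof -
  have "in_L2 \<Omega> (\<lambda>x. c * u x)" "in_L2 \<Omega> (\<lambda>x. c *\<^sub>R g x)"
    using assms in_L2_scaleR[of \<Omega> u c] in_L2_scaleR[of \<Omega> g c] by (auto simp: has_weak_gradient_def)
  then show ?thesis using assms by (simp add: has_weak_gradient_def mult.assoc)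
qed

lemma wgrad_weak_gradient: "v \<in> H1 \<Omega> \<Longrightarrow> has_weak_gradient \<Omega> v (wgrad \<Omega> v)"
  using someI_ex[of "has_weak_gradient \<Omega> v"] by (simp add: wgrad_def H1_def)

lemma wgrad_AE_eq: "has_weak_gradient \<Omega> v g \<Longrightarrow> AE x in M. wgrad \<Omega> v x = g x"
  by (rule weak_gradient_unique[OF wgrad_weak_gradient]) (auto simp: H1_def)

lemma H1_add: "u \<in> H1 \<Omega> \<Longrightarrow> v \<in> H1 \<Omega> \<Longrightarrow> (\<lambda>x. u x + v x) \<in> H1 \<Omega>"
  unfolding H1_def using weak_gradient_add by blast

lemma H1_scale: "u \<in> H1 \<Omega> \<Longrightarrow> (\<lambda>x. c * u x) \<in> H1 \<Omega>"
  unfolding H1_def using weak_gradient_scale by blast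

lemma H1_diff: "u \<in> H1 \<Omega> \<Longrightarrow> v \<in> H1 \<Omega> \<Longrightarrow> (\<lambda>x. u x - v x) \<in> H1 \<Omega>"
  using H1_add[of u "\<lambda>x. - 1 * v x"] H1_scale[of v "- 1"] by simp

lemma test_function_H1: "\<phi> \<in> test_functions \<Omega> \<Longrightarrow> \<phi> \<in> H1 \<Omega>"
  unfolding H1_def using test_function_weak_gradient by blast

text \<open>Gradient and value in one vector: the three terms of \<open>bilin\<close>, the energy
  norm and the norms of \<open>H1\<close> all become integrals of a pointwise bilinear form of jets,
  so integrability and linearity are proved only once.\<close>

definition jet :: "'d fn \<Rightarrow> real^'d \<Rightarrow> (real^'d) \<times> real" where
  "jet v x = (wgrad \<Omega> v x, v x)"

lemma jet_add: "u \<in> H1 \<Omega> \<Longrightarrow> v \<in> H1 \<Omega> \<Longrightarrow> AE x in M. jet (\<lambda>x. u x + v x) x = jet u x + jet v x"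
  using wgrad_AE_eq[OF weak_gradient_add[OF wgrad_weak_gradient wgrad_weak_gradient]]
  by (simp add: jet_def)

lemma jet_scale: "u \<in> H1 \<Omega> \<Longrightarrow> AE x in M. jet (\<lambda>x. c * u x) x = c *\<^sub>R jet u x"
  using wgrad_AE_eq[OF weak_gradient_scale[OF wgrad_weak_gradient]] by (simp add: jet_def)

lemma in_L2_jet:
  assumes "v \<in> H1 \<Omega>"
  shows "in_L2 \<Omega> (jet v)"
proof -
  have "in_L2 \<Omega> v" "in_L2 \<Omega> (wgrad \<Omega> v)"
    using wgrad_weak_gradient[OF assms] by (auto simp: has_weak_gradient_def)
  then have m [measurable]: "v \<in> borel_measurable M" "wgrad \<Omega> v \<in> borel_measurable M"
    and "integrable M (\<lambda>x. (norm (wgrad \<Omega> v x))\<^sup>2 + (norm (v x))\<^sup>2)"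
    by (auto simp: in_L2_def)
  then show ?thesis
    unfolding in_L2_def jet_def by (auto simp: norm_Pair intro!: borel_measurable_Pair)
qed

text \<open>Measurability is demanded after inserting measurable arguments, which is how the form is
  used and avoids a measurable structure on the space of bilinear maps.\<close>

definition bounded_form :: "(real^'d \<Rightarrow> (real^'d) \<times> real \<Rightarrow> (real^'d) \<times> real \<Rightarrow> real) \<Rightarrow> bool" where
  "bounded_form \<beta> \<longleftrightarrow> (\<forall>x. bilinear (\<beta> x)) \<and>
     (\<forall>f g. f \<in> borel_measurable M \<longrightarrow> g \<in> borel_measurable M \<longrightarrow>
        (\<lambda>x. \<beta> x (f x) (g x)) \<in> borel_measurable M) \<and>
     (\<exists>C. AE x in M. \<forall>p q. \<bar>\<beta> x p q\<bar> \<le> C * norm p * norm q)"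

lemma bounded_formI:
  assumes "\<And>x. bilinear (\<beta> x)"
    "\<And>f g. f \<in> borel_measurable M \<Longrightarrow> g \<in> borel_measurable M \<Longrightarrow> (\<lambda>x. \<beta> x (f x) (g x)) \<in> borel_measurable M"
    "AE x in M. \<forall>p q. \<bar>\<beta> x p q\<bar> \<le> C * norm p * norm q"
  shows "bounded_form \<beta>"
  unfolding bounded_form_def by (intro conjI allI impI exI[of _ C] assms)

definition jform where
  "jform \<beta> u v = (\<integral>x. \<beta> x (jet u x) (jet v x) \<partial>M)"

context
  fixes \<beta> assumes \<beta>: "bounded_form \<beta>"
begin

lemma bilinear_form: "bilinear (\<beta> x)"
  using \<beta> by (simp add: bounded_form_def)

lemma jform_integrable:
  assumes "u \<in> H1 \<Omega>" "v \<in> H1 \<Omega>"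
  shows "integrable M (\<lambda>x. \<beta> x (jet u x) (jet v x))"
proof -
  obtain C where C: "AE x in M. \<forall>p q. \<bar>\<beta> x p q\<bar> \<le> C * norm p * norm q"
    using \<beta> by (auto simp: bounded_form_def)
  show ?thesis
  proof (rule integrable_bounded_mult_L2[OF in_L2_jet[OF assms(1)] in_L2_jet[OF assms(2)]])
    show "(\<lambda>x. \<beta> x (jet u x) (jet v x)) \<in> borel_measurable M"
      using \<beta> in_L2_jet[OF assms(1)] in_L2_jet[OF assms(2)] by (simp add: bounded_form_def in_L2_def)
    show "AE x in M. \<bar>\<beta> x (jet u x) (jet v x)\<bar> \<le> C * norm (jet u x) * norm (jet v x)"
      using C by eventually_elim blast
  qed
qed

lemma jform_add_left:
  assumes "u \<in> H1 \<Omega>" "u' \<in> H1 \<Omega>" "v \<in> H1 \<Omega>"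
  shows "jform \<beta> (\<lambda>x. u x + u' x) v = jform \<beta> u v + jform \<beta> u' v"
proof -
  have "jform \<beta> (\<lambda>x. u x + u' x) v = (\<integral>x. \<beta> x (jet u x) (jet v x) + \<beta> x (jet u' x) (jet v x) \<partial>M)"
    unfolding jform_def
  proof (rule integral_cong_AE)
    show "AE x in M. \<beta> x (jet (\<lambda>x. u x + u' x) x) (jet v x) = \<beta> x (jet u x) (jet v x) + \<beta> x (jet u' x) (jet v x)"
      using jet_add[OF assms(1,2)] by eventually_elim (simp add: bilinear_ladd[OF bilinear_form])
  qed (use jform_integrable assms H1_add in \<open>auto intro!: borel_measurable_integrable\<close>)
  then show ?thesis using jform_integrable assms by (simp add: jform_def)
qed

lemma jform_scale_left:
  assumes "u \<in> H1 \<Omega>" "v \<in> H1 \<Omega>"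
  shows "jform \<beta> (\<lambda>x. c * u x) v = c * jform \<beta> u v"
proof -
  have "jform \<beta> (\<lambda>x. c * u x) v = (\<integral>x. c * \<beta> x (jet u x) (jet v x) \<partial>M)"
    unfolding jform_def
  proof (rule integral_cong_AE)
    show "AE x in M. \<beta> x (jet (\<lambda>x. c * u x) x) (jet v x) = c * \<beta> x (jet u x) (jet v x)"
      using jet_scale[OF assms(1), of c] by eventually_elim (simp add: bilinear_lmul[OF bilinear_form])
  qed (use jform_integrable assms H1_scale in \<open>auto intro!: borel_measurable_integrable\<close>)
  then show ?thesis using assms by (simp add: jform_def)
qed

end

text \<open>Swapping the slots transfers every statement about the left argument of
  \<open>jform\<close> to the right one.\<close>

lemma bounded_form_transpose:
  assumes "bounded_form \<beta>"
  shows "bounded_form (\<lambda>x p q. \<beta> x q p)"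
proof -
  obtain C where C: "AE x in M. \<forall>p q. \<bar>\<beta> x p q\<bar> \<le> C * norm p * norm q"
    using assms by (auto simp: bounded_form_def)
  show ?thesis
  proof (rule bounded_formI)
    show "bilinear (\<lambda>p q. \<beta> x q p)" for x using bilinear_form[OF assms, of x] by (auto simp: bilinear_def)
    show "AE x in M. \<forall>p q. \<bar>\<beta> x q p\<bar> \<le> C * norm p * norm q"
      using C
    proof eventually_elim
      case (elim x)
      have "\<bar>\<beta> x q p\<bar> \<le> C * norm p * norm q" for p q
        using elim[rule_format, of q p] by (simp only: mult_ac)
      then show ?case by (intro allI)
    qed
  qed (use assms in \<open>simp add: bounded_form_def\<close>)
qed

context
  fixes \<beta> assumes \<beta>: "bounded_form \<beta>"
begin

lemma jform_add_right:
  assumes "u \<in> H1 \<Omega>" "u' \<in> H1 \<Omega>" "v \<in> H1 \<Omega>"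
  shows "jform \<beta> v (\<lambda>x. u x + u' x) = jform \<beta> v u + jform \<beta> v u'"
  using jform_add_left[OF bounded_form_transpose[OF \<beta>] assms] by (simp add: jform_def)

lemma jform_scale_right:
  assumes "u \<in> H1 \<Omega>" "v \<in> H1 \<Omega>"
  shows "jform \<beta> v (\<lambda>x. c * u x) = c * jform \<beta> v u"
  using jform_scale_left[OF bounded_form_transpose[OF \<beta>] assms] by (simp add: jform_def)

lemma jform_scale_quadratic: "v \<in> H1 \<Omega> \<Longrightarrow> jform \<beta> (\<lambda>x. c * v x) (\<lambda>x. c * v x) = c\<^sup>2 * jform \<beta> v v"
  using jform_scale_left[OF \<beta>, of v "\<lambda>x. c * v x" c] jform_scale_right[of v v c] H1_scale[of v c]
  by (simp add: power2_eq_square)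

text \<open>Both cross terms change sign together with \<open>v\<close> and cancel in the sum, even
  for a nonsymmetric form.\<close>

lemma jform_parallelogram:
  assumes "u \<in> H1 \<Omega>" "v \<in> H1 \<Omega>"
  shows "jform \<beta> (\<lambda>x. u x + v x) (\<lambda>x. u x + v x) + jform \<beta> (\<lambda>x. u x - v x) (\<lambda>x. u x - v x) =
    2 * jform \<beta> u u + 2 * jform \<beta> v v"
proof -
  let ?v = "\<lambda>x. - 1 * v x"
  have v: "?v \<in> H1 \<Omega>" using H1_scale assms by blast
  have *: "jform \<beta> (\<lambda>x. u x + w x) (\<lambda>x. u x + w x) = jform \<beta> u u + jform \<beta> u w + jform \<beta> w u + jform \<beta> w w"
    if "w \<in> H1 \<Omega>" for w
    using that assms H1_add[OF assms(1) that] jform_add_left[OF \<beta> assms(1) that] jform_add_right[OF assms(1) that]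
    by simp
  have "(\<lambda>x. u x - v x) = (\<lambda>x. u x + ?v x)" by simp
  then show ?thesis
    using *[OF assms(2)] *[OF v] jform_scale_left[OF \<beta> assms(2,1), of "-1"]
      jform_scale_right[OF assms(2,1), of "-1"] jform_scale_quadratic[OF assms(2), of "-1"]
    by simp
qed

end

lemma inner_bounded_form: "bounded_form (\<lambda>_. (\<bullet>))"
proof (rule bounded_formI)
  show "bilinear (inner :: (real^'d) \<times> real \<Rightarrow> _)"
    using bilinear_conv_bounded_bilinear bounded_bilinear_inner by blast
  show "AE x in M. \<forall>p q. \<bar>p \<bullet> q :: real\<bar> \<le> 1 * norm (p :: (real^'d) \<times> real) * norm q"
    by (simp add: Cauchy_Schwarz_ineq2)
qed (auto intro: borel_measurable_inner)

lemma jform_inner_eq: "jform (\<lambda>_. (\<bullet>)) v v = (\<integral>x. (norm (jet v x))\<^sup>2 \<partial>M)"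
  by (simp add: jform_def power2_norm_eq_inner)

lemma H1_norm_sq:
  assumes "v \<in> H1 \<Omega>"
  shows "(H1_norm \<Omega> v)\<^sup>2 = jform (\<lambda>_. (\<bullet>)) v v"
proof -
  have "in_L2 \<Omega> v" "in_L2 \<Omega> (wgrad \<Omega> v)"
    using wgrad_weak_gradient[OF assms] by (auto simp: has_weak_gradient_def)
  then have "jform (\<lambda>_. (\<bullet>)) v v = (\<integral>x. (v x)\<^sup>2 \<partial>M) + (\<integral>x. (norm (wgrad \<Omega> v x))\<^sup>2 \<partial>M)"
    by (simp add: jform_inner_eq jet_def norm_Pair in_L2_def add.commute)
  then show ?thesis by (simp add: H1_norm_def)
qed

lemma H1_norm_nonneg: "0 \<le> H1_norm \<Omega> v"
  by (simp add: H1_norm_def)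

lemma H1_norm_scale: "v \<in> H1 \<Omega> \<Longrightarrow> H1_norm \<Omega> (\<lambda>x. c * v x) = \<bar>c\<bar> * H1_norm \<Omega> v"
  by (rule power2_eq_imp_eq)
    (simp_all add: H1_norm_sq H1_scale jform_scale_quadratic[OF inner_bounded_form] power_mult_distrib H1_norm_nonneg)

lemma H1_norm_sq_add_le:
  assumes "u \<in> H1 \<Omega>" "v \<in> H1 \<Omega>"
  shows "(H1_norm \<Omega> (\<lambda>x. u x + v x))\<^sup>2 \<le> 2 * (H1_norm \<Omega> u)\<^sup>2 + 2 * (H1_norm \<Omega> v)\<^sup>2"
  using jform_parallelogram[OF inner_bounded_form assms] assms H1_add H1_diff
    zero_le_power2[of "H1_norm \<Omega> (\<lambda>x. u x - v x)"]
  by (simp add: H1_norm_sq)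

section \<open>Linearity of \<open>H10\<close>\<close>

lemma H10_subset_H1: "v \<in> H10 \<Omega> \<Longrightarrow> v \<in> H1 \<Omega>"
  by (simp add: H10_def)

lemma H10_add:
  assumes u: "u \<in> H10 \<Omega>" and v: "v \<in> H10 \<Omega>"
  shows "(\<lambda>x. u x + v x) \<in> H10 \<Omega>"
proof -
  obtain \<phi> \<psi> where \<phi>: "\<And>n. \<phi> n \<in> test_functions \<Omega>" "(\<lambda>n. H1_norm \<Omega> (\<lambda>x. \<phi> n x - u x)) \<longlonglongrightarrow> 0"
    and \<psi>: "\<And>n. \<psi> n \<in> test_functions \<Omega>" "(\<lambda>n. H1_norm \<Omega> (\<lambda>x. \<psi> n x - v x)) \<longlonglongrightarrow> 0"
    using assms unfolding H10_def by blast
  let ?f = "\<lambda>n. H1_norm \<Omega> (\<lambda>x. (\<phi> n x + \<psi> n x) - (u x + v x))"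
  have lim: "(\<lambda>n. 2 * (H1_norm \<Omega> (\<lambda>x. \<phi> n x - u x))\<^sup>2 + 2 * (H1_norm \<Omega> (\<lambda>x. \<psi> n x - v x))\<^sup>2) \<longlonglongrightarrow> 2 * 0\<^sup>2 + 2 * 0\<^sup>2"
    by (intro tendsto_intros \<phi> \<psi>)
  \<comment> \<open>Squares are used because the parallelogram law stands in for the triangle
    inequality.\<close>
  have "(\<lambda>n. (?f n)\<^sup>2) \<longlonglongrightarrow> 0"
  proof (rule tendsto_sandwich[OF _ _ tendsto_const])
    show "(\<lambda>n. 2 * (H1_norm \<Omega> (\<lambda>x. \<phi> n x - u x))\<^sup>2 + 2 * (H1_norm \<Omega> (\<lambda>x. \<psi> n x - v x))\<^sup>2) \<longlonglongrightarrow> 0"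
      using lim by simp
    have "(?f n)\<^sup>2 \<le> 2 * (H1_norm \<Omega> (\<lambda>x. \<phi> n x - u x))\<^sup>2 + 2 * (H1_norm \<Omega> (\<lambda>x. \<psi> n x - v x))\<^sup>2" for n
      using H1_norm_sq_add_le[of "\<lambda>x. \<phi> n x - u x" "\<lambda>x. \<psi> n x - v x"]
        H1_diff[OF test_function_H1[OF \<phi>(1)[of n]] H10_subset_H1[OF u]]
        H1_diff[OF test_function_H1[OF \<psi>(1)[of n]] H10_subset_H1[OF v]]
      by (simp add: algebra_simps)
    then show "\<forall>\<^sub>F n in sequentially. (?f n)\<^sup>2 \<le> 2 * (H1_norm \<Omega> (\<lambda>x. \<phi> n x - u x))\<^sup>2 + 2 * (H1_norm \<Omega> (\<lambda>x. \<psi> n x - v x))\<^sup>2"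
      by simp
  qed simp
  then have "?f \<longlonglongrightarrow> 0"
    using tendsto_real_sqrt[of "\<lambda>n. (?f n)\<^sup>2" 0 sequentially] by (simp add: H1_norm_nonneg)
  moreover have "(\<lambda>x. \<phi> n x + \<psi> n x) \<in> test_functions \<Omega>" for n using \<phi> \<psi> by (intro test_function_add)
  ultimately show ?thesis
    unfolding H10_def using H1_add[OF H10_subset_H1[OF u] H10_subset_H1[OF v]]
    by (auto intro!: exI[of _ "\<lambda>n x. \<phi> n x + \<psi> n x"])
qed

lemma H10_scale:
  assumes u: "u \<in> H10 \<Omega>"
  shows "(\<lambda>x. c * u x) \<in> H10 \<Omega>"
proof -
  obtain \<phi> where \<phi>: "\<And>n. \<phi> n \<in> test_functions \<Omega>" "(\<lambda>n. H1_norm \<Omega> (\<lambda>x. \<phi> n x - u x)) \<longlonglongrightarrow> 0"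
    using assms unfolding H10_def by blast
  have "H1_norm \<Omega> (\<lambda>x. c * \<phi> n x - c * u x) = \<bar>c\<bar> * H1_norm \<Omega> (\<lambda>x. \<phi> n x - u x)" for n
    using H1_norm_scale[of "\<lambda>x. \<phi> n x - u x" c]
      H1_diff[OF test_function_H1[OF \<phi>(1)[of n]] H10_subset_H1[OF u]]
    by (simp add: algebra_simps)
  moreover have "(\<lambda>n. \<bar>c\<bar> * H1_norm \<Omega> (\<lambda>x. \<phi> n x - u x)) \<longlonglongrightarrow> 0"
    using tendsto_mult[OF tendsto_const \<phi>(2), of "\<bar>c\<bar>"] by simp
  ultimately show ?thesis
    unfolding H10_def using H1_scale[OF H10_subset_H1[OF u]] test_function_scale[OF \<phi>(1)]
    by (auto intro!: exI[of _ "\<lambda>n x. c * \<phi> n x"])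
qed

section \<open>Coefficients as bounded pointwise forms\<close>

lemma borel_measurable_fst_snd:
  fixes f :: "'a \<Rightarrow> 'b::second_countable_topology \<times> 'c::second_countable_topology"
  assumes "f \<in> borel_measurable N"
  shows "(\<lambda>x. fst (f x)) \<in> borel_measurable N" "(\<lambda>x. snd (f x)) \<in> borel_measurable N"
  by (rule measurable_compose[OF assms borel_measurable_continuous_onI];
      auto intro!: continuous_intros)+

text \<open>Everything is reduced to matrix entries: measurability then follows from finite sums and
  products, and the bound, crude by the number of entries, needs no operator norm.\<close>

lemma matrix_bounded_form:
  assumes "in_Linf \<Omega> (A :: real^'d \<Rightarrow> real^'d^'d)"
  shows "bounded_form (\<lambda>x p q. (A x *v fst p) \<bullet> fst q)"
proof -
  obtain C where C: "AE x in M. norm (A x) \<le> C" using assms by (auto simp: in_Linf_def)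
  have A: "A \<in> borel_measurable M" using assms by (simp add: in_Linf_def)
  let ?d = "real CARD('d)"
  have expand: "(A x *v g) \<bullet> h = (\<Sum>i\<in>UNIV. \<Sum>j\<in>UNIV. A x $ i $ j * g $ j * h $ i)" for x g h
    by (simp add: matrix_vector_mult_def inner_vec_def sum_distrib_right)
  show ?thesis
  proof (rule bounded_formI)
    show "bilinear (\<lambda>p q :: (real^'d) \<times> real. (A x *v fst p) \<bullet> fst q)" for x
      by (auto simp: bilinear_def inner_add_left inner_add_right matrix_vector_right_distrib
          matrix_vector_mult_scaleR intro!: linearI)
    show "(\<lambda>x. (A x *v fst (f x)) \<bullet> fst (g x)) \<in> borel_measurable M"
      if "f \<in> borel_measurable M" "g \<in> borel_measurable M" for f g :: "real^'d \<Rightarrow> (real^'d) \<times> real"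
      unfolding expand
      by (intro borel_measurable_sum borel_measurable_times borel_measurable_vec_nth
          borel_measurable_fst_snd that A)
    show "AE x in M. \<forall>(p :: (real^'d) \<times> real) (q :: (real^'d) \<times> real).
        \<bar>(A x *v fst p) \<bullet> fst q\<bar> \<le> ?d * ?d * C * norm p * norm q"
      using C
    proof (eventually_elim, intro allI)
      fix x and p q :: "(real^'d) \<times> real" assume x: "norm (A x) \<le> C"
      have term_le: "\<bar>A x $ i $ j * fst p $ j * fst q $ i\<bar> \<le> C * norm p * norm q" for i j
      proof -
        have "\<bar>A x $ i $ j\<bar> \<le> C"
          using component_le_norm_cart[of "A x $ i" j]
            Finite_Cartesian_Product.norm_nth_le[of "A x" i] x by linarith
        moreover have "\<bar>fst p $ j\<bar> \<le> norm p" "\<bar>fst q $ i\<bar> \<le> norm q"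
          using component_le_norm_cart[of "fst p" j] component_le_norm_cart[of "fst q" i]
            norm_fst_le[of "fst p" "snd p"] norm_fst_le[of "fst q" "snd q"] by auto
        ultimately show ?thesis by (auto simp: abs_mult intro!: mult_mono)
      qed
      have "\<bar>(A x *v fst p) \<bullet> fst q\<bar> \<le> (\<Sum>i\<in>UNIV. \<bar>\<Sum>j\<in>UNIV. A x $ i $ j * fst p $ j * fst q $ i\<bar>)"
        unfolding expand by (rule sum_abs)
      also have "\<dots> \<le> (\<Sum>i\<in>UNIV. \<Sum>j\<in>UNIV. \<bar>A x $ i $ j * fst p $ j * fst q $ i\<bar>)"
        by (intro sum_mono sum_abs)
      also have "\<dots> \<le> (\<Sum>i\<in>(UNIV :: 'd set). \<Sum>j\<in>(UNIV :: 'd set). C * norm p * norm q)"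
        by (intro sum_mono term_le)
      finally show "\<bar>(A x *v fst p) \<bullet> fst q\<bar> \<le> ?d * ?d * C * norm p * norm q"
        by (simp add: mult.assoc)
    qed
  qed
qed

lemma vector_bounded_form:
  assumes "in_Linf \<Omega> (b :: real^'d \<Rightarrow> real^'d)"
  shows "bounded_form (\<lambda>x p q. (b x \<bullet> fst p) * snd q)"
proof -
  obtain C where C: "AE x in M. norm (b x) \<le> C" using assms by (auto simp: in_Linf_def)
  have b: "b \<in> borel_measurable M" using assms by (simp add: in_Linf_def)
  show ?thesis
  proof (rule bounded_formI)
    show "bilinear (\<lambda>p q :: (real^'d) \<times> real. (b x \<bullet> fst p) * snd q)" for x
      by (auto simp: bilinear_def inner_add_right algebra_simps intro!: linearI)
    show "AE x in M. \<forall>(p :: (real^'d) \<times> real) (q :: (real^'d) \<times> real).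
        \<bar>(b x \<bullet> fst p) * snd q\<bar> \<le> C * norm p * norm q"
      using C
    proof (eventually_elim, intro allI)
      fix x and p q :: "(real^'d) \<times> real" assume x: "norm (b x) \<le> C"
      have "\<bar>b x \<bullet> fst p\<bar> \<le> norm (b x) * norm (fst p)" by (rule Cauchy_Schwarz_ineq2)
      also have "\<dots> \<le> C * norm p"
        using x norm_fst_le[of "fst p" "snd p"] order_trans[OF norm_ge_zero x]
        by (intro mult_mono) auto
      finally show "\<bar>(b x \<bullet> fst p) * snd q\<bar> \<le> C * norm p * norm q"
        using norm_snd_le[of "snd q" "fst q"] by (auto simp: abs_mult intro!: mult_mono)
    qed
  qed (intro borel_measurable_inner borel_measurable_times borel_measurable_fst_snd b)
qed

lemma scalar_bounded_form:
  assumes "in_Linf \<Omega> (c :: real^'d \<Rightarrow> real)"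
  shows "bounded_form (\<lambda>x p q. c x * snd p * snd q)"
proof -
  obtain C where C: "AE x in M. norm (c x) \<le> C" using assms by (auto simp: in_Linf_def)
  have c: "c \<in> borel_measurable M" using assms by (simp add: in_Linf_def)
  show ?thesis
  proof (rule bounded_formI)
    show "bilinear (\<lambda>p q :: (real^'d) \<times> real. c x * snd p * snd q)" for x
      by (auto simp: bilinear_def algebra_simps intro!: linearI)
    show "AE x in M. \<forall>(p :: (real^'d) \<times> real) (q :: (real^'d) \<times> real).
        \<bar>c x * snd p * snd q\<bar> \<le> C * norm p * norm q"
      using C
    proof (eventually_elim, intro allI)
      fix x and p q :: "(real^'d) \<times> real" assume "norm (c x) \<le> C"
      then show "\<bar>c x * snd p * snd q\<bar> \<le> C * norm p * norm q"
        using norm_snd_le[of "snd q" "fst q"] norm_snd_le[of "snd p" "fst p"]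
        by (auto simp: abs_mult intro!: mult_mono)
    qed
  qed (intro borel_measurable_times borel_measurable_fst_snd c)
qed

lemma in_Linf_const: "in_Linf \<Omega> (\<lambda>_. c)"
  by (auto simp: in_Linf_def)

lemma value_bounded_form: "bounded_form (\<lambda>_ p q. snd p * snd q)"
  using scalar_bounded_form[OF in_Linf_const, of 1] by simp

lemma gradient_bounded_form: "bounded_form (\<lambda>_ p q. fst p \<bullet> fst q)"
  using matrix_bounded_form[OF in_Linf_const, of "mat 1"] by simp

text \<open>The inequality passes from test functions to their limits in \<open>H1_norm\<close>; it
  makes the gradient alone, and hence the energy norm, control \<open>H1_norm\<close> on
  \<open>H10\<close>.\<close>

lemma Poincare_H10: "\<exists>C>0. \<forall>v\<in>H10 \<Omega>. (H1_norm \<Omega> v)\<^sup>2 \<le> C * (\<integral>x. (norm (wgrad \<Omega> v x))\<^sup>2 \<partial>M)"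
proof -
  obtain R where R: "\<And>x. x \<in> \<Omega> \<Longrightarrow> norm x \<le> R" using bounded_\<Omega> unfolding bounded_iff by blast
  define c where "c = 4 * R\<^sup>2"
  let ?L = "\<lambda>v. jform (\<lambda>_ p q. snd p * snd q) v v" and ?D = "\<lambda>v. jform (\<lambda>_ p q. fst p \<bullet> fst q) v v"
  have L_def: "?L v = (\<integral>x. (v x)\<^sup>2 \<partial>M)" and D_def: "?D v = (\<integral>x. (norm (wgrad \<Omega> v x))\<^sup>2 \<partial>M)" for v
    by (simp add: jform_def jet_def power2_eq_square, simp add: jform_def jet_def power2_norm_eq_inner)
  have nn: "0 \<le> ?L v" "0 \<le> ?D v" for v unfolding L_def D_def by simp_all
  have N: "(H1_norm \<Omega> v)\<^sup>2 = ?L v + ?D v" for v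
    unfolding L_def D_def by (simp add: H1_norm_def)
  have test: "?L \<phi> \<le> c * ?D \<phi>" if \<phi>: "\<phi> \<in> test_functions \<Omega>" for \<phi>
  proof -
    fix i :: 'd
    have "\<bar>x $ i\<bar> \<le> R" if "x \<in> \<Omega>" for x
      using R[OF that] component_le_norm_cart[of x i] by linarith
    then have "?L \<phi> \<le> c * (\<integral>x. (partial i \<phi> x)\<^sup>2 \<partial>M)"
      using Poincare_test_function[OF \<phi>, of i R] unfolding L_def c_def by blast
    also have "(\<integral>x. (partial i \<phi> x)\<^sup>2 \<partial>M) \<le> (\<integral>x. (norm (wgrad \<Omega> \<phi> x))\<^sup>2 \<partial>M)"
    proof (rule integral_mono_AE)
      show "integrable M (\<lambda>x. (partial i \<phi> x)\<^sup>2)"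
        using integrable_L2[OF in_L2_continuous, of "\<lambda>x. (partial i \<phi> x)\<^sup>2"]
        by (simp add: continuous_on_power test_function_partial_continuous[OF \<phi>])
      show "integrable M (\<lambda>x. (norm (wgrad \<Omega> \<phi> x))\<^sup>2)"
        using wgrad_weak_gradient[OF test_function_H1[OF \<phi>]] by (auto simp: has_weak_gradient_def in_L2_def)
      show "AE x in M. (partial i \<phi> x)\<^sup>2 \<le> (norm (wgrad \<Omega> \<phi> x))\<^sup>2"
        using wgrad_AE_eq[OF test_function_weak_gradient[OF \<phi>]]
      proof eventually_elim
        case (elim x)
        then have "wgrad \<Omega> \<phi> x $ i = partial i \<phi> x" by simp
        then show ?case using power_mono[OF component_le_norm_cart[of "wgrad \<Omega> \<phi> x" i] abs_ge_zero, of 2] by simp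
      qed
    qed
    finally show ?thesis unfolding D_def by (simp add: c_def mult_left_mono)
  qed
  have le: "?L v \<le> 4 * c * ?D v" if v: "v \<in> H10 \<Omega>" for v
  proof -
    obtain \<phi> where \<phi>: "\<And>n. \<phi> n \<in> test_functions \<Omega>" "(\<lambda>n. H1_norm \<Omega> (\<lambda>x. \<phi> n x - v x)) \<longlonglongrightarrow> 0"
      using v unfolding H10_def by blast
    have bound: "?L v \<le> (2 + 4 * c) * (H1_norm \<Omega> (\<lambda>x. \<phi> n x - v x))\<^sup>2 + 4 * c * ?D v" for n
    proof -
      let ?d = "\<lambda>x. \<phi> n x - v x"
      have h: "\<phi> n \<in> H1 \<Omega>" "v \<in> H1 \<Omega>" "?d \<in> H1 \<Omega>"
        using test_function_H1[OF \<phi>(1)] H10_subset_H1[OF v] H1_diff by auto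
      \<comment> \<open>The parallelogram law is used twice, with \<open>v = \<phi> n - ?d\<close>
        for the values and \<open>\<phi> n = v + ?d\<close> for the gradients. This produces the
        factor 4 in front of \<open>c\<close>, while all terms in \<open>?d\<close> vanish in the
        limit.\<close>
      have "?L v \<le> 2 * ?L (\<phi> n) + 2 * ?L ?d"
        using jform_parallelogram[OF value_bounded_form h(1,3)] nn(1)[of "\<lambda>x. \<phi> n x + ?d x"] by simp
      also have "?L (\<phi> n) \<le> c * ?D (\<phi> n)" using test \<phi> by blast
      also have "?D (\<phi> n) \<le> 2 * ?D v + 2 * ?D ?d"
        using jform_parallelogram[OF gradient_bounded_form h(2,3)] nn(2)[of "\<lambda>x. v x - ?d x"] by simp
      also have "2 * (c * (2 * ?D v + 2 * ?D ?d)) + 2 * ?L ?d \<le> (2 + 4 * c) * (?L ?d + ?D ?d) + 4 * c * ?D v"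
        using nn[of ?d] mult_nonneg_nonneg[of c "?L ?d"] by (simp add: algebra_simps c_def)
      finally show ?thesis by (simp add: N c_def mult_left_mono)
    qed
    have "(\<lambda>n. (2 + 4 * c) * (H1_norm \<Omega> (\<lambda>x. \<phi> n x - v x))\<^sup>2 + 4 * c * ?D v) \<longlonglongrightarrow> (2 + 4 * c) * 0\<^sup>2 + 4 * c * ?D v"
      by (intro tendsto_intros \<phi>)
    then show ?thesis using LIMSEQ_le_const[of _ _ "?L v"] bound by force
  qed
  show ?thesis
  proof (intro exI conjI ballI)
    show "0 < 4 * c + 1" by (simp add: c_def add_nonneg_pos)
    fix v assume "v \<in> H10 \<Omega>"
    then show "(H1_norm \<Omega> v)\<^sup>2 \<le> (4 * c + 1) * (\<integral>x. (norm (wgrad \<Omega> v x))\<^sup>2 \<partial>M)"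
      using le[of v] unfolding N D_def[symmetric] by (simp add: algebra_simps)
  qed
qed

end

section \<open>The model problem as an abstract elliptic problem\<close>

text \<open>Makes \<open>subspace\<close> and the abstract projection locales applicable to sets of
  real functions.\<close>

instantiation "fun" :: (type, real_vector) real_vector
begin

definition scaleR_fun_def: "c *\<^sub>R f = (\<lambda>x. c *\<^sub>R f x)"

instance
  by standard (simp_all add: scaleR_fun_def fun_eq_iff scaleR_add_right scaleR_add_left)

end

lemma scaleR_real_fun: "c *\<^sub>R (f :: 'a \<Rightarrow> real) = (\<lambda>x. c * f x)"
  by (simp add: scaleR_fun_def)

text \<open>Linearity is relative to \<open>H\<close>: outside it the integrals in
  \<open>bilin\<close> may fail to converge, and their default value 0 is not additive.\<close>

definition bilinear_on :: "'v::real_vector set \<Rightarrow> ('v \<Rightarrow> 'v \<Rightarrow> real) \<Rightarrow> bool" where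
  "bilinear_on H f \<longleftrightarrow>
     (\<forall>u\<in>H. \<forall>u'\<in>H. \<forall>v\<in>H. f (u + u') v = f u v + f u' v \<and> f v (u + u') = f v u + f v u') \<and>
     (\<forall>c. \<forall>u\<in>H. \<forall>v\<in>H. f (c *\<^sub>R u) v = c * f u v \<and> f v (c *\<^sub>R u) = c * f v u)"

lemma bilinear_onD:
  assumes "bilinear_on H f"
  shows "u \<in> H \<Longrightarrow> u' \<in> H \<Longrightarrow> v \<in> H \<Longrightarrow> f (u + u') v = f u v + f u' v"
    "u \<in> H \<Longrightarrow> u' \<in> H \<Longrightarrow> v \<in> H \<Longrightarrow> f v (u + u') = f v u + f v u'"
    "u \<in> H \<Longrightarrow> v \<in> H \<Longrightarrow> f (c *\<^sub>R u) v = c * f u v"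
    "u \<in> H \<Longrightarrow> v \<in> H \<Longrightarrow> f v (c *\<^sub>R u) = c * f v u"
  using assms by (auto simp: bilinear_on_def)

lemma bilinear_on_diff:
  assumes "bilinear_on H f" "subspace H" "u \<in> H" "u' \<in> H" "v \<in> H"
  shows "f (u - u') v = f u v - f u' v" "f v (u - u') = f v u - f v u'"
  using bilinear_onD(1,2)[OF assms(1,3) _ assms(5), of "(- 1) *\<^sub>R u'"]
    bilinear_onD(3,4)[OF assms(1,4,5), of "- 1"] subspace_scale[OF assms(2,4), of "- 1"]
  by simp_all

text \<open>The interface between analysis and numerics: every bound is expressed in the single norm
  \<open>N\<close> of the estimator properties, and its constants are fixed before any mesh is
  mentioned.\<close>

locale elliptic_forms =
  fixes H :: "'v::real_vector set" and N :: "'v \<Rightarrow> real" and a k :: "'v \<Rightarrow> 'v \<Rightarrow> real"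
    and Ca \<alpha> Cb :: real
  assumes subspace_H: "subspace H"
    and N_nonneg: "v \<in> H \<Longrightarrow> 0 \<le> N v"
    and N_scale: "v \<in> H \<Longrightarrow> (N (c *\<^sub>R v))\<^sup>2 = c\<^sup>2 * (N v)\<^sup>2"
    and N_parallelogram: "u \<in> H \<Longrightarrow> v \<in> H \<Longrightarrow> (N (u + v))\<^sup>2 + (N (u - v))\<^sup>2 = 2 * (N u)\<^sup>2 + 2 * (N v)\<^sup>2"
    and bilinear_a: "bilinear_on H a" and bilinear_k: "bilinear_on H k"
    and a_bound: "u \<in> H \<Longrightarrow> v \<in> H \<Longrightarrow> \<bar>a u v\<bar> \<le> Ca * N u * N v"
    and k_bound: "u \<in> H \<Longrightarrow> v \<in> H \<Longrightarrow> \<bar>k u v\<bar> \<le> Cb * N u * N v"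
    and a_elliptic: "v \<in> H \<Longrightarrow> \<alpha> * (N v)\<^sup>2 \<le> a v v"
    and constants: "0 < \<alpha>" "0 \<le> Ca" "0 \<le> Cb"

context bounded_open
begin

lemma subspace_H10: "subspace (H10 \<Omega>)"
proof (rule subspaceI)
  have zero: "(\<lambda>_. 0) \<in> test_functions \<Omega>" by (simp add: test_functions_def Ck_const)
  have "H1_norm \<Omega> (\<lambda>x. 0) = 0"
    using H1_norm_scale[OF test_function_H1[OF zero], of 0] by simp
  then have "(\<lambda>_. 0) \<in> H10 \<Omega>"
    unfolding H10_def using zero test_function_H1[OF zero] by (auto intro!: exI[of _ "\<lambda>_ _. 0"])
  then show "0 \<in> H10 \<Omega>" by (simp add: zero_fun_def)
qed (use H10_add H10_scale in \<open>auto simp: plus_fun_def scaleR_real_fun\<close>)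

lemma bilinear_on_jform: "bounded_form \<beta> \<Longrightarrow> bilinear_on (H10 \<Omega>) (jform \<beta>)"
  by (auto simp: bilinear_on_def plus_fun_def scaleR_real_fun H10_subset_H1
      jform_add_left jform_add_right jform_scale_left jform_scale_right)

lemma bilin_eq_jform:
  "bilin \<Omega> A b c u v = jform (\<lambda>x p q. (A x *v fst p) \<bullet> fst q) u v
     + jform (\<lambda>x p q. (b x \<bullet> fst p) * snd q) u v + jform (\<lambda>x p q. c x * snd p * snd q) u v"
  by (simp add: bilin_def jform_def jet_def)

lemma bilinear_on_bilin:
  assumes "admissible_coefficients \<Omega> A b c"
  shows "bilinear_on (H10 \<Omega>) (bilin \<Omega> A b c)"
proof -
  have "in_Linf \<Omega> A" "in_Linf \<Omega> b" "in_Linf \<Omega> c"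
    using assms by (auto simp: admissible_coefficients_def)
  note forms = matrix_bounded_form[OF this(1)] vector_bounded_form[OF this(2)] scalar_bounded_form[OF this(3)]
  note bil = forms[THEN bilinear_on_jform]
  show ?thesis
    unfolding bilinear_on_def bilin_eq_jform
    by (auto simp: bilinear_onD[OF bil(1)] bilinear_onD[OF bil(2)] bilinear_onD[OF bil(3)] distrib_left)
qed

text \<open>Bounded sequences of arguments on which \<open>K\<close> is unbounded would contradict sequential
  compactness.\<close>

lemma compact_operator_bounded:
  assumes K: "compact_operator \<Omega> K"
  shows "\<exists>C\<ge>0. \<forall>v\<in>H10 \<Omega>. \<forall>w\<in>H10 \<Omega>. \<bar>K v w\<bar> \<le> C * H1_norm \<Omega> v * H1_norm \<Omega> w"
proof (rule ccontr)
  assume contra: "\<not> ?thesis"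
  let ?h = "H1_norm \<Omega>"
  have K_dual: "K v \<in> H_minus1 \<Omega>" if "v \<in> H10 \<Omega>" for v
    using K that by (auto simp: compact_operator_def)
  have K_scale: "K (\<lambda>x. r * v x) w = r * K v w" if "v \<in> H10 \<Omega>" "w \<in> H10 \<Omega>" for r v w
    using K that by (auto simp: compact_operator_def)
  have K_scale': "K v (\<lambda>x. r * w x) = r * K v w" if "v \<in> H10 \<Omega>" "w \<in> H10 \<Omega>" for r v w
    using K_dual[OF that(1)] that(2) by (auto simp: H_minus1_def)
  have h_scale: "?h (\<lambda>x. r * v x) = \<bar>r\<bar> * ?h v" if "v \<in> H10 \<Omega>" for r v
    using H1_norm_scale H10_subset_H1 that by blast
  have "\<exists>v\<in>H10 \<Omega>. \<exists>w\<in>H10 \<Omega>. ?h v \<le> 1 \<and> ?h w \<le> 1 \<and> real n < \<bar>K v w\<bar>" for n :: nat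
  proof -
    obtain v w where vw: "v \<in> H10 \<Omega>" "w \<in> H10 \<Omega>" "real n * ?h v * ?h w < \<bar>K v w\<bar>"
      using contra by (meson not_le of_nat_0_le_iff)
    \<comment> \<open>Each \<open>K v\<close> is a bounded functional, so it vanishes on arguments
      of norm zero; this excludes \<open>?h w = 0\<close>.\<close>
    have hw: "0 < ?h w"
    proof (rule ccontr)
      assume "\<not> 0 < ?h w"
      then have "?h w = 0" using H1_norm_nonneg[of w] by linarith
      moreover obtain C where "\<bar>K v w\<bar> \<le> C * ?h w"
        using K_dual[OF vw(1)] vw(2) by (auto simp: H_minus1_def)
      ultimately show False using vw(3) by simp
    qed
    have "K v w \<noteq> 0" using vw(3) H1_norm_nonneg[of v] H1_norm_nonneg[of w]
      by (smt (verit) mult_nonneg_nonneg of_nat_0_le_iff)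
    \<comment> \<open>If \<open>?h v = 0\<close>, scaling \<open>v\<close> leaves its norm at 0 and
      \<open>r\<close> simply makes \<open>K\<close> large enough; otherwise \<open>r\<close>
      normalizes \<open>v\<close>.\<close>
    define r where "r = (if ?h v = 0 then (real n + 1) * ?h w / \<bar>K v w\<bar> else 1 / ?h v)"
    have r: "0 \<le> r" "r * ?h v \<le> 1" "real n * ?h w < r * \<bar>K v w\<bar>"
    proof -
      show "0 \<le> r" using H1_norm_nonneg hw by (auto simp: r_def)
      show "r * ?h v \<le> 1" by (auto simp: r_def)
      show "real n * ?h w < r * \<bar>K v w\<bar>"
      proof (cases "?h v = 0")
        case True
        then show ?thesis using hw \<open>K v w \<noteq> 0\<close> by (simp add: r_def)
      next
        case False
        then have "0 < ?h v" using H1_norm_nonneg[of v] by linarith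
        then show ?thesis using vw(3) False by (simp add: r_def field_simps)
      qed
    qed
    let ?v = "\<lambda>x. r * v x" and ?w = "\<lambda>x. (1 / ?h w) * w x"
    have in_H: "?v \<in> H10 \<Omega>" "?w \<in> H10 \<Omega>" using H10_scale vw by blast+
    have "\<bar>K ?v ?w\<bar> = r * \<bar>K v w\<bar> / ?h w"
      using K_scale'[OF in_H(1) vw(2), of "1 / ?h w"] K_scale[OF vw(1,2), of r] r(1) hw
      by (simp add: abs_mult)
    moreover have "real n * ?h w / ?h w < r * \<bar>K v w\<bar> / ?h w"
      using r(3) hw by (rule divide_strict_right_mono)
    ultimately have "real n < \<bar>K ?v ?w\<bar>" using hw by simp
    moreover have "?h ?v \<le> 1" "?h ?w \<le> 1"
      using h_scale[OF vw(1), of r] h_scale[OF vw(2), of "1 / ?h w"] r hw by auto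
    ultimately show ?thesis using in_H by blast
  qed
  then have "\<forall>n. \<exists>v w. v \<in> H10 \<Omega> \<and> w \<in> H10 \<Omega> \<and> ?h v \<le> 1 \<and> ?h w \<le> 1 \<and> real n < \<bar>K v w\<bar>"
    by blast
  from choice[OF this] obtain V where
    "\<forall>n. \<exists>w. V n \<in> H10 \<Omega> \<and> w \<in> H10 \<Omega> \<and> ?h (V n) \<le> 1 \<and> ?h w \<le> 1 \<and> real n < \<bar>K (V n) w\<bar>"
    by blast
  from choice[OF this] obtain W where
    "\<forall>n. V n \<in> H10 \<Omega> \<and> W n \<in> H10 \<Omega> \<and> ?h (V n) \<le> 1 \<and> ?h (W n) \<le> 1 \<and> real n < \<bar>K (V n) (W n)\<bar>"
    by blast
  then have V: "\<And>n. V n \<in> H10 \<Omega>" "\<And>n. W n \<in> H10 \<Omega>" "\<And>n. ?h (V n) \<le> 1" "\<And>n. ?h (W n) \<le> 1"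
    "\<And>n. real n < \<bar>K (V n) (W n)\<bar>"
    by auto
  have "\<exists>\<Phi>\<in>H_minus1 \<Omega>. \<exists>r::nat \<Rightarrow> nat. strict_mono r \<and>
      (\<lambda>n. dual_norm \<Omega> (\<lambda>w. K (V (r n)) w - \<Phi> w)) \<longlonglongrightarrow> 0"
    using K V(1,3) unfolding compact_operator_def by blast
  then obtain \<Phi> r where \<Phi>: "\<Phi> \<in> H_minus1 \<Omega>" and r: "strict_mono (r :: nat \<Rightarrow> nat)"
    and lim: "(\<lambda>n. dual_norm \<Omega> (\<lambda>w. K (V (r n)) w - \<Phi> w)) \<longlonglongrightarrow> 0"
    by blast
  obtain C where C: "\<And>v. v \<in> H10 \<Omega> \<Longrightarrow> \<bar>\<Phi> v\<bar> \<le> C * ?h v"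
    using \<Phi> unfolding H_minus1_def by blast
  obtain B where B: "\<And>n. \<bar>dual_norm \<Omega> (\<lambda>w. K (V (r n)) w - \<Phi> w)\<bar> \<le> B"
    using convergent_imp_Bseq[OF convergentI[OF lim]] by (auto simp: Bseq_def)
  have bound: "\<bar>K (V (r n)) (W (r n))\<bar> \<le> B + \<bar>C\<bar>" for n
  proof -
    let ?F = "\<lambda>w. K (V (r n)) w - \<Phi> w" and ?U = "{v \<in> H10 \<Omega>. ?h v \<le> 1}"
    obtain C' where C': "\<And>w. w \<in> H10 \<Omega> \<Longrightarrow> \<bar>K (V (r n)) w\<bar> \<le> C' * ?h w"
      using K_dual[OF V(1)[of "r n"]] unfolding H_minus1_def by blast
    have unit: "c * ?h w \<le> \<bar>c\<bar>" if "?h w \<le> 1" for c w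
      using that H1_norm_nonneg[of w] by (smt (verit) abs_ge_self mult_left_le mult_right_mono)
    \<comment> \<open>\<open>dual_norm\<close> is a supremum of reals and dominates the individual
      values only once the set is known to be bounded above.\<close>
    have "bdd_above ((\<lambda>w. \<bar>?F w\<bar>) ` ?U)"
    proof (rule bdd_aboveI2)
      fix w assume w: "w \<in> ?U"
      then have "\<bar>K (V (r n)) w\<bar> \<le> C' * ?h w" "\<bar>\<Phi> w\<bar> \<le> C * ?h w" using C C' by auto
      then show "\<bar>?F w\<bar> \<le> \<bar>C'\<bar> + \<bar>C\<bar>" using unit[of w C] unit[of w C'] w by auto
    qed
    then have "\<bar>?F (W (r n))\<bar> \<le> dual_norm \<Omega> ?F"
      unfolding dual_norm_def by (intro cSUP_upper) (use V in auto)
    then have "\<bar>?F (W (r n))\<bar> \<le> B" using B[of n] by simp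
    moreover have "\<bar>\<Phi> (W (r n))\<bar> \<le> \<bar>C\<bar>" using C[OF V(2)[of "r n"]] unit[OF V(4)[of "r n"], of C] by linarith
    ultimately show ?thesis by linarith
  qed
  obtain n :: nat where "B + \<bar>C\<bar> < real n" using reals_Archimedean2 by blast
  moreover have "real n \<le> real (r n)" using seq_suble[OF r] by simp
  ultimately show False using V(5)[of "r n"] bound[of n] by linarith
qed

lemma bilinear_on_compact_operator:
  assumes "compact_operator \<Omega> K"
  shows "bilinear_on (H10 \<Omega>) K"
  using assms unfolding bilinear_on_def plus_fun_def scaleR_real_fun compact_operator_def H_minus1_def
  by blast

text \<open>The two norms are compared in both directions. \<open>?h v \<le> D * ?N v\<close>, from
  Poincare and positivity of \<open>A\<close>, transfers the upper bounds of the form and of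
  \<open>K\<close>; \<open>(?N v)\<^sup>2 \<le> E * (?h v)\<^sup>2\<close>, from boundedness of
  \<open>A\<close>, transfers ellipticity.\<close>

lemma elliptic_forms_model_problem:
  assumes adm: "admissible_coefficients \<Omega> A b c" and K: "compact_operator \<Omega> K"
  shows "\<exists>Ca \<alpha> Cb. elliptic_forms (H10 \<Omega>) (energy_norm \<Omega> A) (bilin \<Omega> A b c) K Ca \<alpha> Cb"
proof -
  let ?\<beta> = "\<lambda>x p q. (A x *v fst p) \<bullet> fst q" and ?N = "energy_norm \<Omega> A" and ?h = "H1_norm \<Omega>"
  have A: "bounded_form ?\<beta>"
    using adm by (intro matrix_bounded_form) (simp add: admissible_coefficients_def)
  obtain \<alpha>0 where \<alpha>0: "0 < \<alpha>0" "AE x in M. \<forall>\<xi>. \<alpha>0 * (norm \<xi>)\<^sup>2 \<le> (A x *v \<xi>) \<bullet> \<xi>"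
    using adm by (auto simp: admissible_coefficients_def)
  have lower: "\<alpha>0 * (\<integral>x. (norm (wgrad \<Omega> v x))\<^sup>2 \<partial>M) \<le> jform ?\<beta> v v" if v: "v \<in> H1 \<Omega>" for v
  proof -
    have "(\<integral>x. \<alpha>0 * (norm (wgrad \<Omega> v x))\<^sup>2 \<partial>M) \<le> jform ?\<beta> v v"
      unfolding jform_def
    proof (rule integral_mono_AE)
      show "integrable M (\<lambda>x. \<alpha>0 * (norm (wgrad \<Omega> v x))\<^sup>2)"
        using wgrad_weak_gradient[OF v] by (auto simp: has_weak_gradient_def in_L2_def)
      show "AE x in M. \<alpha>0 * (norm (wgrad \<Omega> v x))\<^sup>2 \<le> (A x *v fst (jet v x)) \<bullet> fst (jet v x)"
        using \<alpha>0(2) by eventually_elim (simp add: jet_def)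
    qed (use jform_integrable[OF A v v] in simp)
    then show ?thesis by simp
  qed
  have nonneg: "0 \<le> jform ?\<beta> v v" if "v \<in> H1 \<Omega>" for v
  proof -
    have "0 \<le> \<alpha>0 * (\<integral>x. (norm (wgrad \<Omega> v x))\<^sup>2 \<partial>M)" using \<alpha>0 by simp
    then show ?thesis using lower[OF that] by linarith
  qed
  have N_eq: "?N v = sqrt (jform ?\<beta> v v)" for v
    by (simp add: energy_norm_def jform_def jet_def)
  have N_sq: "(?N v)\<^sup>2 = jform ?\<beta> v v" if "v \<in> H1 \<Omega>" for v
    using nonneg[OF that] by (simp add: N_eq)
  have N_nonneg: "0 \<le> ?N v" if "v \<in> H10 \<Omega>" for v using nonneg[OF H10_subset_H1[OF that]] by (simp add: N_eq)
  obtain P where P: "0 < P" "\<And>v. v \<in> H10 \<Omega> \<Longrightarrow> (?h v)\<^sup>2 \<le> P * (\<integral>x. (norm (wgrad \<Omega> v x))\<^sup>2 \<partial>M)"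
    using Poincare_H10 by blast
  define D where "D = sqrt (P / \<alpha>0)"
  have D: "0 \<le> D" using P \<alpha>0 by (simp add: D_def)
  have h_le: "?h v \<le> D * ?N v" if "v \<in> H10 \<Omega>" for v
  proof (rule power2_le_imp_le)
    have "(?h v)\<^sup>2 \<le> P * (\<integral>x. (norm (wgrad \<Omega> v x))\<^sup>2 \<partial>M)" using P that by blast
    also have "\<dots> = (P / \<alpha>0) * (\<alpha>0 * (\<integral>x. (norm (wgrad \<Omega> v x))\<^sup>2 \<partial>M))" using \<alpha>0 by simp
    also have "\<dots> \<le> (P / \<alpha>0) * (?N v)\<^sup>2"
      using lower[OF H10_subset_H1[OF that]] N_sq[OF H10_subset_H1[OF that]] P \<alpha>0 by (intro mult_left_mono) auto
    also have "\<dots> = (D * ?N v)\<^sup>2" using P \<alpha>0 by (simp add: D_def power_mult_distrib)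
    finally show "(?h v)\<^sup>2 \<le> (D * ?N v)\<^sup>2" .
    show "0 \<le> D * ?N v" using D N_nonneg[OF that] by simp
  qed
  obtain E where E: "0 < E" "\<And>v. v \<in> H1 \<Omega> \<Longrightarrow> (?N v)\<^sup>2 \<le> E * (?h v)\<^sup>2"
  proof -
    obtain C where C: "AE x in M. \<forall>(p :: (real^'d) \<times> real) (q :: (real^'d) \<times> real). \<bar>?\<beta> x p q\<bar> \<le> C * norm p * norm q"
      using A unfolding bounded_form_def by blast
    have "(?N v)\<^sup>2 \<le> (\<bar>C\<bar> + 1) * (?h v)\<^sup>2" if v: "v \<in> H1 \<Omega>" for v
    proof -
      have "jform ?\<beta> v v \<le> (\<integral>x. (\<bar>C\<bar> + 1) * (norm (jet v x))\<^sup>2 \<partial>M)"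
        unfolding jform_def
      proof (rule integral_mono_AE)
        show "integrable M (\<lambda>x. (\<bar>C\<bar> + 1) * (norm (jet v x))\<^sup>2)"
          using in_L2_jet[OF v] by (simp add: in_L2_def)
        show "AE x in M. ?\<beta> x (jet v x) (jet v x) \<le> (\<bar>C\<bar> + 1) * (norm (jet v x))\<^sup>2"
          using C
        proof eventually_elim
          case (elim x)
          have "?\<beta> x (jet v x) (jet v x) \<le> C * norm (jet v x) * norm (jet v x)"
            using elim abs_ge_self order_trans by blast
          also have "\<dots> = C * (norm (jet v x))\<^sup>2" by (simp add: power2_eq_square)
          also have "\<dots> \<le> (\<bar>C\<bar> + 1) * (norm (jet v x))\<^sup>2" by (intro mult_right_mono) auto
          finally show ?case .
        qed
      qed (use jform_integrable[OF A v v] in simp)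
      then show ?thesis using N_sq[OF v] H1_norm_sq[OF v] by (simp add: jform_inner_eq)
    qed
    then show ?thesis using that[of "\<bar>C\<bar> + 1"] by simp
  qed
  obtain Ca where Ca: "\<And>u v. u \<in> H10 \<Omega> \<Longrightarrow> v \<in> H10 \<Omega> \<Longrightarrow> \<bar>bilin \<Omega> A b c u v\<bar> \<le> Ca * ?h u * ?h v"
    using adm by (auto simp: admissible_coefficients_def)
  obtain \<gamma> where \<gamma>: "0 < \<gamma>" "\<And>v. v \<in> H10 \<Omega> \<Longrightarrow> \<gamma> * (?h v)\<^sup>2 \<le> bilin \<Omega> A b c v v"
    using adm by (auto simp: admissible_coefficients_def)
  obtain Ck where Ck: "0 \<le> Ck" "\<And>u v. u \<in> H10 \<Omega> \<Longrightarrow> v \<in> H10 \<Omega> \<Longrightarrow> \<bar>K u v\<bar> \<le> Ck * ?h u * ?h v"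
    using compact_operator_bounded[OF K] by blast
  have transfer: "\<bar>f\<bar> \<le> \<bar>C\<bar> * D\<^sup>2 * ?N u * ?N v"
    if "\<bar>f\<bar> \<le> C * ?h u * ?h v" "u \<in> H10 \<Omega>" "v \<in> H10 \<Omega>" for f C u v
  proof -
    have "C * ?h u * ?h v \<le> \<bar>C\<bar> * (?h u * ?h v)"
      by (simp add: mult.assoc mult_right_mono H1_norm_nonneg)
    also have "\<dots> \<le> \<bar>C\<bar> * ((D * ?N u) * (D * ?N v))"
      using that h_le H1_norm_nonneg N_nonneg D by (intro mult_left_mono mult_mono) auto
    finally show ?thesis using that(1) by (simp add: power2_eq_square mult_ac)
  qed
  have "elliptic_forms (H10 \<Omega>) ?N (bilin \<Omega> A b c) K (\<bar>Ca\<bar> * D\<^sup>2) (\<gamma> / E) (\<bar>Ck\<bar> * D\<^sup>2)"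
  proof (unfold_locales, rule subspace_H10)
    fix u v assume uv: "u \<in> H10 \<Omega>" "v \<in> H10 \<Omega>"
    note H1 = uv[THEN H10_subset_H1]
    show "(?N (u + v))\<^sup>2 + (?N (u - v))\<^sup>2 = 2 * (?N u)\<^sup>2 + 2 * (?N v)\<^sup>2"
      using jform_parallelogram[OF A H1] N_sq[OF H1_add[OF H1]] N_sq[OF H1_diff[OF H1]] N_sq[OF H1(1)] N_sq[OF H1(2)]
      by (simp add: plus_fun_def fun_diff_def)
    show "\<bar>bilin \<Omega> A b c u v\<bar> \<le> \<bar>Ca\<bar> * D\<^sup>2 * ?N u * ?N v" using transfer[OF Ca[OF uv] uv] .
    show "\<bar>K u v\<bar> \<le> \<bar>Ck\<bar> * D\<^sup>2 * ?N u * ?N v" using transfer[OF Ck(2)[OF uv] uv] .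
  next
    fix v assume v: "v \<in> H10 \<Omega>"
    show "0 \<le> ?N v" using N_nonneg v .
    show "(?N (r *\<^sub>R v))\<^sup>2 = r\<^sup>2 * (?N v)\<^sup>2" for r
      using jform_scale_quadratic[OF A H10_subset_H1[OF v]] N_sq[OF H1_scale[OF H10_subset_H1[OF v]]] N_sq[OF H10_subset_H1[OF v]]
      by (simp add: scaleR_real_fun)
    have "(\<gamma> / E) * (?N v)\<^sup>2 \<le> (\<gamma> / E) * (E * (?h v)\<^sup>2)"
      using E \<gamma> H10_subset_H1[OF v] by (intro mult_left_mono) auto
    also have "\<dots> \<le> bilin \<Omega> A b c v v" using \<gamma>(2)[OF v] E by simp
    finally show "(\<gamma> / E) * (?N v)\<^sup>2 \<le> bilin \<Omega> A b c v v" .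
  qed (use bilinear_on_bilin[OF adm] bilinear_on_compact_operator[OF K] \<gamma> E in auto)
  then show ?thesis by blast
qed

end

section \<open>Finite element spaces\<close>

lemma polys_le_add:
  assumes "q \<in> polys_le p" "q' \<in> polys_le p"
  shows "(\<lambda>x. q x + q' x) \<in> polys_le p"
proof -
  obtain k k' where "\<And>x. q x = (\<Sum>\<alpha> | (\<Sum>i\<in>UNIV. \<alpha> i) \<le> p. k \<alpha> * (\<Prod>i\<in>UNIV. (x $ i) ^ (\<alpha> i)))"
    "\<And>x. q' x = (\<Sum>\<alpha> | (\<Sum>i\<in>UNIV. \<alpha> i) \<le> p. k' \<alpha> * (\<Prod>i\<in>UNIV. (x $ i) ^ (\<alpha> i)))"
    using assms unfolding polys_le_def by blast
  then show ?thesis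
    unfolding polys_le_def by (auto intro!: exI[of _ "\<lambda>\<alpha>. k \<alpha> + k' \<alpha>"] simp: distrib_right sum.distrib)
qed

lemma polys_le_scale:
  assumes "q \<in> polys_le p"
  shows "(\<lambda>x. c * q x) \<in> polys_le p"
proof -
  obtain k where "\<And>x. q x = (\<Sum>\<alpha> | (\<Sum>i\<in>UNIV. \<alpha> i) \<le> p. k \<alpha> * (\<Prod>i\<in>UNIV. (x $ i) ^ (\<alpha> i)))"
    using assms unfolding polys_le_def by blast
  then show ?thesis
    unfolding polys_le_def by (auto intro!: exI[of _ "\<lambda>\<alpha>. c * k \<alpha>"] simp: sum_distrib_left mult.assoc)
qed

lemma fe_space_polyE:
  assumes "v \<in> fe_space \<Omega> p \<T>" "T \<in> \<T>"
  obtains q where "q \<in> polys_le p" "AE x in lebesgue_on T. v x = q x"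
proof -
  have "\<exists>q\<in>polys_le p. AE x in lebesgue_on T. v x = q x"
    using assms by (simp add: fe_space_def)
  then show ?thesis by (elim bexE) (rule that)
qed

lemma (in bounded_open) subspace_fe_space: "subspace (fe_space \<Omega> p \<T>)"
proof (rule subspaceI)
  have "(\<lambda>_. 0) \<in> polys_le p"
    unfolding polys_le_def by (auto intro!: exI[of _ "\<lambda>_. 0"])
  then show "0 \<in> fe_space \<Omega> p \<T>"
    using subspace_0[OF subspace_H10] unfolding fe_space_def zero_fun_def by auto
next
  fix u v assume uv: "u \<in> fe_space \<Omega> p \<T>" "v \<in> fe_space \<Omega> p \<T>"
  have "\<exists>q\<in>polys_le p. AE x in lebesgue_on T. (u + v) x = q x" if T: "T \<in> \<T>" for T
  proof -
    obtain q where q: "q \<in> polys_le p" "AE x in lebesgue_on T. u x = q x"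
      by (rule fe_space_polyE[OF uv(1) T])
    obtain q' where q': "q' \<in> polys_le p" "AE x in lebesgue_on T. v x = q' x"
      by (rule fe_space_polyE[OF uv(2) T])
    have "AE x in lebesgue_on T. (u + v) x = q x + q' x" using q(2) q'(2) by eventually_elim simp
    then show ?thesis by (rule bexI[OF _ polys_le_add[OF q(1) q'(1)]])
  qed
  then show "u + v \<in> fe_space \<Omega> p \<T>"
    using uv subspace_add[OF subspace_H10] by (simp add: fe_space_def)
next
  fix c u assume u: "u \<in> fe_space \<Omega> p \<T>"
  have "\<exists>q\<in>polys_le p. AE x in lebesgue_on T. (c *\<^sub>R u) x = q x" if T: "T \<in> \<T>" for T
  proof -
    obtain q where q: "q \<in> polys_le p" "AE x in lebesgue_on T. u x = q x"
      by (rule fe_space_polyE[OF u T])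
    have "AE x in lebesgue_on T. (c *\<^sub>R u) x = c * q x"
      using q(2) by eventually_elim (simp add: scaleR_fun_def)
    then show ?thesis by (rule bexI[OF _ polys_le_scale[OF q(1)]])
  qed
  then show "c *\<^sub>R u \<in> fe_space \<Omega> p \<T>"
    using u subspace_scale[OF subspace_H10] by (simp add: fe_space_def)
qed

text \<open>A proper face of a convex set has smaller affine dimension, hence empty interior, and
  convex sets with empty interior are null sets.\<close>

lemma non_negligible_face_eq:
  fixes F T :: "'a::euclidean_space set"
  assumes "F face_of T" "convex T" "\<not> negligible F"
  shows "F = T"
proof (rule ccontr)
  assume "F \<noteq> T"
  then have "aff_dim F < aff_dim T" using assms by (intro face_of_aff_dim_lt)
  moreover have "interior F \<noteq> {}"
    using negligible_convex_interior[OF face_of_imp_convex[OF assms(1)]] assms by blast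
  then have "aff_dim F = int DIM('a)" by (rule aff_dim_nonempty_interior)
  ultimately show False using aff_dim_le_DIM[of T] by linarith
qed

lemma conforming_triangulation_element:
  fixes T :: "(real^'d) set"
  assumes "conforming_triangulation \<Omega> \<T>" "T \<in> \<T>"
  shows "convex T" "compact T" "\<not> negligible T"
proof -
  have T: "int CARD('d) simplex T" using assms by (simp add: conforming_triangulation_def)
  show convex: "convex T" using T by (rule convex_simplex)
  show "compact T" using T by (rule compact_simplex)
  have "aff_dim T = int DIM(real^'d)" using aff_dim_simplex[OF T] by simp
  then have "interior T \<noteq> {}"
    using interior_rel_interior_gen[of T] rel_interior_eq_empty[OF convex] by auto
  then show "\<not> negligible T" using negligible_convex_interior[OF convex] by blast
qed

text \<open>An element of the finer mesh meets some coarse element in a set of positive measure, hence so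
  does one of the fine elements contained in that coarse element. As their intersection is a common
  face of full dimension, the two fine elements coincide.\<close>

lemma fine_element_subset_coarse:
  fixes \<T> \<T>' :: "(real^'d) set set"
  assumes \<T>: "conforming_triangulation \<Omega> \<T>" and \<T>': "conforming_triangulation \<Omega> \<T>'"
    and sub: "\<And>T. T \<in> \<T> \<Longrightarrow> T = \<Union>{T' \<in> \<T>'. T' \<subseteq> T}" and T': "T' \<in> \<T>'"
  shows "\<exists>T\<in>\<T>. T' \<subseteq> T"
proof -
  have fin: "finite \<T>" "finite \<T>'"
    using \<T> \<T>' by (auto simp: conforming_triangulation_def triangulation_def)
  have "T' \<subseteq> \<Union>\<T>" using \<T> \<T>' T' by (auto simp: conforming_triangulation_def)
  then have "T' = \<Union>((\<lambda>T. T' \<inter> T) ` \<T>)" by auto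
  moreover have "\<not> negligible T'" using conforming_triangulation_element[OF \<T>' T'] by simp
  ultimately obtain T where T: "T \<in> \<T>" "\<not> negligible (T' \<inter> T)"
    using negligible_Union[of "(\<lambda>T. T' \<inter> T) ` \<T>"] fin by auto
  have "T' \<inter> T = \<Union>((\<lambda>S. T' \<inter> S) ` {S \<in> \<T>'. S \<subseteq> T})" using sub[OF T(1)] by auto
  with T(2) obtain S where S: "S \<in> \<T>'" "S \<subseteq> T" "\<not> negligible (T' \<inter> S)"
    using negligible_Union[of "(\<lambda>S. T' \<inter> S) ` {S \<in> \<T>'. S \<subseteq> T}"] fin by auto
  have "(T' \<inter> S) face_of T'"
    using \<T>' T' S(1) by (auto simp: conforming_triangulation_def triangulation_def)
  then have "T' \<inter> S = T'"
    using non_negligible_face_eq S(3) conforming_triangulation_element[OF \<T>' T'] by blast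
  then show ?thesis using S(2) T(1) by blast
qed

text \<open>A polynomial on a coarse element restricts to every fine element inside it. Nestedness
  of the discrete spaces is thus derived from the geometry of \<open>refine\<close> rather than
  postulated.\<close>

lemma fe_space_mono_subdivision:
  fixes \<T> \<T>' :: "(real^'d) set set"
  assumes \<T>: "conforming_triangulation \<Omega> \<T>" and \<T>': "conforming_triangulation \<Omega> \<T>'"
    and sub: "\<And>T. T \<in> \<T> \<Longrightarrow> T = \<Union>{T' \<in> \<T>'. T' \<subseteq> T}"
  shows "fe_space \<Omega> p \<T> \<subseteq> fe_space \<Omega> p \<T>'"
proof
  fix v assume v: "v \<in> fe_space \<Omega> p \<T>"
  have "\<exists>q\<in>polys_le p. AE x in lebesgue_on T'. v x = q x" if T': "T' \<in> \<T>'" for T'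
  proof -
    obtain T where T: "T \<in> \<T>" "T' \<subseteq> T" using fine_element_subset_coarse[OF assms T'] by blast
    obtain q where q: "q \<in> polys_le p" "AE x in lebesgue_on T. v x = q x"
      by (rule fe_space_polyE[OF v T(1)])
    have "T \<in> sets lebesgue" "T' \<in> sets lebesgue"
      using conforming_triangulation_element(2)[OF \<T> T(1)] conforming_triangulation_element(2)[OF \<T>' T']
      by (simp_all add: lborelD borel_compact)
    then have "AE x in lebesgue_on T'. v x = q x"
      using q(2) T(2) by (auto simp: AE_restrict_space_iff elim: eventually_mono)
    then show ?thesis by (rule bexI[OF _ q(1)])
  qed
  then show "v \<in> fe_space \<Omega> p \<T>'" using v by (simp add: fe_space_def)
qed

section \<open>Nested discrete spaces along refinements\<close>

lemma refinements_trans: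
  assumes "Th \<in> refinements refine TH" "TH \<in> refinements refine \<T>"
  shows "Th \<in> refinements refine \<T>"
  using assms(1)
proof induction
  case refl
  show ?case by (rule assms(2))
next
  case (step \<T>' \<M>)
  show ?case by (rule refinements.step[OF step(3,2)])
qed

lemma mesh_refinement_conforming:
  assumes "mesh_refinement \<Omega> T0 refine Cmesh" "\<T> \<in> refinements refine T0"
  shows "conforming_triangulation \<Omega> \<T>"
  using assms(2)
proof cases
  case refl
  then show ?thesis using assms(1) by (simp add: mesh_refinement_def)
next
  case (step \<T>' \<M>)
  then show ?thesis using assms(1) by (simp add: mesh_refinement_def)
qed

lemma fe_space_mono_refinements:
  assumes mesh: "mesh_refinement \<Omega> T0 refine Cmesh" and H: "TH \<in> refinements refine T0"
    and h: "Th \<in> refinements refine TH"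
  shows "fe_space \<Omega> p TH \<subseteq> fe_space \<Omega> p Th"
  using h
proof induction
  case (step \<T> \<M>)
  have \<T>: "\<T> \<in> refinements refine T0" using refinements_trans[OF step(1) H] .
  note conf = mesh[unfolded mesh_refinement_def, THEN conjunct2, THEN conjunct1, rule_format, OF \<T> step(2)]
  have "fe_space \<Omega> p \<T> \<subseteq> fe_space \<Omega> p (refine \<T> \<M>)"
    by (rule fe_space_mono_subdivision[OF mesh_refinement_conforming[OF mesh \<T>] conf[THEN conjunct1]
          conf[THEN conjunct2, THEN conjunct1, rule_format]])
  then show ?case using step by blast
qed simp

section \<open>The combined primal-dual Galerkin scheme\<close>

lemma quadratic_le_linear_imp_le:
  fixes x :: real
  assumes "\<alpha> * x\<^sup>2 \<le> B * x" "0 < \<alpha>" "0 \<le> B" "0 \<le> x"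
  shows "x \<le> B / \<alpha>"
proof (cases "x = 0")
  case False
  then have "0 < x" using assms by simp
  then have "\<alpha> * x \<le> B" using assms(1) by (simp add: power2_eq_square mult.assoc[symmetric])
  then show ?thesis using assms by (simp add: field_simps)
qed (use assms in simp)

lemma power2_add_le_Young:
  fixes x y \<delta> :: real
  assumes "0 < \<delta>"
  shows "(x + y)\<^sup>2 \<le> (1 + \<delta>) * x\<^sup>2 + (1 + 1 / \<delta>) * y\<^sup>2"
proof -
  have "0 \<le> (\<delta> * x - y)\<^sup>2 / \<delta>" using assms by simp
  also have "\<dots> = \<delta> * x\<^sup>2 - 2 * x * y + y\<^sup>2 / \<delta>"
    using assms by (simp add: power2_eq_square field_simps)
  finally show ?thesis by (simp add: power2_eq_square algebra_simps)
qed

lemma power2_add_le: "(x + y)\<^sup>2 \<le> 2 * x\<^sup>2 + 2 * (y :: real)\<^sup>2"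
  using power2_add_le_Young[of 1 x y] by simp

context elliptic_forms
begin

definition pair_sq :: "'v \<times> 'v \<Rightarrow> real" where
  "pair_sq s = (N (fst s))\<^sup>2 + (N (snd s))\<^sup>2"

text \<open>The kernel of the combined Galerkin projection. The right-hand side of the dual problem
  moves with the primal solution, so the dual error satisfies Galerkin orthogonality only up to
  \<open>k\<close> applied to the primal error; building these terms in makes the two-stage scheme a
  single linear projection.\<close>

definition annihilator :: "'v set \<Rightarrow> ('v \<times> 'v) set" where
  "annihilator X = {d \<in> H \<times> H. \<forall>v\<in>X. a (fst d) v = 0 \<and> a v (snd d) = k v (fst d) + k (fst d) v}"

text \<open>The terms \<open>(Ca / \<alpha>)\<^sup>2\<close> come from the primal and dual diagonal
  parts and the last one from the coupling; the summand 1 makes the constant at least 1.\<close>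

definition C_gal :: real where
  "C_gal = 1 + 2 * (Ca / \<alpha>)\<^sup>2 + 16 * (Cb / \<alpha>)\<^sup>2 * (1 + (Ca / \<alpha>)\<^sup>2)"

lemmas a_lin = bilinear_onD[OF bilinear_a] and k_lin = bilinear_onD[OF bilinear_k]

lemmas a_diff = bilinear_on_diff[OF bilinear_a subspace_H]
  and k_diff = bilinear_on_diff[OF bilinear_k subspace_H]

lemma quadratic_form_pair: "quadratic_form_on (H \<times> H) pair_sq"
proof
  show "subspace (H \<times> H)" using subspace_H by (simp add: subspace_Times)
  show "pair_sq (x + y) + pair_sq (x - y) = 2 * pair_sq x + 2 * pair_sq y"
    if "x \<in> H \<times> H" "y \<in> H \<times> H" for x y
    using that N_parallelogram[of "fst x" "fst y"] N_parallelogram[of "snd x" "snd y"]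
    by (auto simp: pair_sq_def)
qed (auto simp: pair_sq_def N_scale algebra_simps)

lemma subspace_annihilator:
  assumes "X \<subseteq> H"
  shows "subspace (annihilator X)"
proof (rule subspaceI)
  have zero: "0 \<in> H" using subspace_H by (rule subspace_0)
  have "a 0 v = 0" "a v 0 = 0" "k 0 v = 0" "k v 0 = 0" if "v \<in> H" for v
    using a_lin(3)[OF zero that, of 0] a_lin(4)[OF zero that, of 0]
      k_lin(3)[OF zero that, of 0] k_lin(4)[OF zero that, of 0] by simp_all
  then show "0 \<in> annihilator X" using zero assms by (auto simp: annihilator_def zero_prod_def)
next
  fix x y assume "x \<in> annihilator X" "y \<in> annihilator X"
  then show "x + y \<in> annihilator X"
    using assms subspace_add[OF subspace_H]
    by (auto simp: annihilator_def a_lin k_lin subset_iff mem_Times_iff)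
next
  fix c x assume "x \<in> annihilator X"
  then show "c *\<^sub>R x \<in> annihilator X"
    using assms subspace_scale[OF subspace_H]
    by (auto simp: annihilator_def a_lin k_lin subset_iff mem_Times_iff distrib_left)
qed

text \<open>The system is triangular: testing with \<open>pu\<close> bounds the primal component of
  the projection, hence also the primal remainder \<open>du\<close>; testing with \<open>pz\<close>
  then bounds the dual component, with \<open>du\<close> entering as data.\<close>

lemma galerkin_bound:
  assumes X: "X \<subseteq> H" and p: "p \<in> X \<times> X" and d: "d \<in> annihilator X"
  shows "pair_sq p \<le> C_gal * pair_sq (p + d)"
proof -
  obtain pu pz du dz where pd: "p = (pu, pz)" "d = (du, dz)" by (cases p, cases d) auto
  have in_H: "pu \<in> H" "pz \<in> H" "du \<in> H" "dz \<in> H" and in_X: "pu \<in> X" "pz \<in> X"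
    using X p d by (auto simp: pd annihilator_def)
  define eu ez where "eu = pu + du" and "ez = pz + dz"
  have e_H: "eu \<in> H" "ez \<in> H" using in_H subspace_add[OF subspace_H] by (auto simp: eu_def ez_def)
  let ?c = "Ca / \<alpha>" and ?m = "Cb / \<alpha>"
  have c: "0 \<le> ?c" "0 \<le> ?m" using constants by auto
  have pu: "N pu \<le> ?c * N eu"
  proof -
    have "a pu pu = a eu pu" using d in_X in_H by (simp add: eu_def a_lin annihilator_def pd)
    then have "\<alpha> * (N pu)\<^sup>2 \<le> (Ca * N eu) * N pu"
      using a_elliptic[OF in_H(1)] a_bound[OF e_H(1) in_H(1)] by linarith
    from quadratic_le_linear_imp_le[OF this] show ?thesis using constants N_nonneg in_H e_H by simp
  qed
  have pz: "N pz \<le> ?c * N ez + 2 * ?m * N du"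
  proof -
    \<comment> \<open>\<open>pz\<close> is an admissible test function, so membership of
      \<open>d\<close> in the annihilator evaluates \<open>a pz dz\<close> as the two coupling
      terms.\<close>
    have "a pz pz = a pz ez - (k pz du + k du pz)"
      using d in_X in_H by (simp add: ez_def a_lin annihilator_def pd)
    then have "\<alpha> * (N pz)\<^sup>2 \<le> (Ca * N ez + 2 * Cb * N du) * N pz"
      using a_elliptic[OF in_H(2)] a_bound[OF in_H(2) e_H(2)] k_bound[OF in_H(2,3)] k_bound[OF in_H(3,2)]
      by (simp add: algebra_simps)
    from quadratic_le_linear_imp_le[OF this] have "N pz \<le> (Ca * N ez + 2 * Cb * N du) / \<alpha>"
      using constants N_nonneg in_H e_H by simp
    then show ?thesis using constants by (simp add: add_divide_distrib)
  qed
  have pu2: "(N pu)\<^sup>2 \<le> ?c\<^sup>2 * (N eu)\<^sup>2"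
    using power_mono[OF pu N_nonneg[OF in_H(1)], of 2] unfolding power_mult_distrib .
  have "(N du)\<^sup>2 \<le> 2 * (N eu)\<^sup>2 + 2 * (N pu)\<^sup>2"
  proof -
    have "eu - pu = du" by (simp add: eu_def)
    then have "(N (eu + pu))\<^sup>2 + (N du)\<^sup>2 = 2 * (N eu)\<^sup>2 + 2 * (N pu)\<^sup>2"
      using N_parallelogram[OF e_H(1) in_H(1)] by simp
    then show ?thesis using zero_le_power2[of "N (eu + pu)"] by linarith
  qed
  then have du2: "(N du)\<^sup>2 \<le> 2 * (1 + ?c\<^sup>2) * (N eu)\<^sup>2"
    using pu2 by (simp add: distrib_right)
  have "(N pz)\<^sup>2 \<le> (?c * N ez + 2 * ?m * N du)\<^sup>2"
    using power_mono[OF pz N_nonneg[OF in_H(2)]] by blast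
  also have "\<dots> \<le> 2 * (?c * N ez)\<^sup>2 + 2 * (2 * ?m * N du)\<^sup>2"
    by (rule power2_add_le)
  also have "\<dots> = 2 * ?c\<^sup>2 * (N ez)\<^sup>2 + 8 * ?m\<^sup>2 * (N du)\<^sup>2" by (simp only: power_mult_distrib) simp
  also have "\<dots> \<le> 2 * ?c\<^sup>2 * (N ez)\<^sup>2 + 8 * ?m\<^sup>2 * (2 * (1 + ?c\<^sup>2) * (N eu)\<^sup>2)"
    using du2 by (intro add_left_mono mult_left_mono) auto
  also have "8 * ?m\<^sup>2 * (2 * (1 + ?c\<^sup>2) * (N eu)\<^sup>2) = 16 * ?m\<^sup>2 * (1 + ?c\<^sup>2) * (N eu)\<^sup>2" by simp
  finally have pz2: "(N pz)\<^sup>2 \<le> 2 * ?c\<^sup>2 * (N ez)\<^sup>2 + 16 * ?m\<^sup>2 * (1 + ?c\<^sup>2) * (N eu)\<^sup>2" .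
  define c2 m2 where "c2 = ?c\<^sup>2" and "m2 = ?m\<^sup>2"
  have c2: "0 \<le> c2" "0 \<le> m2" by (simp_all add: c2_def m2_def)
  have "(N pu)\<^sup>2 + (N pz)\<^sup>2 \<le> (c2 + 16 * m2 * (1 + c2)) * (N eu)\<^sup>2 + 2 * c2 * (N ez)\<^sup>2"
    using pu2 pz2 unfolding c2_def[symmetric] m2_def[symmetric] by (simp add: distrib_right)
  also have "\<dots> \<le> (1 + 2 * c2 + 16 * m2 * (1 + c2)) * (N eu)\<^sup>2 + (1 + 2 * c2 + 16 * m2 * (1 + c2)) * (N ez)\<^sup>2"
    using c2 by (intro add_mono mult_right_mono) auto
  finally show ?thesis
    by (simp add: pair_sq_def pd eu_def ez_def C_gal_def c2_def m2_def distrib_left)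
qed

lemma C_gal_pos: "1 \<le> C_gal"
  by (simp add: C_gal_def)

text \<open>Continuous dependence of the discrete dual solution on its datum, for comparing the data
  \<open>u\<close> and \<open>uH \<T>\<close>.\<close>

lemma dual_galerkin_bound:
  assumes "X \<subseteq> H" "d \<in> X" "e \<in> H" "\<And>v. v \<in> X \<Longrightarrow> a v d = k v e + k e v"
  shows "N d \<le> (2 * Cb / \<alpha>) * N e"
proof -
  have d: "d \<in> H" using assms by blast
  have "\<alpha> * (N d)\<^sup>2 \<le> (2 * Cb * N e) * N d"
    using a_elliptic[OF d] k_bound[OF d assms(3)] k_bound[OF assms(3) d] assms(4)[OF assms(2)]
    by (simp add: mult_ac)
  from quadratic_le_linear_imp_le[OF this] show ?thesis using constants N_nonneg d assms by simp
qed

end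

section \<open>Estimator reduction and linear convergence\<close>

lemma est_nonneg: "0 \<le> est \<eta> \<T> \<U> v"
  by (simp add: est_def sum_nonneg)

lemma est_sq: "(est \<eta> \<T> \<U> v)\<^sup>2 = (\<Sum>T\<in>\<U>. (\<eta> \<T> T v)\<^sup>2)"
  by (simp add: est_def sum_nonneg)

lemma est_sq_split:
  assumes "finite \<U>"
  shows "(est \<eta> \<T> \<U> v)\<^sup>2 = (est \<eta> \<T> (\<U> \<inter> \<V>) v)\<^sup>2 + (est \<eta> \<T> (\<U> - \<V>) v)\<^sup>2"
  unfolding est_sq using sum.Int_Diff[OF assms] .

lemma est_sq_mono: "finite \<V> \<Longrightarrow> \<U> \<subseteq> \<V> \<Longrightarrow> (est \<eta> \<T> \<U> v)\<^sup>2 \<le> (est \<eta> \<T> \<V> v)\<^sup>2"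
  unfolding est_sq by (intro sum_mono2) auto

lemma combined_est_sq_split:
  "finite \<U> \<Longrightarrow> combined_est_sq \<eta> \<zeta> uH zH \<T> \<U> =
     combined_est_sq \<eta> \<zeta> uH zH \<T> (\<U> \<inter> \<V>) + combined_est_sq \<eta> \<zeta> uH zH \<T> (\<U> - \<V>)"
  by (simp add: combined_est_sq_def est_sq_split[of \<U> _ _ _ \<V>])

text \<open>Here \<open>x\<close> belongs to the kept elements, \<open>y\<close> to the refined ones
  with reduction factor \<open>r\<close>, and \<open>c\<close> is the stability term. The Young
  parameter keeps the leading factor as close to 1 as desired.\<close>

lemma sum_power2_perturb:
  fixes x y x' y' c r \<delta> :: real
  assumes "0 < \<delta>" "0 \<le> x" "0 \<le> y" "x \<le> x' + c" "y \<le> r * y' + c"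
  shows "x\<^sup>2 + y\<^sup>2 \<le> (1 + \<delta>) * (x'\<^sup>2 + r\<^sup>2 * y'\<^sup>2) + 2 * (1 + 1 / \<delta>) * c\<^sup>2"
proof -
  have "x\<^sup>2 \<le> (x' + c)\<^sup>2" "y\<^sup>2 \<le> (r * y' + c)\<^sup>2" using assms by (auto intro: power_mono)
  then have "x\<^sup>2 + y\<^sup>2 \<le> ((1 + \<delta>) * x'\<^sup>2 + (1 + 1 / \<delta>) * c\<^sup>2) + ((1 + \<delta>) * (r * y')\<^sup>2 + (1 + 1 / \<delta>) * c\<^sup>2)"
    using power2_add_le_Young[OF assms(1), of x' c] power2_add_le_Young[OF assms(1), of "r * y'" c] by linarith
  then show ?thesis by (simp add: power_mult_distrib algebra_simps)
qed

locale afem = bounded_open \<Omega> + elliptic_forms "H10 \<Omega>" "energy_norm \<Omega> A" "bilin \<Omega> A b c" K Ca \<alpha> Cb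
  for \<Omega> :: "(real^'d) set" and A b c K Ca \<alpha> Cb +
  fixes qred Cstab Crel Cdrel Cmesh :: real and f :: "'d fn" and fv :: "real^'d \<Rightarrow> real^'d" and p :: nat
    and T0 :: "'d mesh" and refine and \<eta> \<zeta> :: "'d indicators" and u :: "'d fn" and z and uH and zH
  assumes setting: "afem_setting \<Omega> A b c K qred Cstab Crel Cdrel Cmesh f fv p T0 refine \<eta> \<zeta> u z uH zH"
begin

abbreviation "R \<equiv> refinements refine"
abbreviation "X \<equiv> fe_space \<Omega> p"
abbreviation "enorm \<equiv> energy_norm \<Omega> A"
abbreviation "form \<equiv> bilin \<Omega> A b c"

abbreviation zz :: "'d mesh \<Rightarrow> 'd fn" where
  "zz \<T> \<equiv> zH \<T> (uH \<T>)"

abbreviation \<rho> :: "'d mesh \<Rightarrow> 'd mesh \<Rightarrow> real" where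
  "\<rho> \<equiv> combined_est_sq \<eta> \<zeta> uH zH"

abbreviation err :: "'d mesh \<Rightarrow> real" where
  "err \<T> \<equiv> \<rho> \<T> \<T>"

definition sol :: "'d mesh \<Rightarrow> 'd fn \<times> 'd fn" where
  "sol \<T> = (uH \<T>, zz \<T>)"

section \<open>Galerkin orthogonality of the combined solution\<close>

lemma mesh: "mesh_refinement \<Omega> T0 refine Cmesh"
  using setting by (simp add: afem_setting_def)

lemma params: "0 < qred" "qred < 1" "0 < Cstab" "0 < Crel" "0 < Cdrel" "0 < Cmesh"
  using setting by (simp_all add: afem_setting_def)

lemma finite_mesh: "\<T> \<in> R T0 \<Longrightarrow> finite \<T>"
  using mesh_refinement_conforming[OF mesh] by (auto simp: conforming_triangulation_def triangulation_def)

lemma X_subset_H10: "X \<T> \<subseteq> H10 \<Omega>"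
  by (auto simp: fe_space_def)

lemma X_mono: "TH \<in> R T0 \<Longrightarrow> Th \<in> R TH \<Longrightarrow> X TH \<subseteq> X Th"
  using fe_space_mono_refinements[OF mesh] .

lemma u_in_H10: "u \<in> H10 \<Omega>"
  using setting by (simp add: afem_setting_def primal_solution_def)

lemma z_in_H10: "w \<in> H10 \<Omega> \<Longrightarrow> z w \<in> H10 \<Omega>"
  using setting by (simp add: afem_setting_def dual_solution_def)

lemma primal_eq: "v \<in> H10 \<Omega> \<Longrightarrow> form u v = load \<Omega> f fv v"
  using setting by (simp add: afem_setting_def primal_solution_def)

lemma dual_eq: "w \<in> H10 \<Omega> \<Longrightarrow> v \<in> H10 \<Omega> \<Longrightarrow> form v (z w) = K v w + K w v"
  using setting by (simp add: afem_setting_def dual_solution_def)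

lemma discrete_solutions:
  assumes "\<T> \<in> R T0"
  shows "primal_solution \<Omega> A b c f fv (X \<T>) (uH \<T>)"
    "\<And>w. w \<in> H10 \<Omega> \<Longrightarrow> dual_solution \<Omega> A b c K (X \<T>) w (zH \<T> w)"
  using setting assms by (simp_all add: afem_setting_def)

lemma uH_in_X: "\<T> \<in> R T0 \<Longrightarrow> uH \<T> \<in> X \<T>"
  using discrete_solutions(1) by (simp add: primal_solution_def)

lemma uH_in_H10: "\<T> \<in> R T0 \<Longrightarrow> uH \<T> \<in> H10 \<Omega>"
  using uH_in_X X_subset_H10 by blast

lemma zH_in_X: "\<T> \<in> R T0 \<Longrightarrow> w \<in> H10 \<Omega> \<Longrightarrow> zH \<T> w \<in> X \<T>"
  using discrete_solutions(2) by (simp add: dual_solution_def)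

lemma zH_in_H10: "\<T> \<in> R T0 \<Longrightarrow> w \<in> H10 \<Omega> \<Longrightarrow> zH \<T> w \<in> H10 \<Omega>"
  using zH_in_X X_subset_H10 by blast

lemma discrete_primal_eq: "\<T> \<in> R T0 \<Longrightarrow> v \<in> X \<T> \<Longrightarrow> form (uH \<T>) v = load \<Omega> f fv v"
  using discrete_solutions(1) by (simp add: primal_solution_def)

lemma discrete_dual_eq: "\<T> \<in> R T0 \<Longrightarrow> w \<in> H10 \<Omega> \<Longrightarrow> v \<in> X \<T> \<Longrightarrow> form v (zH \<T> w) = K v w + K w v"
  using discrete_solutions(2) by (simp add: dual_solution_def)

lemma refine_trans: "TH \<in> R T0 \<Longrightarrow> Th \<in> R TH \<Longrightarrow> Th \<in> R T0"
  by (rule refinements_trans)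

lemma sol_in: "\<T> \<in> R T0 \<Longrightarrow> sol \<T> \<in> X \<T> \<times> X \<T>"
  by (simp add: sol_def uH_in_X zH_in_X uH_in_H10)

text \<open>Subtract the discrete equations from those of \<open>(w, z')\<close>. Only test
  functions from \<open>X \<T>\<close> matter, so the pair may be the exact solution or the solution
  on any refinement.\<close>

lemma annihilator_intro:
  assumes \<T>: "\<T> \<in> R T0" and w: "w \<in> H10 \<Omega>" "z' \<in> H10 \<Omega>"
    and eq: "\<And>v. v \<in> X \<T> \<Longrightarrow> form w v = load \<Omega> f fv v" "\<And>v. v \<in> X \<T> \<Longrightarrow> form v z' = K v w + K w v"
  shows "(w, z') - sol \<T> \<in> annihilator (X \<T>)"
proof -
  have H: "uH \<T> \<in> H10 \<Omega>" "zz \<T> \<in> H10 \<Omega>" using \<T> uH_in_H10 zH_in_H10 by auto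
  have "form (w - uH \<T>) v = 0 \<and> form v (z' - zz \<T>) = K v (w - uH \<T>) + K (w - uH \<T>) v"
    if v: "v \<in> X \<T>" for v
  proof -
    have "v \<in> H10 \<Omega>" using v X_subset_H10 by blast
    then show ?thesis
      using w H eq[OF v] discrete_primal_eq[OF \<T> v] discrete_dual_eq[OF \<T> H(1) v]
      by (simp add: a_diff k_diff)
  qed
  then show ?thesis
    using w H subspace_diff[OF subspace_H10] by (simp add: annihilator_def sol_def)
qed

lemma sol_diff_annihilator:
  assumes "TH \<in> R T0" "Th \<in> R TH"
  shows "sol Th - sol TH \<in> annihilator (X TH)"
proof -
  have h: "Th \<in> R T0" using assms by (rule refine_trans)
  show ?thesis
    unfolding sol_def[of Th] using X_mono[OF assms]
    by (intro annihilator_intro[OF assms(1)])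
      (auto intro: uH_in_H10 zH_in_H10 h discrete_primal_eq discrete_dual_eq)
qed

lemma exact_diff_annihilator: "\<T> \<in> R T0 \<Longrightarrow> (u, z u) - sol \<T> \<in> annihilator (X \<T>)"
  using X_subset_H10[of \<T>]
  by (intro annihilator_intro) (auto intro: u_in_H10 z_in_H10 primal_eq dual_eq)

lemma pair_sq_exact_diff:
  assumes \<T>: "\<T> \<in> R T0"
  shows "pair_sq ((u, z u) - sol \<T>) \<le> Crel\<^sup>2 * err \<T>"
proof -
  let ?x = "enorm (u - uH \<T>)" and ?y = "enorm (z u - zz \<T>)" and ?w = "enorm (z (uH \<T>) - zz \<T>)"
  have nn: "0 \<le> ?x" "0 \<le> ?y" "0 \<le> ?w"
    using N_nonneg subspace_diff[OF subspace_H10] u_in_H10 z_in_H10 uH_in_H10[OF \<T>] zH_in_H10[OF \<T>] by auto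
  have "reliability enorm (H10 \<Omega>) R T0 \<eta> \<zeta> u z uH zH Crel"
    using setting by (simp add: afem_setting_def)
  then have "?x + ?y + ?w \<le> Crel * sqrt (err \<T>)"
    using \<T> by (simp add: reliability_def fun_diff_def combined_est_sq_def)
  then have "?x + ?y \<le> Crel * sqrt (err \<T>)" using nn by simp
  then have "(?x + ?y)\<^sup>2 \<le> (Crel * sqrt (err \<T>))\<^sup>2" using nn by (intro power_mono) auto
  moreover have "?x\<^sup>2 + ?y\<^sup>2 \<le> (?x + ?y)\<^sup>2" using nn by (simp add: power2_sum)
  moreover have "0 \<le> err \<T>" by (simp add: combined_est_sq_def)
  ultimately show ?thesis by (simp add: pair_sq_def sol_def power_mult_distrib)
qed

lemma combined_est_sq_nonneg: "0 \<le> \<rho> \<T> \<U>"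
  by (simp add: combined_est_sq_def)

text \<open>The difference is the projection of the coarse error onto the fine space. Using this and
  reliability, rather than discrete reliability, keeps \<open>Cdrel\<close> out of the constants,
  which part (i) of the theorem fixes before \<open>Cdrel\<close>.\<close>

lemma pair_sq_sol_diff:
  assumes "TH \<in> R T0" "Th \<in> R TH"
  shows "pair_sq (sol Th - sol TH) \<le> C_gal * Crel\<^sup>2 * err TH"
proof -
  have h: "Th \<in> R T0" using assms by (rule refine_trans)
  have sub: "subspace (X Th \<times> X Th)" by (intro subspace_Times subspace_fe_space)
  have "sol TH \<in> X Th \<times> X Th" using sol_in[OF assms(1)] X_mono[OF assms] by auto
  then have "sol Th - sol TH \<in> X Th \<times> X Th" using sol_in[OF h] sub by (intro subspace_diff)
  then have "pair_sq (sol Th - sol TH) \<le> C_gal * pair_sq (sol Th - sol TH + ((u, z u) - sol Th))"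
    by (rule galerkin_bound[OF X_subset_H10 _ exact_diff_annihilator[OF h]])
  also have "sol Th - sol TH + ((u, z u) - sol Th) = (u, z u) - sol TH" by simp
  also have "C_gal * pair_sq ((u, z u) - sol TH) \<le> C_gal * (Crel\<^sup>2 * err TH)"
    using pair_sq_exact_diff[OF assms(1)] C_gal_pos by (intro mult_left_mono) auto
  finally show ?thesis by (simp add: mult_ac)
qed

section \<open>Estimator behaviour under refinement\<close>

lemma stability_combined:
  assumes "TH \<in> R T0" "Th \<in> R TH" "vh \<in> X Th" "wh \<in> X Th" "vH \<in> X TH" "wH \<in> X TH"
    "\<U> \<subseteq> Th \<inter> TH"
  shows "\<bar>sqrt ((est \<eta> Th \<U> vh)\<^sup>2 + (est \<zeta> Th \<U> wh)\<^sup>2)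
          - sqrt ((est \<eta> TH \<U> vH)\<^sup>2 + (est \<zeta> TH \<U> wH)\<^sup>2)\<bar>
          \<le> Cstab * (enorm (vh - vH) + enorm (wh - wH))"
proof -
  have "stability enorm X R T0 \<eta> \<zeta> Cstab" using setting by (simp add: afem_setting_def)
  from this[unfolded stability_def, THEN conjunct2, rule_format, OF assms]
  show ?thesis by (simp add: fun_diff_def)
qed

lemma stability_single:
  assumes "TH \<in> R T0" "Th \<in> R TH" "vh \<in> X Th" "vH \<in> X TH" "\<U> \<subseteq> Th \<inter> TH"
    and "\<epsilon> \<in> {\<eta>, \<zeta>}"
  shows "\<bar>est \<epsilon> Th \<U> vh - est \<epsilon> TH \<U> vH\<bar> \<le> Cstab * enorm (vh - vH)"
proof -
  have "stability enorm X R T0 \<eta> \<zeta> Cstab" using setting by (simp add: afem_setting_def)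
  then have "\<bar>est \<eta> Th \<U> vh - est \<eta> TH \<U> vH\<bar> + \<bar>est \<zeta> Th \<U> vh - est \<zeta> TH \<U> vH\<bar> \<le> Cstab * enorm (vh - vH)"
    unfolding stability_def fun_diff_def using assms(1-5) by simp
  then show ?thesis using assms(6) by auto
qed

lemma reduction_single:
  assumes "TH \<in> R T0" "Th \<in> R TH" "v \<in> X TH" "\<epsilon> \<in> {\<eta>, \<zeta>}"
  shows "est \<epsilon> Th (Th - TH) v \<le> qred * est \<epsilon> TH (TH - Th) v"
proof -
  have "reduction X R T0 \<eta> \<zeta> qred" using setting by (simp add: afem_setting_def)
  then show ?thesis using assms by (auto simp: reduction_def)
qed

lemma estimator_perturbation:
  assumes H: "TH \<in> R T0" and h: "Th \<in> R TH" and "0 < \<delta>"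
  shows "err Th \<le> (1 + \<delta>) * (err TH - (1 - qred\<^sup>2) * \<rho> TH (TH - Th))
      + 4 * (1 + 1 / \<delta>) * Cstab\<^sup>2 * pair_sq (sol Th - sol TH)"
proof -
  have h0: "Th \<in> R T0" using H h by (rule refine_trans)
  define d where "d = enorm (uH Th - uH TH) + enorm (zz Th - zz TH)"
  have X_h: "uH Th \<in> X Th" "zz Th \<in> X Th" using sol_in[OF h0] by (auto simp: sol_def)
  have X_H: "uH TH \<in> X TH" "zz TH \<in> X TH" using sol_in[OF H] by (auto simp: sol_def)
  then have X_Hh: "uH TH \<in> X Th" "zz TH \<in> X Th" using X_mono[OF H h] by auto
  let ?g = "\<lambda>\<T> \<U> v w. (est \<eta> \<T> \<U> v)\<^sup>2 + (est \<zeta> \<T> \<U> w)\<^sup>2"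
  have 1: "sqrt (\<rho> Th (Th \<inter> TH)) \<le> sqrt (\<rho> TH (Th \<inter> TH)) + Cstab * d"
    using stability_combined[OF H h X_h X_H, of "Th \<inter> TH"] by (simp add: combined_est_sq_def d_def)
  \<comment> \<open>Stability is used with \<open>Th\<close> as both meshes, where it covers all
    elements of \<open>Th\<close>: first the functions are exchanged on the new elements, then
    reduction applies to the coarse functions.\<close>
  have "sqrt (\<rho> Th (Th - TH)) \<le> sqrt (?g Th (Th - TH) (uH TH) (zz TH)) + Cstab * d"
    using stability_combined[OF h0 refinements.refl X_h X_Hh, of "Th - TH"]
    by (simp add: combined_est_sq_def d_def)
  also have "sqrt (?g Th (Th - TH) (uH TH) (zz TH)) \<le> qred * sqrt (\<rho> TH (TH - Th))"
  proof -
    have "(est \<eta> Th (Th - TH) (uH TH))\<^sup>2 \<le> (qred * est \<eta> TH (TH - Th) (uH TH))\<^sup>2"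
      "(est \<zeta> Th (Th - TH) (zz TH))\<^sup>2 \<le> (qred * est \<zeta> TH (TH - Th) (zz TH))\<^sup>2"
      using reduction_single[OF H h] X_H by (auto intro!: power_mono est_nonneg)
    then have "?g Th (Th - TH) (uH TH) (zz TH) \<le> qred\<^sup>2 * \<rho> TH (TH - Th)"
      by (simp add: combined_est_sq_def power_mult_distrib distrib_left)
    then have "sqrt (?g Th (Th - TH) (uH TH) (zz TH)) \<le> sqrt (qred\<^sup>2 * \<rho> TH (TH - Th))"
      by (rule real_sqrt_le_mono)
    then show ?thesis using params by (simp add: real_sqrt_mult)
  qed
  finally have 2: "sqrt (\<rho> Th (Th - TH)) \<le> qred * sqrt (\<rho> TH (TH - Th)) + Cstab * d" by simp
  have split_h: "err Th = \<rho> Th (Th \<inter> TH) + \<rho> Th (Th - TH)"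
    using combined_est_sq_split[OF finite_mesh[OF h0]] .
  have split_H: "err TH = \<rho> TH (Th \<inter> TH) + \<rho> TH (TH - Th)"
    unfolding Int_commute[of Th] using combined_est_sq_split[OF finite_mesh[OF H]] .
  have "err Th \<le> (1 + \<delta>) * (\<rho> TH (Th \<inter> TH) + qred\<^sup>2 * \<rho> TH (TH - Th))
      + 2 * (1 + 1 / \<delta>) * (Cstab * d)\<^sup>2"
    using sum_power2_perturb[OF assms(3) _ _ 1 2] by (simp add: combined_est_sq_nonneg split_h)
  also have "\<rho> TH (Th \<inter> TH) + qred\<^sup>2 * \<rho> TH (TH - Th) = err TH - (1 - qred\<^sup>2) * \<rho> TH (TH - Th)"
    by (simp add: split_H algebra_simps)
  also have "2 * (1 + 1 / \<delta>) * (Cstab * d)\<^sup>2 \<le> 2 * (1 + 1 / \<delta>) * (Cstab\<^sup>2 * (2 * pair_sq (sol Th - sol TH)))"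
  proof (intro mult_left_mono)
    have "d\<^sup>2 \<le> 2 * pair_sq (sol Th - sol TH)"
      using power2_add_le[of "enorm (uH Th - uH TH)" "enorm (zz Th - zz TH)"]
      by (simp add: d_def pair_sq_def sol_def)
    then show "(Cstab * d)\<^sup>2 \<le> Cstab\<^sup>2 * (2 * pair_sq (sol Th - sol TH))"
      by (simp add: power_mult_distrib mult_left_mono)
  qed (use assms(3) in auto)
  also have "2 * (1 + 1 / \<delta>) * (Cstab\<^sup>2 * (2 * pair_sq (sol Th - sol TH))) =
      4 * (1 + 1 / \<delta>) * Cstab\<^sup>2 * pair_sq (sol Th - sol TH)" by simp
  finally show ?thesis by simp
qed

lemma quasi_monotonicity:
  assumes H: "TH \<in> R T0" and h: "Th \<in> R TH"
  shows "err Th \<le> (2 + 8 * Cstab\<^sup>2 * C_gal * Crel\<^sup>2) * err TH"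
proof -
  have "0 \<le> (1 - qred\<^sup>2) * \<rho> TH (TH - Th)"
    using params combined_est_sq_nonneg by (simp add: power_le_one)
  then have "err Th \<le> 2 * err TH + 8 * Cstab\<^sup>2 * pair_sq (sol Th - sol TH)"
    using estimator_perturbation[OF H h, of 1] by simp
  also have "\<dots> \<le> 2 * err TH + 8 * Cstab\<^sup>2 * (C_gal * Crel\<^sup>2 * err TH)"
    using pair_sq_sol_diff[OF H h] by (intro add_left_mono mult_left_mono) auto
  finally show ?thesis by (simp add: algebra_simps)
qed

context
  fixes \<theta> Cmark :: real and \<T> \<M> :: "nat \<Rightarrow> 'd mesh"
  assumes alg: "algorithm_B T0 refine \<eta> \<zeta> uH zH \<theta> Cmark \<T> \<M>"
begin

section \<open>Runs of the algorithm\<close>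

lemma run_step: "\<T> (Suc l) = refine (\<T> l) (\<M> l)" "\<M> l \<subseteq> \<T> l"
  "\<theta> * err (\<T> l) \<le> \<rho> (\<T> l) (\<M> l)"
  using alg by (simp_all add: algorithm_B_def)

lemma run_refines: "l \<le> n \<Longrightarrow> \<T> n \<in> R (\<T> l)"
proof (induction n rule: dec_induct)
  case base
  show ?case by (rule refinements.refl)
next
  case (step n)
  show ?case unfolding run_step(1) by (rule refinements.step[OF step(3) run_step(2)])
qed

lemma run_in: "\<T> l \<in> R T0"
  using run_refines[of 0 l] alg by (simp add: algorithm_B_def)

lemma run_marked: "\<M> l \<subseteq> \<T> l - \<T> (Suc l)"
  using mesh[unfolded mesh_refinement_def, THEN conjunct2, THEN conjunct1, rule_format, OF run_in[of l] run_step(2)[of l]]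
  unfolding run_step(1) by (elim conjE)

lemma run_nested_projections:
  "nested_projections (H10 \<Omega> \<times> H10 \<Omega>) pair_sq (\<lambda>k. X (\<T> k) \<times> X (\<T> k)) (\<lambda>k. annihilator (X (\<T> k)))
     (\<lambda>k. sol (\<T> k)) (u, z u) C_gal"
proof -
  interpret quadratic_form_on "H10 \<Omega> \<times> H10 \<Omega>" pair_sq by (rule quadratic_form_pair)
  show ?thesis
  proof unfold_locales
    show "0 < C_gal" using C_gal_pos by simp
    show "subspace (X (\<T> k) \<times> X (\<T> k))" for k by (intro subspace_Times subspace_fe_space)
    show "X (\<T> k) \<times> X (\<T> k) \<subseteq> H10 \<Omega> \<times> H10 \<Omega>" for k using X_subset_H10[of "\<T> k"] by auto
    show "X (\<T> k) \<times> X (\<T> k) \<subseteq> X (\<T> j) \<times> X (\<T> j)" if "k \<le> j" for k j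
      using X_mono[OF run_in run_refines[OF that]] by auto
    show "subspace (annihilator (X (\<T> k)))" for k using subspace_annihilator[OF X_subset_H10] .
    show "annihilator (X (\<T> k)) \<subseteq> H10 \<Omega> \<times> H10 \<Omega>" for k by (auto simp: annihilator_def)
    show "sol (\<T> k) \<in> X (\<T> k) \<times> X (\<T> k)" for k using sol_in run_in by blast
    show "sol (\<T> j) - sol (\<T> k) \<in> annihilator (X (\<T> k))" if "k \<le> j" for k j
      using sol_diff_annihilator[OF run_in run_refines[OF that]] .
    show "(u, z u) - sol (\<T> k) \<in> annihilator (X (\<T> k))" for k using exact_diff_annihilator run_in by blast
    show "pair_sq x \<le> C_gal * pair_sq (x + y)" if "x \<in> X (\<T> k) \<times> X (\<T> k)" "y \<in> annihilator (X (\<T> k))" for x y k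
      using galerkin_bound[OF X_subset_H10 that] .
  qed
qed

lemma run_quasi_orthogonality:
  assumes "0 < \<epsilon>" "16 * C_gal\<^sup>2 < \<epsilon> * real m"
  shows "(\<Sum>k\<in>{l..<l + n}. pair_sq (sol (\<T> (Suc k)) - sol (\<T> k)))
    \<le> (\<epsilon> * real n + 4 * C_gal * 2 ^ m) * (Crel\<^sup>2 * err (\<T> l))"
proof -
  have "(\<Sum>k\<in>{l..<l + n}. pair_sq (sol (\<T> (Suc k)) - sol (\<T> k)))
      \<le> (\<epsilon> * real n + 4 * C_gal * 2 ^ m) * pair_sq ((u, z u) - sol (\<T> l))"
    using nested_projections.sum_increments_le[OF run_nested_projections assms] .
  also have "\<dots> \<le> (\<epsilon> * real n + 4 * C_gal * 2 ^ m) * (Crel\<^sup>2 * err (\<T> l))"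
    using pair_sq_exact_diff[OF run_in] assms C_gal_pos by (intro mult_left_mono) auto
  finally show ?thesis .
qed

text \<open>All marked elements are refined, so the share \<open>\<theta>\<close> of the squared
  estimator selected by Doerfler marking shrinks by the factor \<open>qred\<^sup>2\<close>.\<close>

lemma run_estimator_reduction:
  assumes "0 < \<delta>"
  shows "err (\<T> (Suc k)) \<le> (1 + \<delta>) * (1 - (1 - qred\<^sup>2) * \<theta>) * err (\<T> k)
      + 4 * (1 + 1 / \<delta>) * Cstab\<^sup>2 * pair_sq (sol (\<T> (Suc k)) - sol (\<T> k))"
proof -
  have fin: "finite (\<T> k - \<T> (Suc k))" using finite_mesh[OF run_in] by blast
  have "\<theta> * err (\<T> k) \<le> \<rho> (\<T> k) (\<M> k)" by (rule run_step)
  also have "\<dots> \<le> \<rho> (\<T> k) (\<T> k - \<T> (Suc k))"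
    unfolding combined_est_sq_def using run_marked[of k] fin by (intro add_mono est_sq_mono)
  finally have "(1 - qred\<^sup>2) * (\<theta> * err (\<T> k)) \<le> (1 - qred\<^sup>2) * \<rho> (\<T> k) (\<T> k - \<T> (Suc k))"
    using params by (intro mult_left_mono) (auto simp: power_le_one)
  then have "err (\<T> k) - (1 - qred\<^sup>2) * \<rho> (\<T> k) (\<T> k - \<T> (Suc k)) \<le> (1 - (1 - qred\<^sup>2) * \<theta>) * err (\<T> k)"
    by (simp add: algebra_simps)
  then have "(1 + \<delta>) * (err (\<T> k) - (1 - qred\<^sup>2) * \<rho> (\<T> k) (\<T> k - \<T> (Suc k)))
      \<le> (1 + \<delta>) * ((1 - (1 - qred\<^sup>2) * \<theta>) * err (\<T> k))"
    using assms by (intro mult_left_mono) auto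
  then show ?thesis
    using estimator_perturbation[OF run_in run_refines[OF le_SucI[OF order_refl]] assms, of k] by (simp add: mult.assoc)
qed

end

end

text \<open>Packages the uniformity: the rate constants are parameters, whereas meshes, data,
  indicators, \<open>Cmark\<close>, \<open>Cdrel\<close> and \<open>Cmesh\<close> are quantified
  inside.\<close>

definition linear_rate where
  "linear_rate \<Omega> A b c K \<theta> qred Cstab Crel Clin qlin \<longleftrightarrow>
     (\<forall>Cmark Cdrel Cmesh f fv p T0 refine \<eta> \<zeta> u z uH zH \<T> \<M> l n.
        afem_setting \<Omega> A b c K qred Cstab Crel Cdrel Cmesh f fv p T0 refine \<eta> \<zeta> u z uH zH \<longrightarrow>
        algorithm_B T0 refine \<eta> \<zeta> uH zH \<theta> Cmark \<T> \<M> \<longrightarrow> l \<le> n \<longrightarrow>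
        combined_est_sq \<eta> \<zeta> uH zH (\<T> n) (\<T> n)
          \<le> Clin * qlin ^ (n - l) * combined_est_sq \<eta> \<zeta> uH zH (\<T> l) (\<T> l))"

lemma uniform_linear_convergence:
  fixes \<Omega> :: "(real^'d) set"
  assumes "bounded_open \<Omega>" and ell: "elliptic_forms (H10 \<Omega>) (energy_norm \<Omega> A) (bilin \<Omega> A b c) K Ca \<alpha> Cb"
    and \<theta>: "0 < \<theta>" "\<theta> \<le> 1"
  shows "\<exists>Clin qlin. 0 < Clin \<and> 0 < qlin \<and> qlin < 1 \<and>
         linear_rate \<Omega> A b c K \<theta> qred Cstab Crel Clin qlin"
proof (cases "0 < qred \<and> qred < 1 \<and> 0 < Cstab \<and> 0 < Crel")
  \<comment> \<open>No setting has such parameters, so the claim is vacuous and any constants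
    serve.\<close>
  case False
  then show ?thesis
    by (intro exI[of _ 1] exI[of _ "1/2"]) (auto simp: linear_rate_def afem_setting_def)
next
  case True
  interpret elliptic_forms "H10 \<Omega>" "energy_norm \<Omega> A" "bilin \<Omega> A b c" K Ca \<alpha> Cb by (rule ell)
  define \<kappa>0 where "\<kappa>0 = 1 - (1 - qred\<^sup>2) * \<theta>"
  have qq: "0 < qred\<^sup>2" "qred\<^sup>2 < 1" using True by (auto simp: power_less_one_iff)
  have "(1 - qred\<^sup>2) * \<theta> \<le> 1 - qred\<^sup>2" using qq \<theta> by (simp add: mult_left_le)
  moreover have "0 < (1 - qred\<^sup>2) * \<theta>" using qq \<theta> by simp
  ultimately have \<kappa>0: "0 < \<kappa>0" "\<kappa>0 < 1" using qq(1) unfolding \<kappa>0_def by linarith+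
  \<comment> \<open>Makes \<open>(1 + \<delta>) * \<kappa>0\<close> the midpoint between
    \<open>\<kappa>0\<close> and 1.\<close>
  define \<delta> where "\<delta> = (1 - \<kappa>0) / (2 * \<kappa>0)"
  have \<delta>: "0 < \<delta>" "(1 + \<delta>) * \<kappa>0 = (1 + \<kappa>0) / 2" using \<kappa>0 by (auto simp: \<delta>_def field_simps)
  define c1 where "c1 = 4 * (1 + 1 / \<delta>) * Cstab\<^sup>2"
  define c2 where "c2 = 2 + 8 * Cstab\<^sup>2 * C_gal * Crel\<^sup>2"
  \<comment> \<open>The depth of the averaging tree required for a given \<open>\<epsilon>\<close>.
    In \<open>G\<close> it is taken at \<open>\<epsilon> / Crel\<^sup>2\<close>, because reliability
    replaces the error by \<open>Crel\<^sup>2\<close> times the squared estimator.\<close>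
  define m where "m = (\<lambda>\<epsilon>. nat \<lceil>16 * C_gal\<^sup>2 / \<epsilon>\<rceil> + 1)"
  define G where "G = (\<lambda>\<epsilon>. 4 * C_gal * 2 ^ m (\<epsilon> / Crel\<^sup>2) * Crel\<^sup>2)"
  have m: "16 * C_gal\<^sup>2 < \<epsilon> * real (m \<epsilon>)" if "0 < \<epsilon>" for \<epsilon>
  proof -
    have "16 * C_gal\<^sup>2 / \<epsilon> \<le> real (nat \<lceil>16 * C_gal\<^sup>2 / \<epsilon>\<rceil>)" by (rule real_nat_ceiling_ge)
    then have "16 * C_gal\<^sup>2 / \<epsilon> < real (m \<epsilon>)" by (simp add: m_def)
    then show ?thesis using that by (simp add: field_simps)
  qed
  have cb: "0 < (1 + \<kappa>0) / 2" "(1 + \<kappa>0) / 2 < 1" "0 < c1" "1 \<le> c2"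
    using \<kappa>0 \<delta> True C_gal_pos by (auto simp: c1_def c2_def add_pos_pos intro: add_increasing2)
  have G: "0 \<le> G \<epsilon>" for \<epsilon> using C_gal_pos by (simp add: G_def)
  obtain C r where Cr: "0 < C" "0 < r" "r < 1"
    and conv: "\<forall>\<rho> e :: nat \<Rightarrow> real. (\<forall>k. 0 \<le> \<rho> k) \<longrightarrow>
       (\<forall>k. \<rho> (Suc k) \<le> (1 + \<kappa>0) / 2 * \<rho> k + c1 * e k) \<longrightarrow>
       (\<forall>l k. l \<le> k \<longrightarrow> \<rho> k \<le> c2 * \<rho> l) \<longrightarrow>
       (\<forall>\<epsilon> l N. 0 < \<epsilon> \<longrightarrow> (\<Sum>k\<in>{l..<l + N}. e k) \<le> (\<epsilon> * real N + G \<epsilon>) * \<rho> l) \<longrightarrow>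
       (\<forall>l n. l \<le> n \<longrightarrow> \<rho> n \<le> C * r ^ (n - l) * \<rho> l)"
  proof -
    from linear_convergence[OF cb, where G = G, OF G] show ?thesis
      by (elim exE conjE) (rule that)
  qed
  have main: "combined_est_sq \<eta> \<zeta> uH zH (\<T> n) (\<T> n) \<le> C * r ^ (n - l) * combined_est_sq \<eta> \<zeta> uH zH (\<T> l) (\<T> l)"
    if setting: "afem_setting \<Omega> A b c K qred Cstab Crel Cdrel Cmesh f fv p T0 refine \<eta> \<zeta> u z uH zH"
      and alg: "algorithm_B T0 refine \<eta> \<zeta> uH zH \<theta> Cmark \<T> \<M>" and ln: "l \<le> n"
    for Cmark Cdrel Cmesh f fv p T0 refine \<eta> \<zeta> u z uH zH \<T> \<M> l n
  proof -
    interpret afem \<Omega> A b c K Ca \<alpha> Cb qred Cstab Crel Cdrel Cmesh f fv p T0 refine \<eta> \<zeta> u z uH zH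
      using assms(1) ell setting by (simp add: afem_def afem_axioms_def)
    let ?\<rho> = "\<lambda>k. err (\<T> k)" and ?e = "\<lambda>k. pair_sq (sol (\<T> (Suc k)) - sol (\<T> k))"
    have "\<forall>l n. l \<le> n \<longrightarrow> ?\<rho> n \<le> C * r ^ (n - l) * ?\<rho> l"
    proof (rule conv[THEN spec[of _ ?\<rho>], THEN spec[of _ ?e], THEN mp, THEN mp, THEN mp, THEN mp])
      show "\<forall>k. 0 \<le> ?\<rho> k" by (simp add: combined_est_sq_nonneg)
      show "\<forall>k. ?\<rho> (Suc k) \<le> (1 + \<kappa>0) / 2 * ?\<rho> k + c1 * ?e k"
        using run_estimator_reduction[OF alg \<delta>(1), folded \<kappa>0_def c1_def, unfolded \<delta>(2)] by blast
      show "\<forall>l k. l \<le> k \<longrightarrow> ?\<rho> k \<le> c2 * ?\<rho> l"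
        using quasi_monotonicity[OF run_in[OF alg] run_refines[OF alg]] unfolding c2_def by blast
      show "\<forall>\<epsilon> l N. 0 < \<epsilon> \<longrightarrow> (\<Sum>k\<in>{l..<l + N}. ?e k) \<le> (\<epsilon> * real N + G \<epsilon>) * ?\<rho> l"
      proof (intro allI impI)
        fix \<epsilon> :: real and l n :: nat assume "0 < \<epsilon>"
        then have \<epsilon>: "0 < \<epsilon> / Crel\<^sup>2" using True by simp
        have "(\<epsilon> / Crel\<^sup>2 * real n + 4 * C_gal * 2 ^ m (\<epsilon> / Crel\<^sup>2)) * (Crel\<^sup>2 * ?\<rho> l) = (\<epsilon> * real n + G \<epsilon>) * ?\<rho> l"
          using True by (simp add: G_def field_simps)
        then show "(\<Sum>k\<in>{l..<l + n}. ?e k) \<le> (\<epsilon> * real n + G \<epsilon>) * ?\<rho> l"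
          using run_quasi_orthogonality[OF alg \<epsilon> m[OF \<epsilon>], where l = l and n = n]
          by (simp only:)
      qed
    qed
    then show ?thesis using ln by blast
  qed
  show ?thesis
    unfolding linear_rate_def by (intro exI[of _ C] exI[of _ r] conjI allI impI Cr main)
qed

section \<open>Optimal convergence rates\<close>

text \<open>The slack \<open>\<epsilon>\<close> makes it unnecessary to know that the infimum over
  meshes is attained: if all meshes exceeded the bound, the supremum would exceed itself by
  \<open>(n + 1) powr s * \<epsilon>\<close>.\<close>

lemma approx_norm_witness:
  fixes e :: "'d::finite mesh \<Rightarrow> real"
  assumes fin: "approx_norm refine T0 s e < \<infinity>" and "\<And>\<T>. 0 \<le> e \<T>" "0 < \<epsilon>"
  shows "\<exists>\<T>\<in>refinements refine T0. card \<T> \<le> card T0 + n \<and>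
    e \<T> \<le> enn2real (approx_norm refine T0 s e) * real (n + 1) powr - s + \<epsilon>"
proof (rule ccontr)
  let ?B = "enn2real (approx_norm refine T0 s e)" and ?n = "real (n + 1)"
  let ?t = "?B * ?n powr - s + \<epsilon>"
  let ?S = "{\<T> \<in> refinements refine T0. card \<T> \<le> card T0 + n}"
  assume contra: "\<not> ?thesis"
  have t: "0 \<le> ?t" using assms(3) by (simp add: add_nonneg_nonneg)
  have "ennreal ?t \<le> (INF \<T>\<in>?S. ennreal (e \<T>))"
  proof (rule INF_greatest)
    fix \<T> assume "\<T> \<in> ?S"
    then have "?t \<le> e \<T>" using contra by force
    then show "ennreal ?t \<le> ennreal (e \<T>)" by (rule ennreal_leI)
  qed
  then have "ennreal (?n powr s) * ennreal ?t \<le> ennreal (?n powr s) * (INF \<T>\<in>?S. ennreal (e \<T>))"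
    by (intro mult_left_mono) auto
  also have "\<dots> \<le> approx_norm refine T0 s e"
    unfolding approx_norm_def by (rule SUP_upper) simp
  also have "\<dots> = ennreal ?B" using fin by simp
  finally have "ennreal (?n powr s * ?t) \<le> ennreal ?B" using t by (simp add: ennreal_mult)
  then have "?n powr s * ?t \<le> ?B" by (simp add: ennreal_le_iff)
  moreover have "?n powr s * ?t = ?B + ?n powr s * \<epsilon>"
    by (simp add: distrib_left powr_minus field_simps)
  moreover have "0 < ?n powr s * \<epsilon>" using assms(3) by simp
  ultimately show False by linarith
qed

lemma powr_inverse_powr: "0 \<le> x \<Longrightarrow> 0 < \<beta> \<Longrightarrow> (x powr (1 / \<beta>)) powr \<beta> = (x :: real)"
  by (simp add: powr_powr)

text \<open>The place where the threshold for the marking parameter enters: with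
  \<open>t = \<theta> * (1 + C\<^sup>2)\<close> the gap \<open>1 - t\<close> is halved, one half
  paying for \<open>\<delta>\<close>, the other for \<open>\<kappa>\<close>.\<close>

lemma Doerfler_constants:
  fixes \<theta> C :: real
  assumes "0 < \<theta>" "\<theta> * (1 + C\<^sup>2) < 1"
  obtains \<delta> \<kappa> where "0 < \<delta>" "0 < \<kappa>" "\<theta> * (1 + (1 + \<delta>) * C\<^sup>2) \<le> 1 - (1 + 1 / \<delta>) * \<kappa>"
proof -
  define t where "t = \<theta> * (1 + C\<^sup>2)"
  define \<delta> where "\<delta> = (1 - t) / (2 * t)"
  define \<kappa> where "\<kappa> = (1 - t) / (2 * (1 + 1 / \<delta>))"
  have t: "0 < t" "t < 1" using assms by (auto simp: t_def add_pos_nonneg)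
  have \<delta>: "0 < \<delta>" using t by (simp add: \<delta>_def)
  have \<kappa>: "0 < \<kappa>" using t \<delta> by (simp add: \<kappa>_def add_pos_pos)
  have "0 < 1 + 1 / \<delta>" using \<delta> by (simp add: add_pos_pos)
  then have *: "(1 + 1 / \<delta>) * \<kappa> = (1 - t) / 2"
    unfolding \<kappa>_def by (simp only: times_divide_eq_right mult_divide_mult_cancel_left_if mult.commute[of 2]) simp
  have "\<theta> * (1 + (1 + \<delta>) * C\<^sup>2) \<le> t + \<delta> * t"
    using assms(1) \<delta> by (simp add: t_def algebra_simps)
  also have "\<delta> * t = (1 - t) / 2" using t by (simp add: \<delta>_def)
  also have "t + (1 - t) / 2 = 1 - (1 + 1 / \<delta>) * \<kappa>" unfolding * by (simp add: field_simps)
  finally have "\<theta> * (1 + (1 + \<delta>) * C\<^sup>2) \<le> 1 - (1 + 1 / \<delta>) * \<kappa>" .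
  then show ?thesis using that \<delta> \<kappa> by blast
qed

text \<open>Kept outside the locale as a function of numbers, so that the optimality constant can be
  exhibited before meshes and indicators are fixed. The first factor is the quasi-monotonicity
  constant, the second pays for replacing the dual datum \<open>u\<close> by
  \<open>uH \<T>\<close>.\<close>

definition overlay_constant :: "real \<Rightarrow> real \<Rightarrow> real \<Rightarrow> real \<Rightarrow> real" where
  "overlay_constant L Cstab Crel Cdrel =
     (2 + 4 * (Cstab * Cdrel)\<^sup>2) * (2 + 2 * (Cstab * (L * Crel))\<^sup>2)"

lemma overlay_constant_pos: "0 < overlay_constant L Cstab Crel Cdrel"
  by (simp add: overlay_constant_def add_pos_nonneg)

context afem
begin

definition C_mon :: real where
  "C_mon = 2 + 4 * (Cstab * Cdrel)\<^sup>2"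

definition C_ov :: real where
  "C_ov = overlay_constant (2 * Cb / \<alpha>) Cstab Crel Cdrel"

lemma C_ov_pos: "0 < C_ov"
  unfolding C_ov_def by (rule overlay_constant_pos)

section \<open>Quasi-monotonicity of each estimator and overlays\<close>

lemma discrete_reliability: "discrete_reliability enorm (H10 \<Omega>) R T0 \<eta> \<zeta> uH zH Cdrel"
  using setting by (simp add: afem_setting_def)

text \<open>One argument for both estimators: stability on kept elements, stability and reduction on
  new ones, and the premise \<open>drel\<close> absorbs the change of the discrete function into the
  coarse estimator.\<close>

lemma single_quasi_monotonicity:
  assumes H: "TH \<in> R T0" and h: "Th \<in> R TH" and v: "vH \<in> X TH" "vh \<in> X Th"
    and \<epsilon>: "\<epsilon> \<in> {\<eta>, \<zeta>}" and drel: "enorm (vh - vH) \<le> Cdrel * est \<epsilon> TH (TH - Th) vH"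
  shows "(est \<epsilon> Th Th vh)\<^sup>2 \<le> C_mon * (est \<epsilon> TH TH vH)\<^sup>2"
proof -
  have h0: "Th \<in> R T0" using H h by (rule refine_trans)
  have v': "vH \<in> X Th" using v X_mono[OF H h] by blast
  define d where "d = Cstab * enorm (vh - vH)"
  define y where "y = est \<epsilon> TH (TH - Th) vH"
  define x where "x = est \<epsilon> TH (Th \<inter> TH) vH"
  have 1: "est \<epsilon> Th (Th \<inter> TH) vh \<le> x + d"
    using stability_single[OF H h v(2,1) order_refl \<epsilon>] by (simp add: d_def x_def)
  have 2: "est \<epsilon> Th (Th - TH) vh \<le> qred * y + d"
    using stability_single[OF h0 refinements.refl v(2) v' _ \<epsilon>, of "Th - TH"] reduction_single[OF H h v(1) \<epsilon>]
    by (simp add: d_def y_def)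
  have split: "(est \<epsilon> TH TH vH)\<^sup>2 = x\<^sup>2 + y\<^sup>2"
    using est_sq_split[OF finite_mesh[OF H], of \<epsilon> TH vH Th] by (simp add: x_def y_def Int_commute)
  have "(est \<epsilon> Th Th vh)\<^sup>2 \<le> 2 * (x\<^sup>2 + qred\<^sup>2 * y\<^sup>2) + 4 * d\<^sup>2"
    using sum_power2_perturb[OF zero_less_one est_nonneg est_nonneg 1 2]
      est_sq_split[OF finite_mesh[OF h0], of \<epsilon> Th vh TH] by simp
  also have "qred\<^sup>2 * y\<^sup>2 \<le> 1 * y\<^sup>2"
    using params by (intro mult_right_mono) (auto simp: power_le_one)
  also have "d\<^sup>2 \<le> (Cstab * Cdrel)\<^sup>2 * y\<^sup>2"
  proof -
    have "0 \<le> enorm (vh - vH)"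
      using N_nonneg subspace_diff[OF subspace_H10] v X_subset_H10 by blast
    then have "0 \<le> d" using params by (simp add: d_def)
    moreover have "d \<le> Cstab * (Cdrel * y)"
      unfolding d_def y_def using drel params by (intro mult_left_mono) auto
    ultimately have "d\<^sup>2 \<le> (Cstab * Cdrel * y)\<^sup>2" by (intro power_mono) (auto simp: mult.assoc)
    then show ?thesis unfolding power_mult_distrib .
  qed
  finally have "(est \<epsilon> Th Th vh)\<^sup>2 \<le> 2 * (x\<^sup>2 + y\<^sup>2) + 4 * ((Cstab * Cdrel)\<^sup>2 * y\<^sup>2)" by simp
  also have "\<dots> \<le> 2 * (x\<^sup>2 + y\<^sup>2) + 4 * ((Cstab * Cdrel)\<^sup>2 * (x\<^sup>2 + y\<^sup>2))"
    by (intro add_left_mono mult_left_mono) auto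
  finally show ?thesis by (simp add: split C_mon_def algebra_simps)
qed

lemma primal_quasi_monotonicity:
  assumes "TH \<in> R T0" "Th \<in> R TH"
  shows "(est \<eta> Th Th (uH Th))\<^sup>2 \<le> C_mon * (est \<eta> TH TH (uH TH))\<^sup>2"
  using discrete_reliability assms uH_in_X refine_trans[OF assms]
  by (intro single_quasi_monotonicity) (auto simp: discrete_reliability_def fun_diff_def)

lemma dual_quasi_monotonicity:
  assumes "TH \<in> R T0" "Th \<in> R TH" "w \<in> H10 \<Omega>"
  shows "(est \<zeta> Th Th (zH Th w))\<^sup>2 \<le> C_mon * (est \<zeta> TH TH (zH TH w))\<^sup>2"
  using discrete_reliability assms zH_in_X refine_trans[OF assms(1,2)]
  by (intro single_quasi_monotonicity) (auto simp: discrete_reliability_def fun_diff_def)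

text \<open>Both discrete dual problems have the same form and differ only in their datum, by the
  primal error, which reliability bounds by the primal estimator.\<close>

lemma dual_solution_shift:
  assumes \<T>: "\<T> \<in> R T0"
  shows "enorm (zz \<T> - zH \<T> u) \<le> (2 * Cb / \<alpha>) * (Crel * est \<eta> \<T> \<T> (uH \<T>))"
proof -
  have H: "uH \<T> \<in> H10 \<Omega>" using \<T> by (rule uH_in_H10)
  have e: "u - uH \<T> \<in> H10 \<Omega>" using subspace_diff[OF subspace_H10 u_in_H10 H] .
  have Z: "zz \<T> \<in> X \<T>" "zH \<T> u \<in> X \<T>" using zH_in_X[OF \<T>] H u_in_H10 by auto
  have "enorm (zH \<T> u - zz \<T>) \<le> (2 * Cb / \<alpha>) * enorm (u - uH \<T>)"
  proof (rule dual_galerkin_bound[OF X_subset_H10 _ e])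
    show "zH \<T> u - zz \<T> \<in> X \<T>" using Z subspace_diff[OF subspace_fe_space] by blast
    fix v assume v: "v \<in> X \<T>"
    then have "v \<in> H10 \<Omega>" "zz \<T> \<in> H10 \<Omega>" "zH \<T> u \<in> H10 \<Omega>" using Z X_subset_H10 by auto
    then show "form v (zH \<T> u - zz \<T>) = K v (u - uH \<T>) + K (u - uH \<T>) v"
      using discrete_dual_eq[OF \<T> H v] discrete_dual_eq[OF \<T> u_in_H10 v] H u_in_H10
      by (simp add: a_diff k_diff)
  qed
  also have "\<dots> \<le> (2 * Cb / \<alpha>) * (Crel * est \<eta> \<T> \<T> (uH \<T>))"
  proof (intro mult_left_mono)
    have "reliability enorm (H10 \<Omega>) R T0 \<eta> \<zeta> u z uH zH Crel"
      using setting by (simp add: afem_setting_def)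
    then show "enorm (u - uH \<T>) \<le> Crel * est \<eta> \<T> \<T> (uH \<T>)"
      using \<T> by (simp add: reliability_def fun_diff_def)
  qed (use constants in auto)
  also have "enorm (zH \<T> u - zz \<T>) = enorm (zz \<T> - zH \<T> u)"
  proof (rule power2_eq_imp_eq)
    have d: "zz \<T> - zH \<T> u \<in> H10 \<Omega>" "zH \<T> u - zz \<T> \<in> H10 \<Omega>"
      using Z X_subset_H10 subspace_diff[OF subspace_H10] by blast+
    show "(enorm (zH \<T> u - zz \<T>))\<^sup>2 = (enorm (zz \<T> - zH \<T> u))\<^sup>2" using N_scale[OF d(1), of "- 1"] by simp
    show "0 \<le> enorm (zH \<T> u - zz \<T>)" "0 \<le> enorm (zz \<T> - zH \<T> u)" using N_nonneg d by auto
  qed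
  finally show ?thesis .
qed

text \<open>Near-optimal meshes for the primal and for the dual problem are unrelated. On a common
  refinement each estimator is controlled by its own mesh, and the shift of the dual datum is
  charged to the primal estimator.\<close>

lemma overlay_estimator:
  assumes "T1 \<in> R T0" "T2 \<in> R T0" "\<T> \<in> R T1" "\<T> \<in> R T2"
  shows "err \<T> \<le> C_ov * ((est \<eta> T1 T1 (uH T1))\<^sup>2 + (est \<zeta> T2 T2 (zH T2 u))\<^sup>2)"
proof -
  have \<T>: "\<T> \<in> R T0" using refine_trans[OF assms(1,3)] .
  let ?x = "(est \<eta> T1 T1 (uH T1))\<^sup>2" and ?y = "(est \<zeta> T2 T2 (zH T2 u))\<^sup>2"
  let ?D = "Cstab * ((2 * Cb / \<alpha>) * Crel)"
  have x: "(est \<eta> \<T> \<T> (uH \<T>))\<^sup>2 \<le> C_mon * ?x" using primal_quasi_monotonicity assms by blast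
  have y: "(est \<zeta> \<T> \<T> (zH \<T> u))\<^sup>2 \<le> C_mon * ?y" using dual_quasi_monotonicity assms u_in_H10 by blast
  have "est \<zeta> \<T> \<T> (zz \<T>) \<le> est \<zeta> \<T> \<T> (zH \<T> u) + Cstab * enorm (zz \<T> - zH \<T> u)"
    using stability_single[OF \<T> refinements.refl, of "zz \<T>" "zH \<T> u" \<T> \<zeta>] zH_in_X[OF \<T>] uH_in_H10[OF \<T>] u_in_H10
    by auto
  also have "Cstab * enorm (zz \<T> - zH \<T> u) \<le> Cstab * ((2 * Cb / \<alpha>) * (Crel * est \<eta> \<T> \<T> (uH \<T>)))"
    using dual_solution_shift[OF \<T>] params by (intro mult_left_mono) auto
  finally have "est \<zeta> \<T> \<T> (zz \<T>) \<le> est \<zeta> \<T> \<T> (zH \<T> u) + ?D * est \<eta> \<T> \<T> (uH \<T>)"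
    by (simp add: mult.assoc)
  then have "(est \<zeta> \<T> \<T> (zz \<T>))\<^sup>2 \<le> (est \<zeta> \<T> \<T> (zH \<T> u) + ?D * est \<eta> \<T> \<T> (uH \<T>))\<^sup>2"
    by (rule power_mono) (rule est_nonneg)
  also have "\<dots> \<le> 2 * (est \<zeta> \<T> \<T> (zH \<T> u))\<^sup>2 + 2 * (?D * est \<eta> \<T> \<T> (uH \<T>))\<^sup>2" by (rule power2_add_le)
  also have "\<dots> = 2 * (est \<zeta> \<T> \<T> (zH \<T> u))\<^sup>2 + 2 * ?D\<^sup>2 * (est \<eta> \<T> \<T> (uH \<T>))\<^sup>2"
    unfolding power_mult_distrib[of ?D] by simp
  finally have "err \<T> \<le> (1 + 2 * ?D\<^sup>2) * (est \<eta> \<T> \<T> (uH \<T>))\<^sup>2 + 2 * (est \<zeta> \<T> \<T> (zH \<T> u))\<^sup>2"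
    by (simp add: combined_est_sq_def distrib_right)
  also have "\<dots> \<le> (1 + 2 * ?D\<^sup>2) * (C_mon * ?x) + 2 * (C_mon * ?y)"
    using x y by (intro add_mono mult_left_mono) auto
  also have "\<dots> \<le> (2 + 2 * ?D\<^sup>2) * (C_mon * ?x) + (2 + 2 * ?D\<^sup>2) * (C_mon * ?y)"
    by (intro add_mono mult_right_mono) (auto simp: C_mon_def)
  also have "\<dots> = C_ov * (?x + ?y)" unfolding C_ov_def overlay_constant_def C_mon_def
    by (simp only: distrib_left mult_ac)
  finally show ?thesis .
qed

text \<open>On elements common to both meshes the coarse estimator is at most the small fine
  estimator plus a stability term, which discrete reliability bounds by the refined elements alone.
  Hence the refined elements must carry a large share of \<open>err TH\<close>.\<close>

lemma Doerfler_optimality: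
  assumes H: "TH \<in> R T0" and h: "Th \<in> R TH" and small: "err Th \<le> \<kappa> * err TH"
    and \<delta>: "0 < \<delta>" "\<theta> * (1 + (1 + \<delta>) * (Cstab * Cdrel)\<^sup>2) \<le> 1 - (1 + 1 / \<delta>) * \<kappa>"
  shows "\<theta> * err TH \<le> \<rho> TH (TH - Th)"
proof -
  have h0: "Th \<in> R T0" using H h by (rule refine_trans)
  let ?G = "\<rho> TH (TH - Th)" and ?C = "Cstab * Cdrel"
  have X_h: "uH Th \<in> X Th" "zz Th \<in> X Th" using sol_in[OF h0] by (auto simp: sol_def)
  have X_H: "uH TH \<in> X TH" "zz TH \<in> X TH" using sol_in[OF H] by (auto simp: sol_def)
  have "sqrt (\<rho> TH (Th \<inter> TH)) \<le> Cstab * (enorm (uH Th - uH TH) + enorm (zz Th - zz TH)) + sqrt (\<rho> Th (Th \<inter> TH))"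
    using stability_combined[OF H h X_h X_H, of "Th \<inter> TH"] by (simp add: combined_est_sq_def)
  also have "Cstab * (enorm (uH Th - uH TH) + enorm (zz Th - zz TH)) \<le> Cstab * (Cdrel * sqrt ?G)"
    using discrete_reliability H h params
    by (intro mult_left_mono) (auto simp: discrete_reliability_def fun_diff_def combined_est_sq_def)
  also have "\<dots> = ?C * sqrt ?G" by simp
  finally have "(sqrt (\<rho> TH (Th \<inter> TH)))\<^sup>2 \<le> (?C * sqrt ?G + sqrt (\<rho> Th (Th \<inter> TH)))\<^sup>2"
    by (intro power_mono) (auto simp: combined_est_sq_nonneg)
  also have "\<dots> \<le> (1 + \<delta>) * (?C * sqrt ?G)\<^sup>2 + (1 + 1 / \<delta>) * (sqrt (\<rho> Th (Th \<inter> TH)))\<^sup>2"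
    by (rule power2_add_le_Young[OF \<delta>(1)])
  also have "\<dots> = (1 + \<delta>) * (?C\<^sup>2 * ?G) + (1 + 1 / \<delta>) * \<rho> Th (Th \<inter> TH)"
    unfolding power_mult_distrib[of ?C] by (simp add: combined_est_sq_nonneg)
  also have "\<dots> \<le> (1 + \<delta>) * (?C\<^sup>2 * ?G) + (1 + 1 / \<delta>) * (\<kappa> * err TH)"
  proof (intro add_left_mono mult_left_mono)
    have "\<rho> Th (Th \<inter> TH) \<le> err Th"
      unfolding combined_est_sq_def using finite_mesh[OF h0] by (intro add_mono est_sq_mono) auto
    then show "\<rho> Th (Th \<inter> TH) \<le> \<kappa> * err TH" using small by linarith
  qed (use \<delta> in auto)
  finally have part: "\<rho> TH (Th \<inter> TH) \<le> (1 + \<delta>) * (?C\<^sup>2 * ?G) + (1 + 1 / \<delta>) * (\<kappa> * err TH)"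
    by (simp add: combined_est_sq_nonneg)
  have split_H: "err TH = \<rho> TH (Th \<inter> TH) + ?G"
    unfolding Int_commute[of Th] using combined_est_sq_split[OF finite_mesh[OF H]] .
  \<comment> \<open>Eliminating the common elements gives
    \<open>(1 - (1 + 1 / \<delta>) * \<kappa>) * err TH \<le> ?L * ?G\<close>; the choice of
    \<open>\<delta>\<close> and \<open>\<kappa>\<close> bounds the left factor below by
    \<open>\<theta> * ?L\<close>, and \<open>?L\<close> cancels.\<close>
  let ?L = "1 + (1 + \<delta>) * ?C\<^sup>2"
  have "?L * (\<theta> * err TH) = (\<theta> * ?L) * err TH" by simp
  also have "\<dots> \<le> (1 - (1 + 1 / \<delta>) * \<kappa>) * err TH"
    using \<delta>(2) combined_est_sq_nonneg by (rule mult_right_mono)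
  also have "\<dots> = err TH - (1 + 1 / \<delta>) * (\<kappa> * err TH)" by (simp only: left_diff_distrib mult.assoc mult_1)
  also have "\<dots> \<le> ?G + (1 + \<delta>) * (?C\<^sup>2 * ?G)" using part split_H by linarith
  also have "\<dots> = ?L * ?G" by (simp only: distrib_right mult.assoc mult_1)
  finally show ?thesis using \<delta>(1) by (simp add: add_pos_nonneg)
qed

lemma overlay3:
  assumes "T1 \<in> R T0" "T2 \<in> R T0" "T3 \<in> R T0"
  shows "\<exists>\<T>. \<T> \<in> R T1 \<and> \<T> \<in> R T2 \<and> \<T> \<in> R T3 \<and>
    card \<T> + 2 * card T0 \<le> card T1 + card T2 + card T3"
proof -
  have overlay: "\<exists>\<T>\<in>R TH \<inter> R Th. card \<T> + card T0 \<le> card TH + card Th"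
    if "TH \<in> R T0" "Th \<in> R T0" for TH Th
    using mesh[unfolded mesh_refinement_def, THEN conjunct2, THEN conjunct2, THEN conjunct2, THEN conjunct2,
        rule_format, OF that] .
  obtain \<T>' where \<T>': "\<T>' \<in> R T1" "\<T>' \<in> R T2" "card \<T>' + card T0 \<le> card T1 + card T2"
    using overlay[OF assms(1,2)] by blast
  obtain \<T> where \<T>: "\<T> \<in> R \<T>'" "\<T> \<in> R T3" "card \<T> + card T0 \<le> card \<T>' + card T3"
    using overlay[OF refine_trans[OF assms(1) \<T>'(1)] assms(3)] by blast
  have "\<T> \<in> R T1" "\<T> \<in> R T2" using refinements_trans[OF \<T>(1)] \<T>'(1,2) by auto
  then show ?thesis using \<T> \<T>'(3) by (intro exI[of _ \<T>]) simp
qed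

context
  fixes \<theta> Cmark \<delta> \<kappa> s t :: real and \<T> \<M> :: "nat \<Rightarrow> 'd mesh"
  assumes alg: "algorithm_B T0 refine \<eta> \<zeta> uH zH \<theta> Cmark \<T> \<M>"
    and Cmark: "1 \<le> Cmark"
    and \<delta>: "0 < \<delta>" "\<theta> * (1 + (1 + \<delta>) * (Cstab * Cdrel)\<^sup>2) \<le> 1 - (1 + 1 / \<delta>) * \<kappa>"
    and \<kappa>: "0 < \<kappa>" and st: "0 < s" "0 < t"
    and fin: "approx_norm refine T0 s (\<lambda>TH. est \<eta> TH TH (uH TH))
              + approx_norm refine T0 t (\<lambda>TH. est \<zeta> TH TH (zH TH u)) < \<infinity>"
begin

section \<open>Counting marked elements\<close>

abbreviation "\<beta> \<equiv> min (2 * s) (2 * t)"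
abbreviation "Au \<equiv> enn2real (approx_norm refine T0 s (\<lambda>TH. est \<eta> TH TH (uH TH)))"
abbreviation "Az \<equiv> enn2real (approx_norm refine T0 t (\<lambda>TH. est \<zeta> TH TH (zH TH u)))"
abbreviation "As \<equiv> Au\<^sup>2 + Az\<^sup>2"

text \<open>Near-optimal meshes with \<open>n\<close> extra elements each are overlaid with the
  current mesh so that the estimator drops by \<open>\<kappa>\<close>. The elements refined on the
  way then form an admissible marking set, and quasi-minimality of \<open>\<M> l\<close> compares
  with it.\<close>

lemma marked_card_le:
  assumes pos: "0 < err (\<T> l)"
  shows "real (card (\<M> l)) \<le> 2 * Cmark * (4 * C_ov * As / \<kappa> / err (\<T> l)) powr (1 / \<beta>)"
proof -
  define \<rho>l where "\<rho>l = err (\<T> l)"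
  \<comment> \<open>Chosen so that \<open>2 * C_ov * As * (n + 1) powr - \<beta>\<close> is at most
    half of \<open>\<kappa> * \<rho>l\<close>; the other half is reserved for the slack
    \<open>\<epsilon>\<close>.\<close>
  define x where "x = (4 * C_ov * As / \<kappa> / \<rho>l) powr (1 / \<beta>)"
  \<comment> \<open>Rounding down gives \<open>n \<le> x \<le> n + 1\<close>: the rate sees
    \<open>n + 1\<close> while the cardinality sees \<open>n\<close>, so no additive constant
    remains in the count.\<close>
  define n where "n = nat \<lfloor>x\<rfloor>"
  define \<epsilon> where "\<epsilon> = sqrt (\<kappa> * \<rho>l / (8 * C_ov))"
  have \<beta>: "0 < \<beta>" using st by simp
  have pos': "0 < \<rho>l" using pos by (simp add: \<rho>l_def)
  have x: "0 \<le> x" by (simp add: x_def)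
  have n: "real n \<le> x" "x \<le> real (n + 1)" using x by (auto simp: n_def) linarith
  have \<epsilon>: "0 < \<epsilon>" "4 * C_ov * \<epsilon>\<^sup>2 = \<kappa> * \<rho>l / 2"
    using \<kappa> pos' C_ov_pos by (auto simp: \<epsilon>_def field_simps)
  have fin': "approx_norm refine T0 s (\<lambda>TH. est \<eta> TH TH (uH TH)) < \<infinity>"
    "approx_norm refine T0 t (\<lambda>TH. est \<zeta> TH TH (zH TH u)) < \<infinity>"
    using fin by (auto simp: less_top)
  obtain T1 where T1: "T1 \<in> R T0" "card T1 \<le> card T0 + n"
    "est \<eta> T1 T1 (uH T1) \<le> Au * real (n + 1) powr - s + \<epsilon>"
    using approx_norm_witness[OF fin'(1) est_nonneg \<epsilon>(1)] by blast
  obtain T2 where T2: "T2 \<in> R T0" "card T2 \<le> card T0 + n"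
    "est \<zeta> T2 T2 (zH T2 u) \<le> Az * real (n + 1) powr - t + \<epsilon>"
    using approx_norm_witness[OF fin'(2) est_nonneg \<epsilon>(1)] by blast
  obtain \<T>' where \<T>': "\<T>' \<in> R T1" "\<T>' \<in> R T2" "\<T>' \<in> R (\<T> l)"
    "card \<T>' + 2 * card T0 \<le> card T1 + card T2 + card (\<T> l)"
    using overlay3[OF T1(1) T2(1) run_in[OF alg]] by blast
  have rate: "(B * real (n + 1) powr - r)\<^sup>2 \<le> B\<^sup>2 * real (n + 1) powr - \<beta>" if "\<beta> \<le> 2 * r" for B r
  proof -
    have "(real (n + 1) powr - r)\<^sup>2 = real (n + 1) powr (- (2 * r))"
      by (simp add: power2_eq_square flip: powr_add)
    also have "\<dots> \<le> real (n + 1) powr - \<beta>" using that by (intro powr_mono) auto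
    finally show ?thesis unfolding power_mult_distrib by (rule mult_left_mono) simp
  qed
  have "(est \<eta> T1 T1 (uH T1))\<^sup>2 \<le> (Au * real (n + 1) powr - s + \<epsilon>)\<^sup>2"
    using T1(3) est_nonneg by (rule power_mono)
  also have "\<dots> \<le> 2 * (Au * real (n + 1) powr - s)\<^sup>2 + 2 * \<epsilon>\<^sup>2" by (rule power2_add_le)
  finally have 1: "(est \<eta> T1 T1 (uH T1))\<^sup>2 \<le> 2 * (Au\<^sup>2 * real (n + 1) powr - \<beta>) + 2 * \<epsilon>\<^sup>2"
    using rate[of s Au] by simp
  have "(est \<zeta> T2 T2 (zH T2 u))\<^sup>2 \<le> (Az * real (n + 1) powr - t + \<epsilon>)\<^sup>2"
    using T2(3) est_nonneg by (rule power_mono)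
  also have "\<dots> \<le> 2 * (Az * real (n + 1) powr - t)\<^sup>2 + 2 * \<epsilon>\<^sup>2" by (rule power2_add_le)
  finally have 2: "(est \<zeta> T2 T2 (zH T2 u))\<^sup>2 \<le> 2 * (Az\<^sup>2 * real (n + 1) powr - \<beta>) + 2 * \<epsilon>\<^sup>2"
    using rate[of t Az] by simp
  have "err \<T>' \<le> C_ov * ((est \<eta> T1 T1 (uH T1))\<^sup>2 + (est \<zeta> T2 T2 (zH T2 u))\<^sup>2)"
    using overlay_estimator[OF T1(1) T2(1) \<T>'(1,2)] .
  also have "\<dots> \<le> C_ov * (2 * (As * real (n + 1) powr - \<beta>) + 4 * \<epsilon>\<^sup>2)"
    using 1 2 C_ov_pos by (intro mult_left_mono) (auto simp: distrib_right)
  also have "\<dots> = 2 * C_ov * As * real (n + 1) powr - \<beta> + 4 * C_ov * \<epsilon>\<^sup>2"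
    by (simp only: distrib_left mult_ac)
  also have "\<dots> \<le> \<kappa> * \<rho>l"
  proof -
    have "4 * C_ov * As / \<kappa> / \<rho>l = x powr \<beta>"
      unfolding x_def using \<kappa> pos' C_ov_pos \<beta> by (subst powr_inverse_powr) auto
    also have "\<dots> \<le> real (n + 1) powr \<beta>" using x n(2) \<beta> by (intro powr_mono2) auto
    finally have "2 * C_ov * As \<le> \<kappa> * \<rho>l / 2 * real (n + 1) powr \<beta>" using \<kappa> pos' by (simp add: field_simps)
    then have "2 * C_ov * As * real (n + 1) powr - \<beta> \<le> \<kappa> * \<rho>l / 2 * real (n + 1) powr \<beta> * real (n + 1) powr - \<beta>"
      by (rule mult_right_mono) simp
    also have "\<dots> = \<kappa> * \<rho>l / 2" by (simp add: mult.assoc flip: powr_add)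
    finally show ?thesis using \<epsilon>(2) by simp
  qed
  finally have "err \<T>' \<le> \<kappa> * err (\<T> l)" by (simp add: \<rho>l_def)
  then have "\<theta> * err (\<T> l) \<le> \<rho> (\<T> l) (\<T> l - \<T>')"
    by (rule Doerfler_optimality[OF run_in[OF alg] \<T>'(3) _ \<delta>])
  then have "real (card (\<M> l)) \<le> Cmark * real (card (\<T> l - \<T>'))"
    using alg by (auto simp: algorithm_B_def)
  also have "\<dots> \<le> Cmark * (2 * real n)"
  proof (intro mult_left_mono)
    \<comment> \<open>Every refined element has at least two sons, so refined elements are counted
      by the growth of the mesh, which the overlay limits to the \<open>2 * n\<close> extra
      elements.\<close>
    have "card (\<T> l - \<T>') + card (\<T> l) \<le> card \<T>'"
      using mesh[unfolded mesh_refinement_def, THEN conjunct2, THEN conjunct2, THEN conjunct1,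
          rule_format, OF run_in[OF alg] \<T>'(3)] .
    then have "card (\<T> l - \<T>') \<le> 2 * n" using \<T>'(4) T1(2) T2(2) by linarith
    then show "real (card (\<T> l - \<T>')) \<le> 2 * real n" by linarith
  qed (use Cmark in simp)
  also have "\<dots> \<le> Cmark * (2 * x)" using n(1) Cmark by (intro mult_left_mono) auto
  finally show ?thesis by (simp add: x_def \<rho>l_def mult_ac)
qed

text \<open>Mesh closure bounds the new elements by the sum of all marked sets. Linear convergence
  expresses each earlier estimator through the current one, so these cardinalities form a geometric
  series dominated by its last terms.\<close>

lemma optimal_rate:
  assumes conv: "\<And>l n. l \<le> n \<Longrightarrow> err (\<T> n) \<le> Clin * qlin ^ (n - l) * err (\<T> l)"
    and Clin: "0 < Clin" and qlin: "0 < qlin" "qlin < 1" and S: "min s t \<le> S"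
    and card: "card T0 < card (\<T> l)"
  shows "err (\<T> l) \<le> max 1 (2 * Cmesh * Cmark / (1 - qlin powr (1 / (2 * S)))) powr (2 * S) * Clin * (4 * C_ov / \<kappa>)
     * As * (real (card (\<T> l)) - real (card T0)) powr (- \<beta>)"
proof (cases "err (\<T> l) = 0")
  case True
  then show ?thesis using Clin C_ov_pos \<kappa> by simp
next
  case False
  define \<rho>l where "\<rho>l = err (\<T> l)"
  define W where "W = 4 * C_ov * As / \<kappa>"
  define E where "E = real (card (\<T> l)) - real (card T0)"
  define r where "r = qlin powr (1 / \<beta>)"
  \<comment> \<open>Since \<open>\<beta> \<le> 2 * S\<close>, the ratio \<open>r\<close> never
    exceeds \<open>r0\<close>. Together with the maximum with 1 in \<open>Q\<close>, which allows
    \<open>Q powr \<beta> \<le> Q powr (2 * S)\<close>, this makes the constant depend on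
    \<open>S\<close> instead of on \<open>s\<close> and \<open>t\<close>.\<close>
  define r0 where "r0 = qlin powr (1 / (2 * S))"
  define Q where "Q = max 1 (2 * Cmesh * Cmark / (1 - r0))"
  have \<beta>: "0 < \<beta>" "\<beta> \<le> 2 * S" using st S by auto
  have \<rho>l: "0 < \<rho>l" using False combined_est_sq_nonneg[of "\<T> l" "\<T> l"] by (simp add: \<rho>l_def)
  have W: "0 \<le> W" using C_ov_pos \<kappa> by (simp add: W_def)
  have E: "0 < E" using card by (simp add: E_def)
  have "1 / (2 * S) \<le> 1 / \<beta>" using \<beta> by (intro divide_left_mono) auto
  then have r: "0 < r" "r \<le> r0" using qlin by (auto simp: r_def r0_def powr_mono')
  have "0 < S" using \<beta> by linarith
  then have r0: "r0 < 1" using qlin powr_less_mono2[of "1 / (2 * S)" qlin 1] by (simp add: r0_def)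
  define P where "P = (W * Clin / \<rho>l) powr (1 / \<beta>)"
  have marked: "real (card (\<M> j)) \<le> 2 * Cmark * (P * r ^ (l - Suc j))" if j: "j < l" for j
  proof -
    have \<rho>j: "\<rho>l \<le> Clin * qlin ^ (l - j) * err (\<T> j)" using conv[of j l] j by (simp add: \<rho>l_def)
    have "0 < err (\<T> j)"
    proof (rule ccontr)
      assume "\<not> ?thesis"
      then have "err (\<T> j) = 0" using combined_est_sq_nonneg[of "\<T> j" "\<T> j"] by linarith
      then show False using \<rho>j \<rho>l by simp
    qed
    note pos = this
    have "W / err (\<T> j) \<le> W * (Clin * qlin ^ (l - j) / \<rho>l)"
    proof -
      have "1 / err (\<T> j) \<le> Clin * qlin ^ (l - j) / \<rho>l" using \<rho>j pos \<rho>l by (simp add: field_simps)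
      from mult_left_mono[OF this W] show ?thesis by simp
    qed
    then have "(W / err (\<T> j)) powr (1 / \<beta>) \<le> (W * (Clin * qlin ^ (l - j) / \<rho>l)) powr (1 / \<beta>)"
      using W pos \<beta> by (intro powr_mono2) auto
    also have "W * (Clin * qlin ^ (l - j) / \<rho>l) = (W * Clin / \<rho>l) * qlin ^ (l - j)" by simp
    also have "((W * Clin / \<rho>l) * qlin ^ (l - j)) powr (1 / \<beta>) = P * r ^ (l - j)"
    proof -
      have "(qlin ^ (l - j)) powr (1 / \<beta>) = r ^ (l - j)"
        using qlin by (simp add: r_def powr_powr mult.commute flip: powr_realpow)
      then show ?thesis unfolding P_def using qlin W Clin \<rho>l by (subst powr_mult) auto
    qed
    \<comment> \<open>One power of \<open>r < 1\<close> is given away so that reversing the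
      summation index yields the sum of \<open>r ^ j\<close> over \<open>j < l\<close>.\<close>
    also have "\<dots> \<le> P * r ^ (l - Suc j)"
      using r r0 by (intro mult_left_mono power_decreasing) (auto simp: P_def)
    finally have "2 * Cmark * (W / err (\<T> j)) powr (1 / \<beta>) \<le> 2 * Cmark * (P * r ^ (l - Suc j))"
      by (rule mult_left_mono) (use Cmark in simp)
    then show ?thesis unfolding W_def by (rule order_trans[OF marked_card_le[OF pos]])
  qed
  have "\<T> 0 = T0 \<and> (\<forall>j. \<M> j \<subseteq> \<T> j \<and> \<T> (Suc j) = refine (\<T> j) (\<M> j))"
    using alg by (simp add: algorithm_B_def)
  from mesh[unfolded mesh_refinement_def, THEN conjunct2, THEN conjunct2, THEN conjunct2, THEN conjunct1,
      rule_format, OF this]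
  have "E \<le> Cmesh * (\<Sum>j<l. real (card (\<M> j)))" by (simp add: E_def)
  also have "\<dots> \<le> Cmesh * (\<Sum>j<l. 2 * Cmark * (P * r ^ (l - Suc j)))"
    using marked params by (intro mult_left_mono sum_mono) auto
  also have "(\<Sum>j<l. 2 * Cmark * (P * r ^ (l - Suc j))) = 2 * Cmark * P * (\<Sum>j<l. r ^ j)"
    using sum.nat_diff_reindex[of "\<lambda>j. r ^ j" l] by (simp add: sum_distrib_left mult.assoc flip: sum_distrib_left)
  also have "Cmesh * (2 * Cmark * P * (\<Sum>j<l. r ^ j)) \<le> Cmesh * (2 * Cmark * P * (1 / (1 - r0)))"
  proof (intro mult_left_mono)
    have "(1 - r) * (\<Sum>j<l. r ^ j) = 1 - r ^ l" by (simp add: one_diff_power_eq)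
    then have "(1 - r) * (\<Sum>j<l. r ^ j) \<le> 1" using r by simp
    then have "(\<Sum>j<l. r ^ j) \<le> 1 / (1 - r)" using r r0 by (simp add: field_simps)
    also have "\<dots> \<le> 1 / (1 - r0)" using r r0 by (intro divide_left_mono) auto
    finally show "(\<Sum>j<l. r ^ j) \<le> 1 / (1 - r0)" .
  qed (use params Cmark in \<open>auto simp: P_def\<close>)
  also have "\<dots> = (2 * Cmesh * Cmark / (1 - r0)) * P" by simp
  also have "\<dots> \<le> Q * P" by (intro mult_right_mono) (auto simp: Q_def P_def)
  finally have "E powr \<beta> \<le> (Q * P) powr \<beta>" using E \<beta> by (intro powr_mono2) auto
  also have "\<dots> = Q powr \<beta> * (W * Clin / \<rho>l)"
  proof -
    have "0 \<le> W * Clin / \<rho>l" using W Clin \<rho>l by simp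
    then show ?thesis using \<beta> by (simp add: P_def powr_mult powr_inverse_powr Q_def)
  qed
  also have "\<dots> \<le> Q powr (2 * S) * (W * Clin / \<rho>l)"
    using W Clin \<rho>l \<beta> by (intro mult_right_mono powr_mono) (auto simp: Q_def)
  finally have "E powr \<beta> \<le> Q powr (2 * S) * (W * Clin / \<rho>l)" .
  then have "\<rho>l * E powr \<beta> \<le> Q powr (2 * S) * (W * Clin)" using \<rho>l by (simp add: field_simps)
  then have "\<rho>l * E powr \<beta> * E powr - \<beta> \<le> Q powr (2 * S) * (W * Clin) * E powr - \<beta>"
    by (rule mult_right_mono) simp
  moreover have "\<rho>l * E powr \<beta> * E powr - \<beta> = \<rho>l" using E by (simp add: mult.assoc flip: powr_add)
  ultimately have "\<rho>l \<le> Q powr (2 * S) * (W * Clin) * E powr - \<beta>" by simp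
  then show ?thesis unfolding \<rho>l_def E_def W_def Q_def r0_def by (simp add: mult_ac)
qed

end

end

text \<open>In part (ii), \<open>S\<close> only bounds \<open>min s t\<close> and lets one constant
  serve a whole range of rates; a given pair is covered by \<open>S = min s t\<close>. The guard on
  the cardinality is needed because \<open>0 powr (- x)\<close> is 0 in HOL, whereas the intended
  bound is void on the initial mesh. Finiteness of the sum makes \<open>enn2real\<close>
  faithful.\<close>

theorem theorem5:
  fixes \<Omega> :: "(real^'d) set"
    and A :: "real^'d \<Rightarrow> real^'d^'d"
    and b :: "real^'d \<Rightarrow> real^'d"
    and c :: "real^'d \<Rightarrow> real"
    and K :: "(real^'d \<Rightarrow> real) \<Rightarrow> (real^'d \<Rightarrow> real) \<Rightarrow> real"
  assumes "2 \<le> CARD('d)"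
    and "bounded_lipschitz_domain \<Omega>"
    and "admissible_coefficients \<Omega> A b c"
    and "compact_operator \<Omega> K"
  shows
    "(\<forall>\<theta> qred Cstab Crel. 0 < \<theta> \<and> \<theta> \<le> 1 \<longrightarrow>
       (\<exists>l0 Clin qlin. 0 < Clin \<and> 0 < qlin \<and> qlin < 1 \<and>
         (\<forall>Cmark Cdrel Cmesh f fv p \<T>\<^sub>0 refine \<eta> \<zeta> u z uH zH \<T> \<M>.
            1 \<le> Cmark \<and>
            afem_setting \<Omega> A b c K qred Cstab Crel Cdrel Cmesh f fv p \<T>\<^sub>0 refine \<eta> \<zeta> u z uH zH \<and>
            algorithm_B \<T>\<^sub>0 refine \<eta> \<zeta> uH zH \<theta> Cmark \<T> \<M> \<longrightarrow>
            (\<forall>l n. l0 \<le> l \<and> l \<le> n \<longrightarrow>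
               combined_est_sq \<eta> \<zeta> uH zH (\<T> n) (\<T> n)
                 \<le> Clin * qlin ^ (n - l) * combined_est_sq \<eta> \<zeta> uH zH (\<T> l) (\<T> l)))))
     \<and>
     (\<forall>\<theta> qred Cstab Crel. 0 < \<theta> \<longrightarrow>
       (\<exists>l0. \<forall>Cmark Cdrel Cmesh S.
         1 \<le> Cmark \<and> \<theta> < inverse (1 + Cstab\<^sup>2 * Cdrel\<^sup>2) \<longrightarrow>
         (\<exists>Copt>0. \<forall>s t f fv p \<T>\<^sub>0 refine \<eta> \<zeta> u z uH zH \<T> \<M>.
            0 < s \<and> 0 < t \<and> min s t \<le> S \<and>
            afem_setting \<Omega> A b c K qred Cstab Crel Cdrel Cmesh f fv p \<T>\<^sub>0 refine \<eta> \<zeta> u z uH zH \<and>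
            algorithm_B \<T>\<^sub>0 refine \<eta> \<zeta> uH zH \<theta> Cmark \<T> \<M> \<and>
            approx_norm refine \<T>\<^sub>0 s (\<lambda>\<T>\<^sub>H. est \<eta> \<T>\<^sub>H \<T>\<^sub>H (uH \<T>\<^sub>H))
              + approx_norm refine \<T>\<^sub>0 t (\<lambda>\<T>\<^sub>H. est \<zeta> \<T>\<^sub>H \<T>\<^sub>H (zH \<T>\<^sub>H u)) < \<infinity> \<longrightarrow>
            (\<forall>l. l0 \<le> l \<and> card \<T>\<^sub>0 < card (\<T> l) \<longrightarrow>
               combined_est_sq \<eta> \<zeta> uH zH (\<T> l) (\<T> l)
                 \<le> Copt *
                    ((enn2real (approx_norm refine \<T>\<^sub>0 s (\<lambda>\<T>\<^sub>H. est \<eta> \<T>\<^sub>H \<T>\<^sub>H (uH \<T>\<^sub>H))))\<^sup>2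
                     + (enn2real (approx_norm refine \<T>\<^sub>0 t (\<lambda>\<T>\<^sub>H. est \<zeta> \<T>\<^sub>H \<T>\<^sub>H (zH \<T>\<^sub>H u))))\<^sup>2) *
                    (real (card (\<T> l)) - real (card \<T>\<^sub>0)) powr (- min (2 * s) (2 * t))))))"
proof -
  interpret bounded_open \<Omega>
    using assms(2) by unfold_locales (auto simp: bounded_lipschitz_domain_def)
  obtain Ca \<alpha> Cb where ell: "elliptic_forms (H10 \<Omega>) (energy_norm \<Omega> A) (bilin \<Omega> A b c) K Ca \<alpha> Cb"
    using elliptic_forms_model_problem[OF assms(3,4)] by blast
  note linear = uniform_linear_convergence[OF bounded_open_axioms ell]
  show ?thesis
  proof (intro conjI allI impI, goal_cases)
    case (1 \<theta> qred Cstab Crel)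
    then have "0 < \<theta>" "\<theta> \<le> 1" by auto
    from linear[OF this, of qred Cstab Crel] obtain Clin qlin where
      q: "0 < Clin" "0 < qlin" "qlin < 1"
      and conv: "linear_rate \<Omega> A b c K \<theta> qred Cstab Crel Clin qlin"
      by blast
    show ?case
      by (rule exI[of _ 0], rule exI[of _ Clin], rule exI[of _ qlin], intro conjI allI impI q)
        (elim conjE, rule conv[unfolded linear_rate_def, rule_format])
  next
    case (2 \<theta> qred Cstab Crel)
    show ?case
    proof (rule exI[of _ 0], intro allI impI, goal_cases)
      case (1 Cmark Cdrel Cmesh S)
      let ?C = "Cstab * Cdrel"
      have pos: "0 < 1 + ?C\<^sup>2" by (simp add: add_pos_nonneg)
      have small: "\<theta> * (1 + ?C\<^sup>2) < 1"
        using 1 pos by (simp add: power_mult_distrib field_simps)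
      \<comment> \<open>Linear convergence asks for \<open>\<theta> \<le> 1\<close>, which here
        follows from the optimality threshold.\<close>
      have "\<theta> * 1 \<le> \<theta> * (1 + ?C\<^sup>2)" using 2 by (intro mult_left_mono) auto
      then have "\<theta> \<le> 1" using small by linarith
      from linear[OF 2 this, of qred Cstab Crel] obtain Clin qlin where
        q: "0 < Clin" "0 < qlin" "qlin < 1"
        and conv: "linear_rate \<Omega> A b c K \<theta> qred Cstab Crel Clin qlin"
        by blast
      obtain \<delta> \<kappa> where \<delta>: "0 < \<delta>" and \<kappa>: "0 < \<kappa>"
        and \<delta>\<kappa>: "\<theta> * (1 + (1 + \<delta>) * ?C\<^sup>2) \<le> 1 - (1 + 1 / \<delta>) * \<kappa>"
        by (rule Doerfler_constants[OF 2 small])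
      \<comment> \<open>Only numbers available at this point occur; inside the later interpretation
        the overlay factor turns out to be \<open>C_ov\<close>.\<close>
      let ?Copt = "max 1 (2 * Cmesh * Cmark / (1 - qlin powr (1 / (2 * S)))) powr (2 * S) * Clin
        * (4 * overlay_constant (2 * Cb / \<alpha>) Cstab Crel Cdrel / \<kappa>)"
      show ?case
      proof (rule exI[of _ ?Copt], intro conjI allI impI, goal_cases)
        case 1
        have "0 < max 1 (2 * Cmesh * Cmark / (1 - qlin powr (1 / (2 * S)))) powr (2 * S)" by simp
        then show ?case using q(1) \<kappa> overlay_constant_pos by (intro mult_pos_pos divide_pos_pos) auto
      next
        case (2 s t f fv p T0 refine \<eta> \<zeta> u z uH zH \<T> \<M> l)
        then have setting: "afem_setting \<Omega> A b c K qred Cstab Crel Cdrel Cmesh f fv p T0 refine \<eta> \<zeta> u z uH zH"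
          and alg: "algorithm_B T0 refine \<eta> \<zeta> uH zH \<theta> Cmark \<T> \<M>"
          and st: "0 < s" "0 < t" "min s t \<le> S" and card: "card T0 < card (\<T> l)"
          and fin: "approx_norm refine T0 s (\<lambda>TH. est \<eta> TH TH (uH TH))
              + approx_norm refine T0 t (\<lambda>TH. est \<zeta> TH TH (zH TH u)) < \<infinity>"
          by auto
        have Cmark: "1 \<le> Cmark" using 1 by simp
        interpret afem \<Omega> A b c K Ca \<alpha> Cb qred Cstab Crel Cdrel Cmesh f fv p T0 refine \<eta> \<zeta> u z uH zH
          using bounded_open_axioms ell setting by (simp add: afem_def afem_axioms_def)
        show ?case
          by (rule optimal_rate[unfolded C_ov_def, OF alg Cmark \<delta> \<delta>\<kappa> \<kappa> st(1,2) fin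
                conv[unfolded linear_rate_def, rule_format, OF setting alg] q st(3) card])
      qed
    qed
  qed
qed

end
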